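(* Assume that $c^{-1}\le\lambda_{\min}(\boldsymbol\Sigma)\le\lambda_{\max}(\boldsymbol\Sigma)\le c$ and $c^{-1}\le\lambda_{\min}(\boldsymbol\Psi)\le\lambda_{\max}(\boldsymbol\Psi)\le c$ for some constant $c>0$ not depending on $n,p$. Then, for $1\le i<j\le p$, $$\frac{\sqrt n(\hat\rho_{ij}-\rho_{ij})}{\sqrt{B_n}(1-\rho_{ij}^2)}\Rightarrow N(0,1)\quad\text{as }n\to\infty,$$ where $B_n=\|\boldsymbol\Psi\|_{\mathrm F}^2/n$ and $\Rightarrow$ denotes convergence in distribution.
   Context: Setting: $p=p_n$, and all parameters may depend on $n,p$. The $p\times n$ data matrix $\mathbf X=(\boldsymbol X_1,\ldots,\boldsymbol X_n)$ with columns $\boldsymbol X_i=(X_{i1},\ldots,X_{ip})'$ is matrix-variate normal, $\mathbf X\sim N(\boldsymbol\mu\mathbf 1',\boldsymbol\Sigma\otimes\boldsymbol\Psi)$, meaning $\mathrm{vec}(\mathbf X')\sim N(\mathrm{vec}(\mathbf 1\boldsymbol\mu'),\boldsymbol\Sigma\otimes\boldsymbol\Psi)$; equivalently the $X_{ik}$ are jointly Gaussian with $\mathbb E X_{ik}=\mu_k$ and $\mathrm{Cov}(X_{ik},X_{jl})=\psi_{ij}\sigma_{kl}$. Here $\boldsymbol\Sigma=(\sigma_{kl})_{p\times p}$ and $\boldsymbol\Psi=(\psi_{ij})_{n\times n}$ are covariance matrices with $\psi_{ii}=1$ for all $i$; $\lambda_{\min}(\cdot)$ and $\lambda_{\max}(\cdot)$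 denote the smallest and largest eigenvalues. $\|\cdot\|_{\mathrm F}$ is the Frobenius norm. $\rho_{ij}=\sigma_{ij}/\sqrt{\sigma_{ii}\sigma_{jj}}$ is the Pearson correlation coefficient; with $\bar X_i=\frac1n\sum_{k=1}^nX_{ki}$ and $\hat\sigma_{ij}=\frac1{n-1}\sum_{k=1}^n(X_{ki}-\bar X_i)(X_{kj}-\bar X_j)$, the sample correlation coefficient is $\hat\rho_{ij}=\hat\sigma_{ij}/\sqrt{\hat\sigma_{ii}\hat\sigma_{jj}}$. *)

theory Defs
  imports "HOL-Probability.Probability" "Jordan_Normal_Form.Spectral_Radius"
begin

text \<open>
  All matrix and sample indices start at \<open>0\<close>. Matrices have the type \<open>real mat\<close>, since their
  dimensions vary with the sample size.
\<close>

definition covariance_matrix :: "nat \<Rightarrow> real mat \<Rightarrow> bool" where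
  "covariance_matrix d A \<longleftrightarrow>
     A \<in> carrier_mat d d \<and> transpose_mat A = A \<and>
     (\<forall>v\<in>carrier_vec d. 0 \<le> scalar_prod v (mult_mat_vec A v))"

text \<open>Meaningful for symmetric \<open>A\<close> of positive dimension: the spectrum is then finite, nonempty and real.\<close>

definition lambda_min :: "real mat \<Rightarrow> real" where
  "lambda_min A = Min (spectrum A)"

definition lambda_max :: "real mat \<Rightarrow> real" where
  "lambda_max A = Max (spectrum A)"

definition frobenius_norm :: "real mat \<Rightarrow> real" where
  "frobenius_norm A = sqrt (\<Sum>i<dim_row A. \<Sum>j<dim_col A. (A $$ (i, j))\<^sup>2)"

text \<open>The second disjunct is the degenerate normal law with variance \<open>0\<close>.\<close>

definition gaussian_rv :: "'a measure \<Rightarrow> ('a \<Rightarrow> real) \<Rightarrow> bool" where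
  "gaussian_rv M Y \<longleftrightarrow> Y \<in> borel_measurable M \<and>
     ((\<exists>m s. 0 < s \<and> distributed M lborel Y (normal_density m s)) \<or>
      (\<exists>m. AE \<omega> in M. Y \<omega> = m))"

definition jointly_gaussian :: "'a measure \<Rightarrow> 'i set \<Rightarrow> ('i \<Rightarrow> 'a \<Rightarrow> real) \<Rightarrow> bool" where
  "jointly_gaussian M I Y \<longleftrightarrow> (\<forall>a. gaussian_rv M (\<lambda>\<omega>. \<Sum>t\<in>I. a t * Y t \<omega>))"

definition covariance :: "'a measure \<Rightarrow> ('a \<Rightarrow> real) \<Rightarrow> ('a \<Rightarrow> real) \<Rightarrow> real" where
  "covariance M Y Z =
     (LINT \<omega>|M. (Y \<omega> - (LINT \<omega>'|M. Y \<omega>')) * (Z \<omega> - (LINT \<omega>'|M. Z \<omega>')))"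

text \<open>
  The matrix-variate normal law \<open>N(\<mu> 1', \<Sigma> \<otimes> \<Psi>)\<close> of a random matrix \<open>X\<close> with
  \<open>dim_row \<Sigma>\<close> rows (variables) and \<open>dim_row \<Psi>\<close> columns (observations). The coordinate of
  observation \<open>i\<close> in variable \<open>k\<close>, usually written \<open>X\<^sub>i\<^sub>k\<close>, is the matrix entry at \<open>(k, i)\<close>.
\<close>

definition matrix_normal ::
  "'a measure \<Rightarrow> ('a \<Rightarrow> real mat) \<Rightarrow> real vec \<Rightarrow> real mat \<Rightarrow> real mat \<Rightarrow> bool" where
  "matrix_normal M X \<mu> \<Sigma> \<Psi> \<longleftrightarrow>
     (let p = dim_row \<Sigma>; n = dim_row \<Psi> in
       (\<forall>\<omega>\<in>space M. X \<omega> \<in> carrier_mat p n) \<and>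
       jointly_gaussian M ({..<p} \<times> {..<n}) (\<lambda>t \<omega>. X \<omega> $$ t) \<and>
       (\<forall>k<p. \<forall>i<n. (LINT \<omega>|M. X \<omega> $$ (k, i)) = vec_index \<mu> k) \<and>
       (\<forall>k<p. \<forall>l<p. \<forall>i<n. \<forall>j<n.
          covariance M (\<lambda>\<omega>. X \<omega> $$ (k, i)) (\<lambda>\<omega>. X \<omega> $$ (l, j)) = \<Psi> $$ (i, j) * \<Sigma> $$ (k, l)))"

definition pearson_corr :: "real mat \<Rightarrow> nat \<Rightarrow> nat \<Rightarrow> real" where
  "pearson_corr \<Sigma> i j = \<Sigma> $$ (i, j) / sqrt (\<Sigma> $$ (i, i) * \<Sigma> $$ (j, j))"

text \<open>In the sample statistics, \<open>x\<close> is a data matrix whose columns are the observations.\<close>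

definition sample_mean :: "real mat \<Rightarrow> nat \<Rightarrow> real" where
  "sample_mean x i = (\<Sum>k<dim_col x. x $$ (i, k)) / real (dim_col x)"

definition sample_cov :: "real mat \<Rightarrow> nat \<Rightarrow> nat \<Rightarrow> real" where
  "sample_cov x i j =
     (\<Sum>k<dim_col x. (x $$ (i, k) - sample_mean x i) * (x $$ (j, k) - sample_mean x j)) /
     (real (dim_col x) - 1)"

definition sample_corr :: "real mat \<Rightarrow> nat \<Rightarrow> nat \<Rightarrow> real" where
  "sample_corr x i j = sample_cov x i j / sqrt (sample_cov x i i * sample_cov x j j)"

end

theory Submission
  imports Defs "HOL-Real_Asymp.Real_Asymp"
begin

text \<open>
  Standardize the rows \<open>i\<close> and \<open>j\<close> of the data matrix to \<open>y\<close> and \<open>z\<close>: Gaussian vectors with covariance matrix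
  \<open>\<Psi>\<close> and cross covariance \<open>\<rho>\<Psi>\<close>. With \<open>\<gamma>\<^sup>2 + \<delta>\<^sup>2 = 1\<close> and \<open>2\<gamma>\<delta> = \<rho>\<close> they have the form \<open>y = \<gamma>w + \<delta>s\<close> and
  \<open>z = \<delta>w + \<gamma>s\<close>, where \<open>w\<close> and \<open>s\<close> are independent with covariance \<open>\<Psi>\<close> (\<open>decorrelate\<close>). Write \<open>S\<^sub>a\<^sub>b\<close> for centred
  sums of cross products and \<open>F\<close> for the Frobenius norm of \<open>\<Psi>\<close>. Then
  \<open>S\<^sub>y\<^sub>z - \<rho> (S\<^sub>y\<^sub>y + S\<^sub>z\<^sub>z)/2 = (1 - \<rho>\<^sup>2) S\<^sub>w\<^sub>s\<close>. Hence the normalized correlation coefficient is \<open>S\<^sub>w\<^sub>s / F\<close>, up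
  to a factor tending to \<open>1\<close> and a remainder of second order in \<open>S\<^sub>w\<^sub>w - S\<^sub>s\<^sub>s\<close>; the factor \<open>1 - \<rho>\<^sup>2\<close> cancels from
  the remainder too (\<open>normalized_correlation_expansion\<close>).

  The leading term is asymptotically normal for the following reason. Given \<open>w\<close>, the inner product of \<open>w\<close>
  and \<open>s\<close> is normal with variance \<open>w'\<Psi>w\<close>. This variance has mean \<open>F\<^sup>2\<close>, which is at least \<open>n\<close>, and
  standard deviation at most \<open>2cF\<close>, so \<open>w'\<Psi>w / F\<^sup>2\<close> is close to \<open>1\<close>. Averaging \<open>exp(-t\<^sup>2 w'\<Psi>w / (2F\<^sup>2))\<close> over \<open>w\<close>
  gives almost \<open>exp(-t\<^sup>2/2)\<close> (\<open>inner_product_clt\<close>). All other terms are controlled through second moments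
  of bilinear forms in independent Gaussian vectors. Quadratic forms reduce to these, since
  \<open>w'Aw - s'As = 2 h'Ag\<close> for symmetric \<open>A\<close>, and the rotated pair \<open>h = (w - s)/\<surd>2\<close>, \<open>g = (w + s)/\<surd>2\<close> has the same
  joint law as \<open>w\<close>, \<open>s\<close>. Explicit error bounds in terms of \<open>c\<close> and \<open>n\<close> (\<open>normalized_cf_bound\<close>) and Levy's
  continuity theorem give the limit.

  Two general facts enter. Joint normality is a statement about the laws of linear combinations, so
  independence has to be recovered from a factorization of characteristic functions; this is done one
  coordinate at a time from Levy's uniqueness theorem, with complex weights
  (\<open>indep_var_if_char_factorizes\<close>). The bound on the eigenvalues of \<open>\<Psi>\<close> is turned into a bound on its
  operator norm by maximizing the quadratic form over the unit sphere (\<open>rayleigh_maximizer\<close>).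
\<close>

section \<open>Uniqueness of Fourier transforms with complex weights, and independence\<close>

lemma norm_iexp [simp]: "cmod (iexp x) = 1"
  using norm_exp_i_times[of x] by simp

text \<open>
  A bounded real weight becomes a probability density after rescaling and adding \<open>1\<close>, because the
  hypothesis at \<open>t = 0\<close> says that its integral vanishes. Levy's uniqueness theorem then compares the law
  of \<open>Y\<close> under this density with its law under the original measure.
\<close>

lemma (in prob_space) signed_fourier_uniqueness_real:
  fixes g Y :: "'a \<Rightarrow> real"
  assumes [measurable]: "g \<in> borel_measurable M" "Y \<in> borel_measurable M"
    and bnd: "\<And>\<omega>. \<bar>g \<omega>\<bar> \<le> K"
    and zero: "\<And>t. (CLINT \<omega>|M. complex_of_real (g \<omega>) * iexp (t * Y \<omega>)) = 0"
    and B[measurable]: "B \<in> sets borel"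
  shows "(LINT \<omega>|M. g \<omega> * indicator B (Y \<omega>)) = 0"
proof -
  (* K may be 0, so the weight is divided by K + 1. *)
  define L where "L = K + 1"
  have L: "L > 0" using bnd[of undefined] unfolding L_def by linarith
  have gi: "integrable M g"
    by (rule integrable_const_bound[where B=K]) (use bnd in auto)
  have gint: "(LINT \<omega>|M. g \<omega>) = 0"
    using zero[of 0] by simp
  define f where "f \<omega> = 1 + g \<omega> / L" for \<omega>
  have [measurable]: "f \<in> borel_measurable M" unfolding f_def by measurable
  have fpos: "f \<omega> \<ge> 0" for \<omega>
  proof -
    have "\<bar>g \<omega>\<bar> \<le> L" using bnd[of \<omega>] unfolding L_def by linarith
    then have "\<bar>g \<omega> / L\<bar> \<le> 1" using L by (simp add: field_simps)
    then show ?thesis unfolding f_def by linarith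
  qed
  have fi: "integrable M f" unfolding f_def using gi by auto
  have fint: "(LINT \<omega>|M. f \<omega>) = 1" unfolding f_def using gi gint by (simp add: prob_space)
  define D where "D = density M (\<lambda>\<omega>. ennreal (f \<omega>))"
  have pD: "prob_space D"
  proof
    have "emeasure D (space D) = (\<integral>\<^sup>+\<omega>. ennreal (f \<omega>) * indicator (space M) \<omega> \<partial>M)"
      unfolding D_def by (subst emeasure_density) auto
    also have "\<dots> = (\<integral>\<^sup>+\<omega>. ennreal (f \<omega>) \<partial>M)" by (rule nn_integral_cong) auto
    also have "\<dots> = 1" using nn_integral_eq_integral[OF fi] fpos fint by simp
    finally show "emeasure D (space D) = 1" .
  qed
  have [measurable]: "Y \<in> borel_measurable D" unfolding D_def by simp
  have r1: "real_distribution (distr D borel Y)"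
    by (intro prob_space.real_distribution_distr[OF pD]) simp
  have r2: "real_distribution (distr M borel Y)"
    by (intro real_distribution_distr) simp
  have "char (distr D borel Y) = char (distr M borel Y)"
  proof
    fix t
    have i1: "integrable M (\<lambda>\<omega>. iexp (t * Y \<omega>))"
      by (rule integrable_const_bound[where B=1]) auto
    have i2: "integrable M (\<lambda>\<omega>. complex_of_real (g \<omega>) * iexp (t * Y \<omega>))"
      by (rule integrable_const_bound[where B=K]) (use bnd in \<open>auto simp: norm_mult\<close>)
    have "char (distr D borel Y) t = (CLINT \<omega>|D. iexp (t * Y \<omega>))"
      unfolding char_def by (subst integral_distr) auto
    also have "\<dots> = (CLINT \<omega>|M. f \<omega> *\<^sub>R iexp (t * Y \<omega>))"
      unfolding D_def by (subst integral_density) (use fpos in auto)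
    also have "\<dots> = (CLINT \<omega>|M. iexp (t * Y \<omega>) + (complex_of_real (g \<omega>) * iexp (t * Y \<omega>)) / L)"
      by (rule Bochner_Integration.integral_cong) (auto simp: f_def scaleR_conv_of_real field_simps L)
    also have "\<dots> = (CLINT \<omega>|M. iexp (t * Y \<omega>))"
      using i1 i2 zero[of t] by simp
    also have "\<dots> = char (distr M borel Y) t"
      unfolding char_def by (subst integral_distr) auto
    finally show "char (distr D borel Y) t = char (distr M borel Y) t" .
  qed
  then have eq: "distr D borel Y = distr M borel Y"
    by (rule Levy_uniqueness[OF r1 r2])
  have i3: "integrable M (\<lambda>\<omega>. g \<omega> * indicator B (Y \<omega>))"
    by (rule integrable_const_bound[where B=K]) (use bnd order_trans[OF abs_ge_zero bnd] in \<open>auto simp: indicator_def\<close>)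
  have i4: "integrable M (\<lambda>\<omega>. indicator B (Y \<omega>) :: real)"
    by (rule integrable_const_bound[where B=1]) (auto simp: indicator_def)
  have "(LINT x|distr D borel Y. indicator B x :: real) = (LINT \<omega>|M. f \<omega> * indicator B (Y \<omega>))"
    unfolding D_def by (subst integral_distr) (use fpos in \<open>auto simp: integral_density\<close>)
  also have "\<dots> = (LINT \<omega>|M. indicator B (Y \<omega>) + (g \<omega> * indicator B (Y \<omega>)) / L)"
    by (rule Bochner_Integration.integral_cong) (auto simp: f_def field_simps)
  also have "\<dots> = (LINT \<omega>|M. indicator B (Y \<omega>)) + (LINT \<omega>|M. g \<omega> * indicator B (Y \<omega>)) / L"
    using i3 i4 by simp
  finally have "(LINT x|distr M borel Y. indicator B x :: real) = \<dots>" unfolding eq .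
  moreover have "(LINT x|distr M borel Y. indicator B x :: real) = (LINT \<omega>|M. indicator B (Y \<omega>))"
    by (subst integral_distr) auto
  ultimately show ?thesis using L by simp
qed

text \<open>
  Conjugation turns the hypothesis at \<open>-t\<close> into the same statement about the conjugate weight, so the
  real and the imaginary part of the weight satisfy it separately.
\<close>

lemma (in prob_space) signed_fourier_uniqueness:
  fixes g :: "'a \<Rightarrow> complex" and Y :: "'a \<Rightarrow> real"
  assumes [measurable]: "g \<in> borel_measurable M" "Y \<in> borel_measurable M"
    and bnd: "\<And>\<omega>. cmod (g \<omega>) \<le> K"
    and zero: "\<And>t. (CLINT \<omega>|M. g \<omega> * iexp (t * Y \<omega>)) = 0"
    and B[measurable]: "B \<in> sets borel"
  shows "(CLINT \<omega>|M. g \<omega> * indicator B (Y \<omega>)) = 0"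
proof -
  have gi: "integrable M (\<lambda>\<omega>. g \<omega> * iexp (t * Y \<omega>))" for t
    by (rule integrable_const_bound[where B=K]) (use bnd in \<open>auto simp: norm_mult\<close>)
  have [measurable]: "(\<lambda>\<omega>. cnj (g \<omega>)) \<in> borel_measurable M"
    by (rule borel_measurable_continuous_on[where f=cnj]) (auto intro: continuous_intros)
  have gi2: "integrable M (\<lambda>\<omega>. cnj (g \<omega>) * iexp (t * Y \<omega>))" for t
    by (rule integrable_const_bound[where B=K]) (use bnd in \<open>auto simp: norm_mult\<close>)
  have cz: "(CLINT \<omega>|M. cnj (g \<omega>) * iexp (t * Y \<omega>)) = 0" for t
  proof -
    have "(CLINT \<omega>|M. cnj (g \<omega>) * iexp (t * Y \<omega>)) = (CLINT \<omega>|M. cnj (g \<omega> * iexp ((-t) * Y \<omega>)))"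
      by (rule Bochner_Integration.integral_cong) (auto simp: exp_cnj)
    also have "\<dots> = cnj (CLINT \<omega>|M. g \<omega> * iexp ((-t) * Y \<omega>))" by (rule Bochner_Integration.integral_cnj)
    also have "\<dots> = 0" by (simp only: zero) simp
    finally show ?thesis .
  qed
  have re: "(LINT \<omega>|M. Re (g \<omega>) * indicator B (Y \<omega>)) = 0"
  proof (rule signed_fourier_uniqueness_real[where K=K])
    fix t
    have "(CLINT \<omega>|M. complex_of_real (Re (g \<omega>)) * iexp (t * Y \<omega>))
        = (CLINT \<omega>|M. (g \<omega> * iexp (t * Y \<omega>) + cnj (g \<omega>) * iexp (t * Y \<omega>)) / 2)"
      by (rule Bochner_Integration.integral_cong) (auto simp: algebra_simps complex_add_cnj simp flip: distrib_right)
    then show "(CLINT \<omega>|M. complex_of_real (Re (g \<omega>)) * iexp (t * Y \<omega>)) = 0"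
      using gi gi2 zero cz by simp
  qed (use abs_Re_le_cmod bnd in \<open>auto intro: order_trans\<close>)
  have im: "(LINT \<omega>|M. Im (g \<omega>) * indicator B (Y \<omega>)) = 0"
  proof (rule signed_fourier_uniqueness_real[where K=K])
    fix t
    have "(CLINT \<omega>|M. complex_of_real (Im (g \<omega>)) * iexp (t * Y \<omega>))
        = (CLINT \<omega>|M. (g \<omega> * iexp (t * Y \<omega>) - cnj (g \<omega>) * iexp (t * Y \<omega>)) / (2 * \<i>))"
      by (rule Bochner_Integration.integral_cong)
        (auto simp: algebra_simps complex_diff_cnj simp flip: left_diff_distrib)
    then show "(CLINT \<omega>|M. complex_of_real (Im (g \<omega>)) * iexp (t * Y \<omega>)) = 0"
      using gi gi2 zero cz by simp
  qed (use abs_Im_le_cmod bnd in \<open>auto intro: order_trans\<close>)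
  have i: "integrable M (\<lambda>\<omega>. g \<omega> * indicator B (Y \<omega>))"
    by (rule integrable_const_bound[where B=K])
      (use bnd order_trans[OF norm_ge_zero bnd] in \<open>auto simp: indicator_def norm_mult\<close>)
  have e: "Re (g \<omega> * indicator B (Y \<omega>)) = Re (g \<omega>) * indicator B (Y \<omega>)"
      "Im (g \<omega> * indicator B (Y \<omega>)) = Im (g \<omega>) * indicator B (Y \<omega>)" for \<omega>
    by (simp_all add: indicator_def)
  show ?thesis
  proof (rule complex_eqI)
    show "Re (CLINT \<omega>|M. g \<omega> * indicator B (Y \<omega>)) = Re 0"
      using re unfolding integral_Re[OF i, symmetric] e by simp
    show "Im (CLINT \<omega>|M. g \<omega> * indicator B (Y \<omega>)) = Im 0"
      using im unfolding integral_Im[OF i, symmetric] e by simp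
  qed
qed

text \<open>
  Complex weights make the induction on the number of coordinates work: for fixed frequencies of the
  other coordinates, their exponential is absorbed into the weight, and the one-dimensional result
  replaces the exponential of the new coordinate by an indicator, which is absorbed in turn.
\<close>

lemma (in prob_space) signed_fourier_uniqueness_box:
  fixes g :: "'a \<Rightarrow> complex" and Y :: "'i \<Rightarrow> 'a \<Rightarrow> real"
  assumes "finite I" "g \<in> borel_measurable M" "\<And>k. k \<in> I \<Longrightarrow> Y k \<in> borel_measurable M"
    and "\<And>\<omega>. cmod (g \<omega>) \<le> K"
    and "\<And>a. (CLINT \<omega>|M. g \<omega> * iexp (\<Sum>k\<in>I. a k * Y k \<omega>)) = 0"
    and "\<And>k. k \<in> I \<Longrightarrow> B k \<in> sets borel"
  shows "(CLINT \<omega>|M. g \<omega> * (\<Prod>k\<in>I. indicator (B k) (Y k \<omega>))) = 0"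
  using assms
proof (induction I arbitrary: g rule: finite_induct)
  case empty
  then show ?case by simp
next
  case (insert x I)
  have [measurable]: "g \<in> borel_measurable M" "Y x \<in> borel_measurable M" "B x \<in> sets borel"
    using insert.prems by auto
  have [measurable]: "k \<in> I \<Longrightarrow> Y k \<in> borel_measurable M" for k using insert.prems by auto
  define h where "h \<omega> = g \<omega> * indicator (B x) (Y x \<omega>)" for \<omega>
  have [measurable]: "h \<in> borel_measurable M" unfolding h_def by measurable
  have "(CLINT \<omega>|M. h \<omega> * (\<Prod>k\<in>I. indicator (B k) (Y k \<omega>))) = 0"
  proof (rule insert.IH)
    show "cmod (h \<omega>) \<le> K" for \<omega>
      using insert.prems(3)[of \<omega>] order_trans[OF norm_ge_zero insert.prems(3)]
      by (auto simp: h_def indicator_def norm_mult)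
    fix a
    have "(CLINT \<omega>|M. (g \<omega> * iexp (\<Sum>k\<in>I. a k * Y k \<omega>)) * indicator (B x) (Y x \<omega>)) = 0"
    proof (rule signed_fourier_uniqueness[where K=K])
      fix t
      have "(CLINT \<omega>|M. g \<omega> * iexp (\<Sum>k\<in>I. a k * Y k \<omega>) * iexp (t * Y x \<omega>))
        = (CLINT \<omega>|M. g \<omega> * iexp (\<Sum>k\<in>insert x I. (a(x:=t)) k * Y k \<omega>))"
      proof (rule Bochner_Integration.integral_cong)
        fix \<omega>
        have "(\<Sum>k\<in>I. (a(x:=t)) k * Y k \<omega>) = (\<Sum>k\<in>I. a k * Y k \<omega>)"
          by (rule sum.cong) (use insert.hyps in auto)
        then have "(\<Sum>k\<in>insert x I. (a(x:=t)) k * Y k \<omega>) = t * Y x \<omega> + (\<Sum>k\<in>I. a k * Y k \<omega>)"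
          using insert.hyps by simp
        then show "g \<omega> * iexp (\<Sum>k\<in>I. a k * Y k \<omega>) * iexp (t * Y x \<omega>)
          = g \<omega> * iexp (\<Sum>k\<in>insert x I. (a(x:=t)) k * Y k \<omega>)"
          by (simp only: of_real_add distrib_left exp_add) (simp add: mult_ac)
      qed simp
      also have "\<dots> = 0" by (rule insert.prems)
      finally show "(CLINT \<omega>|M. g \<omega> * iexp (\<Sum>k\<in>I. a k * Y k \<omega>) * iexp (t * Y x \<omega>)) = 0" .
    qed (use insert.prems in \<open>auto simp: norm_mult\<close>)
    then show "(CLINT \<omega>|M. h \<omega> * iexp (\<Sum>k\<in>I. a k * Y k \<omega>)) = 0"
      by (simp add: h_def mult_ac)
  qed (use insert.prems in auto)
  then show ?case
    using insert.hyps by (simp add: h_def mult_ac)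
qed

text \<open>
  Boxes are an intersection-stable generator of the product sigma-algebra, and the sets on which the
  conclusion holds are closed under complements and countable disjoint unions.
\<close>

lemma (in prob_space) signed_fourier_uniqueness_PiM:
  fixes g :: "'a \<Rightarrow> complex" and Y :: "'i \<Rightarrow> 'a \<Rightarrow> real"
  assumes I: "finite I" and [measurable]: "g \<in> borel_measurable M" "\<And>k. k \<in> I \<Longrightarrow> Y k \<in> borel_measurable M"
    and bnd: "\<And>\<omega>. cmod (g \<omega>) \<le> K"
    and zero: "\<And>a. (CLINT \<omega>|M. g \<omega> * iexp (\<Sum>k\<in>I. a k * Y k \<omega>)) = 0"
    and E: "E \<in> sets (PiM I (\<lambda>_. borel))"
  shows "(CLINT \<omega>|M. g \<omega> * indicator E (\<lambda>k\<in>I. Y k \<omega>)) = 0"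
proof -
  have gi: "integrable M (\<lambda>\<omega>. g \<omega> * indicator F (\<lambda>k\<in>I. Y k \<omega>))"
    if "F \<in> sets (PiM I (\<lambda>_. borel))" for F
    by (rule integrable_const_bound[where B=K])
      (use that bnd order_trans[OF norm_ge_zero bnd] in \<open>auto simp: indicator_def norm_mult\<close>)
  have sub: "prod_algebra I (\<lambda>_. borel) \<subseteq> Pow (\<Pi>\<^sub>E i\<in>I. space (borel :: real measure))"
    by (rule prod_algebra_sets_into_space)
  from E have "E \<in> sigma_sets (\<Pi>\<^sub>E i\<in>I. space (borel :: real measure)) (prod_algebra I (\<lambda>_. borel))"
    by (simp add: sets_PiM)
  with Int_stable_prod_algebra sub show ?thesis
  proof (induction rule: sigma_sets_induct_disjoint)
    case (basic A)
    then obtain B where A: "A = Pi\<^sub>E I B" and B: "\<And>k. k \<in> I \<Longrightarrow> B k \<in> sets borel"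
      using prod_algebraE_all[OF basic] by (metis Pi_iff)
    have "(CLINT \<omega>|M. g \<omega> * indicator A (\<lambda>k\<in>I. Y k \<omega>)) =
        (CLINT \<omega>|M. g \<omega> * (\<Prod>k\<in>I. indicator (B k) (Y k \<omega>)))"
    proof (rule Bochner_Integration.integral_cong)
      fix \<omega>
      show "g \<omega> * indicator A (\<lambda>k\<in>I. Y k \<omega>) = g \<omega> * (\<Prod>k\<in>I. indicator (B k) (Y k \<omega>))"
      proof (cases "\<forall>k\<in>I. Y k \<omega> \<in> B k")
        case True
        then show ?thesis by (simp add: A PiE_def Pi_def)
      next
        case False
        then have "(\<lambda>k\<in>I. Y k \<omega>) \<notin> A" by (auto simp: A PiE_def Pi_def)
        moreover from False have "(\<Prod>k\<in>I. indicator (B k) (Y k \<omega>)) = (0::complex)"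
          using I by (intro prod_zero) (auto simp: indicator_def)
        ultimately show ?thesis by simp
      qed
    qed simp
    also have "\<dots> = 0"
      by (rule signed_fourier_uniqueness_box) (use assms B in auto)
    finally show ?case .
  next
    case empty
    then show ?case by simp
  next
    case (compl A)
    then have A: "A \<in> sets (PiM I (\<lambda>_. borel))" by (simp add: sets_PiM)
    have "(CLINT \<omega>|M. g \<omega> * indicator ((\<Pi>\<^sub>E i\<in>I. space borel) - A) (\<lambda>k\<in>I. Y k \<omega>))
      = (CLINT \<omega>|M. g \<omega> - g \<omega> * indicator A (\<lambda>k\<in>I. Y k \<omega>))"
      by (rule Bochner_Integration.integral_cong) (auto simp: indicator_def)
    also have "\<dots> = (CLINT \<omega>|M. g \<omega>) - (CLINT \<omega>|M. g \<omega> * indicator A (\<lambda>k\<in>I. Y k \<omega>))"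
      by (rule Bochner_Integration.integral_diff[OF _ gi[OF A]])
        (rule integrable_const_bound[where B=K], use bnd in auto)
    also have "\<dots> = 0" using compl zero[of "\<lambda>_. 0"] by (simp add: restrict_def)
    finally show ?case .
  next
    case (union A)
    then have A: "A i \<in> sets (PiM I (\<lambda>_. borel))" for i by (simp add: sets_PiM image_subset_iff)
    then have [measurable]: "(\<Union>i. A i) \<in> sets (PiM I (\<lambda>_. borel))"
      "(\<Union>j<i. A j) \<in> sets (PiM I (\<lambda>_. borel))" for i by blast+
    have "(\<lambda>i. CLINT \<omega>|M. g \<omega> * indicator (\<Union>j<i. A j) (\<lambda>k\<in>I. Y k \<omega>))
      \<longlonglongrightarrow> (CLINT \<omega>|M. g \<omega> * indicator (\<Union>i. A i) (\<lambda>k\<in>I. Y k \<omega>))"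
    proof (rule integral_dominated_convergence[where w="\<lambda>_. K"])
      show "AE \<omega> in M. (\<lambda>i. g \<omega> * indicator (\<Union>j<i. A j) (\<lambda>k\<in>I. Y k \<omega>))
          \<longlonglongrightarrow> g \<omega> * indicator (\<Union>i. A i) (\<lambda>k\<in>I. Y k \<omega>)"
        by (intro AE_I2 tendsto_intros LIMSEQ_indicator_UN)
      show "AE \<omega> in M. cmod (g \<omega> * indicator (\<Union>j<i. A j) (\<lambda>k\<in>I. Y k \<omega>)) \<le> K" for i
        using bnd order_trans[OF norm_ge_zero bnd] by (auto simp: indicator_def norm_mult)
      show "(\<lambda>\<omega>. g \<omega> * indicator (\<Union>i. A i) (\<lambda>k\<in>I. Y k \<omega>)) \<in> borel_measurable M"
        by measurable
      show "(\<lambda>\<omega>. g \<omega> * indicator (\<Union>j<i. A j) (\<lambda>k\<in>I. Y k \<omega>)) \<in> borel_measurable M" for i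
        by measurable
    qed simp
    moreover have "(CLINT \<omega>|M. g \<omega> * indicator (\<Union>j<i. A j) (\<lambda>k\<in>I. Y k \<omega>)) = 0" for i
    proof (induction i)
      case (Suc i)
      have "(CLINT \<omega>|M. g \<omega> * indicator (\<Union>j<Suc i. A j) (\<lambda>k\<in>I. Y k \<omega>))
        = (CLINT \<omega>|M. g \<omega> * indicator (\<Union>j<i. A j) (\<lambda>k\<in>I. Y k \<omega>) + g \<omega> * indicator (A i) (\<lambda>k\<in>I. Y k \<omega>))"
      proof (rule Bochner_Integration.integral_cong)
        fix \<omega>
        have "A i \<inter> A j = {}" if "j < i" for j
          using union that by (intro disjoint_family_onD[of A UNIV]) simp_all
        then have "A i \<inter> (\<Union>j<i. A j) = {}" by blast
        then show "g \<omega> * indicator (\<Union>j<Suc i. A j) (\<lambda>k\<in>I. Y k \<omega>) =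
           g \<omega> * indicator (\<Union>j<i. A j) (\<lambda>k\<in>I. Y k \<omega>) + g \<omega> * indicator (A i) (\<lambda>k\<in>I. Y k \<omega>)"
          by (auto simp: lessThan_Suc indicator_def)
      qed simp
      also have "\<dots> = (CLINT \<omega>|M. g \<omega> * indicator (\<Union>j<i. A j) (\<lambda>k\<in>I. Y k \<omega>))
          + (CLINT \<omega>|M. g \<omega> * indicator (A i) (\<lambda>k\<in>I. Y k \<omega>))"
        by (intro Bochner_Integration.integral_add gi A) measurable
      also have "\<dots> = 0" unfolding Suc union by simp
      finally show ?case .
    qed simp
    ultimately show ?case by (simp add: LIMSEQ_const_iff restrict_def)
  qed
qed

text \<open>
  Apply uniqueness twice to weights that measure the deviation from independence. With weight
  \<open>e\<^sub>a - E e\<^sub>a\<close>, where \<open>e\<^sub>a\<close> is an exponential of the first family, the exponentials of the second family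
  become the indicator of a set \<open>E\<close>. Then \<open>1\<^sub>E - P(E)\<close> is the weight, and the exponentials of the first family
  become an indicator as well.
\<close>

lemma (in prob_space) indep_var_if_char_factorizes:
  fixes w :: "'i \<Rightarrow> 'a \<Rightarrow> real" and s :: "'i \<Rightarrow> 'a \<Rightarrow> real"
  assumes fin: "finite I" "finite J"
    and w[measurable]: "\<And>k. k \<in> I \<Longrightarrow> w k \<in> borel_measurable M"
    and s[measurable]: "\<And>k. k \<in> J \<Longrightarrow> s k \<in> borel_measurable M"
    and fact: "\<And>a b. (CLINT \<omega>|M. iexp (\<Sum>k\<in>I. a k * w k \<omega>) * iexp (\<Sum>k\<in>J. b k * s k \<omega>))
        = (CLINT \<omega>|M. iexp (\<Sum>k\<in>I. a k * w k \<omega>)) * (CLINT \<omega>|M. iexp (\<Sum>k\<in>J. b k * s k \<omega>))"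
  shows "indep_var (PiM I (\<lambda>_. borel)) (\<lambda>\<omega>. \<lambda>k\<in>I. w k \<omega>) (PiM J (\<lambda>_. borel)) (\<lambda>\<omega>. \<lambda>k\<in>J. s k \<omega>)"
proof -
  let ?W = "\<lambda>\<omega>. \<lambda>k\<in>I. w k \<omega>" and ?S = "\<lambda>\<omega>. \<lambda>k\<in>J. s k \<omega>"
  let ?e = "\<lambda>a \<omega>. iexp (\<Sum>k\<in>I. a k * w k \<omega>)" and ?f = "\<lambda>b \<omega>. iexp (\<Sum>k\<in>J. b k * s k \<omega>)"
  have ie: "integrable M (?e a)" for a by (rule integrable_const_bound[where B=1]) auto
  have "if": "integrable M (?f b)" for b by (rule integrable_const_bound[where B=1]) auto
  have ief: "integrable M (\<lambda>\<omega>. ?e a \<omega> * ?f b \<omega>)" for a b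
    by (rule integrable_const_bound[where B=1]) (auto simp: norm_mult)
  have nle: "cmod (CLINT \<omega>|M. ?e a \<omega>) \<le> 1" for a
  proof -
    have "cmod (CLINT \<omega>|M. ?e a \<omega>) \<le> (LINT \<omega>|M. cmod (?e a \<omega>))" by (rule integral_norm_bound)
    also have "\<dots> = 1" by (simp add: prob_space)
    finally show ?thesis .
  qed
  have main: "prob (?W -` F \<inter> space M \<inter> (?S -` E \<inter> space M)) = prob (?W -` F \<inter> space M) * prob (?S -` E \<inter> space M)"
    if F[measurable]: "F \<in> sets (PiM I (\<lambda>_. borel))" and E[measurable]: "E \<in> sets (PiM J (\<lambda>_. borel))" for F E
  proof -
    define P where "P = prob (?S -` E \<inter> space M)"
    have P1: "0 \<le> P" "P \<le> 1" unfolding P_def by auto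
    have iE: "integrable M (\<lambda>\<omega>. indicator E (?S \<omega>) :: complex)"
      by (rule integrable_const_bound[where B=1]) (auto simp: indicator_def)
    have PE: "(CLINT \<omega>|M. indicator E (?S \<omega>)) = complex_of_real P"
    proof -
      have "(CLINT \<omega>|M. indicator E (?S \<omega>)) = (CLINT \<omega>|M. complex_of_real (indicator (?S -` E \<inter> space M) \<omega>))"
        by (rule Bochner_Integration.integral_cong) (auto simp: indicator_def)
      also have "\<dots> = P" unfolding P_def by (simp only: integral_complex_of_real) simp
      finally show ?thesis .
    qed
    have "(CLINT \<omega>|M. (indicator E (?S \<omega>) - complex_of_real P) * indicator F (?W \<omega>)) = 0"
    proof (rule signed_fourier_uniqueness_PiM[where K=2])
      show "cmod (indicator E (?S \<omega>) - complex_of_real P) \<le> 2" for \<omega>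
        using norm_triangle_ineq4[of "indicator E (?S \<omega>) :: complex" "complex_of_real P"] P1
        by (auto simp: indicator_def split: if_splits)
      fix a
      have ieE: "integrable M (\<lambda>\<omega>. ?e a \<omega> * indicator E (?S \<omega>))"
        by (rule integrable_const_bound[where B=1]) (auto simp: indicator_def norm_mult)
      have "(CLINT \<omega>|M. (?e a \<omega> - (CLINT \<omega>|M. ?e a \<omega>)) * indicator E (?S \<omega>)) = 0"
      proof (rule signed_fourier_uniqueness_PiM[where K=2])
        show "cmod (?e a \<omega> - (CLINT \<omega>|M. ?e a \<omega>)) \<le> 2" for \<omega>
          using norm_triangle_ineq4[of "?e a \<omega>" "CLINT \<omega>|M. ?e a \<omega>"] nle[of a] by simp
        fix b
        have "(CLINT \<omega>|M. (?e a \<omega> - (CLINT \<omega>|M. ?e a \<omega>)) * ?f b \<omega>)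
          = (CLINT \<omega>|M. ?e a \<omega> * ?f b \<omega> - (CLINT \<omega>|M. ?e a \<omega>) * ?f b \<omega>)"
          by (simp add: algebra_simps)
        also have "\<dots> = 0" using ief "if" fact[of a b] by simp
        finally show "(CLINT \<omega>|M. (?e a \<omega> - (CLINT \<omega>|M. ?e a \<omega>)) * ?f b \<omega>) = 0" .
      qed (use fin in auto)
      then have "(CLINT \<omega>|M. ?e a \<omega> * indicator E (?S \<omega>)) = (CLINT \<omega>|M. ?e a \<omega>) * P"
        using iE ieE PE by (simp add: left_diff_distrib)
      then show "(CLINT \<omega>|M. (indicator E (?S \<omega>) - complex_of_real P) * ?e a \<omega>) = 0"
        using ie ieE by (simp add: left_diff_distrib mult.commute[of "indicator E _"] mult.commute[of P])
    qed (use fin in auto)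
    moreover have "(CLINT \<omega>|M. (indicator E (?S \<omega>) - complex_of_real P) * indicator F (?W \<omega>))
      = (CLINT \<omega>|M. complex_of_real (indicator (?W -` F \<inter> space M \<inter> (?S -` E \<inter> space M)) \<omega> - P * indicator (?W -` F \<inter> space M) \<omega>))"
      by (rule Bochner_Integration.integral_cong) (auto simp: indicator_def)
    ultimately have "(LINT \<omega>|M. indicator (?W -` F \<inter> space M \<inter> (?S -` E \<inter> space M)) \<omega> - P * indicator (?W -` F \<inter> space M) \<omega>) = 0"
      by (simp only: integral_complex_of_real of_real_eq_0_iff)
    moreover have ev: "?W -` F \<inter> space M \<in> events" "?S -` E \<inter> space M \<in> events"
      by (auto intro!: measurable_sets[OF _ F] measurable_sets[OF _ E])
    have "integrable M (indicat_real (?W -` F \<inter> space M \<inter> (?S -` E \<inter> space M)))"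
      "integrable M (indicat_real (?W -` F \<inter> space M))"
      using ev sets.Int[OF ev] by (auto intro!: integrable_real_indicator simp: emeasure_eq_measure)
    ultimately have "(LINT \<omega>|M. indicator (?W -` F \<inter> space M \<inter> (?S -` E \<inter> space M)) \<omega>)
        - P * (LINT \<omega>|M. indicator (?W -` F \<inter> space M) \<omega>) = 0"
      by (simp only: Bochner_Integration.integral_diff Bochner_Integration.integral_mult_right_zero
            integrable_mult_right)
    then show ?thesis
      by (simp only: integral_indicator Int_absorb2[OF sets.sets_into_space] sets.Int[OF ev] ev Int_assoc Int_absorb)
        (simp add: P_def Int_assoc mult.commute)
  qed
  show ?thesis
    unfolding indep_var_eq
  proof (intro conjI)
    show "indep_set (sigma_sets (space M) {?W -` A \<inter> space M |A. A \<in> sets (PiM I (\<lambda>_. borel))})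
      (sigma_sets (space M) {?S -` A \<inter> space M |A. A \<in> sets (PiM J (\<lambda>_. borel))})"
    proof (rule indep_set_sigma_sets)
      show "indep_set {?W -` A \<inter> space M |A. A \<in> sets (PiM I (\<lambda>_. borel))}
         {?S -` A \<inter> space M |A. A \<in> sets (PiM J (\<lambda>_. borel))}"
        by (rule indep_setI) (auto simp: main intro!: measurable_sets)
      show "Int_stable {?W -` A \<inter> space M |A. A \<in> sets (PiM I (\<lambda>_. borel))}"
        unfolding Int_stable_def by (safe, rule_tac x="A \<inter> Aa" in exI) auto
      show "Int_stable {?S -` A \<inter> space M |A. A \<in> sets (PiM J (\<lambda>_. borel))}"
        unfolding Int_stable_def by (safe, rule_tac x="A \<inter> Aa" in exI) auto
    qed
  qed measurable
qed

section \<open>Pairs of independent Gaussian vectors with the same covariance\<close>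

text \<open>
  The characteristic function identifies the law of \<open>Y\<close> with that of a multiple of a standard normal
  variable; this covers \<open>v = 0\<close> without a case distinction.
\<close>

lemma (in prob_space) centered_gaussian_moments:
  fixes Y :: "'a \<Rightarrow> real"
  assumes [measurable]: "Y \<in> borel_measurable M" and v: "v \<ge> 0"
    and cf: "\<And>t. (CLINT \<omega>|M. iexp (t * Y \<omega>)) = complex_of_real (exp (- (t\<^sup>2 * v) / 2))"
  shows "integrable M (\<lambda>\<omega>. Y \<omega> ^ k)" and "(LINT \<omega>|M. (Y \<omega>)\<^sup>2) = v"
proof -
  interpret N: real_distribution std_normal_distribution by (rule real_dist_normal_dist)
  have r1: "real_distribution (distr M borel Y)" by (intro real_distribution_distr) simp
  have r2: "real_distribution (distr std_normal_distribution borel (\<lambda>x. sqrt v * x))"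
    by (intro N.real_distribution_distr) simp
  have "char (distr M borel Y) = char (distr std_normal_distribution borel (\<lambda>x. sqrt v * x))"
  proof
    fix t
    have "char (distr M borel Y) t = complex_of_real (exp (- (t\<^sup>2 * v) / 2))"
      unfolding char_def using cf[of t] by (subst integral_distr) auto
    also have "\<dots> = char std_normal_distribution (t * sqrt v)"
      using v by (simp add: char_std_normal_distribution power_mult_distrib)
    also have "\<dots> = char (distr std_normal_distribution borel (\<lambda>x. sqrt v * x)) t"
    proof -
      have "char (distr std_normal_distribution borel (\<lambda>x. sqrt v * x)) t
          = (CLINT x|std_normal_distribution. iexp (t * (sqrt v * x)))"
        unfolding char_def by (rule integral_distr) measurable
      then show ?thesis by (simp add: char_def mult.assoc)
    qed
    finally show "char (distr M borel Y) t = char (distr std_normal_distribution borel (\<lambda>x. sqrt v * x)) t" .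
  qed
  then have eq: "distr M borel Y = distr std_normal_distribution borel (\<lambda>x. sqrt v * x)"
    by (rule Levy_uniqueness[OF r1 r2])
  have "integrable (distr M borel Y) (\<lambda>x. x ^ k)"
    unfolding eq by (subst integrable_distr_eq)
      (auto simp: power_mult_distrib intro!: integrable_std_normal_distribution_moment)
  then show "integrable M (\<lambda>\<omega>. Y \<omega> ^ k)"
    by (subst (asm) integrable_distr_eq) auto
  have "(LINT \<omega>|M. (Y \<omega>)\<^sup>2) = (LINT x|distr M borel Y. x\<^sup>2)"
    by (subst integral_distr) auto
  also have "\<dots> = (LINT x|std_normal_distribution. (sqrt v * x)\<^sup>2)"
    unfolding eq by (subst integral_distr) auto
  also have "\<dots> = v"
    using v std_normal_distribution_even_moments(1)[of 1] by (simp add: power_mult_distrib)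
  finally show "(LINT \<omega>|M. (Y \<omega>)\<^sup>2) = v" .
qed

lemma square_sum_expand:
  fixes f :: "nat \<Rightarrow> nat \<Rightarrow> real"
  shows "(\<Sum>k<n. \<Sum>l<n. f k l)\<^sup>2 = (\<Sum>k<n. \<Sum>l<n. \<Sum>m<n. \<Sum>r<n. f k l * f m r)"
  unfolding power2_eq_square by (simp only: sum_distrib_right) (simp only: sum_distrib_left)

lemma integrable_mult_of_squares:
  fixes f g :: "'a \<Rightarrow> real"
  assumes [measurable]: "f \<in> borel_measurable M" "g \<in> borel_measurable M"
    and "integrable M (\<lambda>x. (f x)\<^sup>2)" "integrable M (\<lambda>x. (g x)\<^sup>2)"
  shows "integrable M (\<lambda>x. f x * g x)"
proof (rule Bochner_Integration.integrable_bound)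
  show "integrable M (\<lambda>x. (f x)\<^sup>2 + (g x)\<^sup>2)" using assms by simp
  have "\<bar>a * b\<bar> \<le> a\<^sup>2 + b\<^sup>2" for a b :: real
  proof -
    have "2 * \<bar>a\<bar> * \<bar>b\<bar> \<le> a\<^sup>2 + b\<^sup>2" using sum_squares_bound[of "\<bar>a\<bar>" "\<bar>b\<bar>"] by simp
    moreover have "0 \<le> \<bar>a\<bar> * \<bar>b\<bar>" by simp
    ultimately show ?thesis unfolding abs_mult by linarith
  qed
  then show "AE x in M. norm (f x * g x) \<le> norm ((f x)\<^sup>2 + (g x)\<^sup>2)" by simp
qed measurable

lemma integrable_square_add:
  fixes f g :: "'a \<Rightarrow> real"
  assumes "f \<in> borel_measurable M" "g \<in> borel_measurable M"
    and "integrable M (\<lambda>x. (f x)\<^sup>2)" "integrable M (\<lambda>x. (g x)\<^sup>2)"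
  shows "integrable M (\<lambda>x. (f x + g x)\<^sup>2)"
  using integrable_mult_of_squares[OF assms] assms
  by (simp add: power2_sum mult.assoc)

lemma integrable_square_sum:
  fixes f :: "'i \<Rightarrow> 'a \<Rightarrow> real"
  assumes "finite I" "\<And>i. i \<in> I \<Longrightarrow> f i \<in> borel_measurable M"
    and "\<And>i. i \<in> I \<Longrightarrow> integrable M (\<lambda>x. (f i x)\<^sup>2)"
  shows "integrable M (\<lambda>x. (\<Sum>i\<in>I. f i x)\<^sup>2)"
  using assms
proof (induction I rule: finite_induct)
  case (insert i I)
  then have [measurable]: "j \<in> insert i I \<Longrightarrow> f j \<in> borel_measurable M" for j by blast
  have "integrable M (\<lambda>x. (f i x + (\<Sum>j\<in>I. f j x))\<^sup>2)"
    using insert by (intro integrable_square_add) auto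
  then show ?case using insert.hyps by simp
qed simp

lemma integral_double_sum:
  fixes f :: "nat \<Rightarrow> nat \<Rightarrow> 'a \<Rightarrow> real"
  assumes "\<And>k l. k < n \<Longrightarrow> l < n \<Longrightarrow> integrable M (f k l)"
  shows "(LINT \<omega>|M. (\<Sum>k<n. \<Sum>l<n. f k l \<omega>)) = (\<Sum>k<n. \<Sum>l<n. LINT \<omega>|M. f k l \<omega>)"
    and "integrable M (\<lambda>\<omega>. \<Sum>k<n. \<Sum>l<n. f k l \<omega>)"
proof -
  have i: "integrable M (\<lambda>\<omega>. \<Sum>l<n. f k l \<omega>)" if "k < n" for k
    using assms that by (intro Bochner_Integration.integrable_sum) auto
  then show "integrable M (\<lambda>\<omega>. \<Sum>k<n. \<Sum>l<n. f k l \<omega>)"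
    using assms by (intro Bochner_Integration.integrable_sum) auto
  have "(LINT \<omega>|M. (\<Sum>k<n. \<Sum>l<n. f k l \<omega>)) = (\<Sum>k<n. LINT \<omega>|M. (\<Sum>l<n. f k l \<omega>))"
    by (rule Bochner_Integration.integral_sum) (use i in auto)
  also have "\<dots> = (\<Sum>k<n. \<Sum>l<n. LINT \<omega>|M. f k l \<omega>)"
    by (intro sum.cong refl Bochner_Integration.integral_sum) (use assms in auto)
  finally show "(LINT \<omega>|M. (\<Sum>k<n. \<Sum>l<n. f k l \<omega>)) = (\<Sum>k<n. \<Sum>l<n. LINT \<omega>|M. f k l \<omega>)" .
qed

text \<open>
  Vectors and matrices of varying size are functions of one or two indices, of which only the values at
  indices below \<open>n\<close> count.
\<close>

definition quad :: "nat \<Rightarrow> (nat \<Rightarrow> nat \<Rightarrow> real) \<Rightarrow> (nat \<Rightarrow> real) \<Rightarrow> real" where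
  "quad n P a = (\<Sum>k<n. \<Sum>l<n. a k * P k l * a l)"

definition frob :: "nat \<Rightarrow> (nat \<Rightarrow> nat \<Rightarrow> real) \<Rightarrow> real" where
  "frob n P = sqrt (\<Sum>k<n. \<Sum>l<n. (P k l)\<^sup>2)"

lemma quad_scale: "quad n P (\<lambda>k. r * a k) = r\<^sup>2 * quad n P a"
  unfolding quad_def sum_distrib_left by (simp add: power2_eq_square mult_ac)

lemma quad_cong: "(\<And>k. k < n \<Longrightarrow> a k = b k) \<Longrightarrow> quad n P a = quad n P b"
  unfolding quad_def by simp

lemma quad_add:
  assumes "\<And>k l. k < n \<Longrightarrow> l < n \<Longrightarrow> P k l = P l k"
  shows "quad n P (\<lambda>k. a k + b k) = quad n P a + quad n P b + 2 * (\<Sum>k<n. \<Sum>l<n. a k * P k l * b l)"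
proof -
  have "(\<Sum>k<n. \<Sum>l<n. b k * P k l * a l) = (\<Sum>l<n. \<Sum>k<n. b k * P k l * a l)" by (rule sum.swap)
  also have "\<dots> = (\<Sum>k<n. \<Sum>l<n. a k * P k l * b l)"
    by (intro sum.cong refl) (simp add: assms)
  finally show ?thesis
    unfolding quad_def by (simp add: algebra_simps sum.distrib)
qed

text \<open>
  Two independent centred Gaussian vectors \<open>w\<close> and \<open>s\<close> with covariance matrix \<open>P\<close>, specified by their joint
  characteristic function. In this form, invariance under rotations of the pair is a computation with
  quadratic forms, while moments and independence are consequences.
\<close>

locale indep_gauss = prob_space M for M :: "'a measure" +
  fixes n :: nat and P :: "nat \<Rightarrow> nat \<Rightarrow> real" and w s :: "nat \<Rightarrow> 'a \<Rightarrow> real"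
  assumes w_meas: "\<And>k. k < n \<Longrightarrow> w k \<in> borel_measurable M"
    and s_meas: "\<And>k. k < n \<Longrightarrow> s k \<in> borel_measurable M"
    and cf: "\<And>a b. (CLINT \<omega>|M. iexp ((\<Sum>k<n. a k * w k \<omega>) + (\<Sum>k<n. b k * s k \<omega>)))
        = complex_of_real (exp (- (quad n P a + quad n P b) / 2))"
    and P_sym: "\<And>k l. k < n \<Longrightarrow> l < n \<Longrightarrow> P k l = P l k"
    and P_psd: "\<And>a. quad n P a \<ge> 0"
begin

declare w_meas[measurable] s_meas[measurable]

lemma swap_pair: "indep_gauss M n P s w"
proof
  fix a b
  show "(CLINT \<omega>|M. iexp ((\<Sum>k<n. a k * s k \<omega>) + (\<Sum>k<n. b k * w k \<omega>)))
        = complex_of_real (exp (- (quad n P a + quad n P b) / 2))"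
    using cf[of b a] by (simp only: add.commute)
qed (use w_meas s_meas P_sym P_psd in auto)

text \<open>
  The joint law of \<open>w\<close> and \<open>s\<close> is invariant under rotation by 45 degrees. This reduces quadratic forms in
  one vector to bilinear forms in two independent vectors, for which second moments suffice.
\<close>

lemma rotate_pair:
  "indep_gauss M n P (\<lambda>k \<omega>. (w k \<omega> - s k \<omega>) / sqrt 2) (\<lambda>k \<omega>. (w k \<omega> + s k \<omega>) / sqrt 2)"
proof
  fix a b :: "nat \<Rightarrow> real"
  let ?a = "\<lambda>k. 1 / sqrt 2 * (a k + b k)" and ?b = "\<lambda>k. 1 / sqrt 2 * (b k + (-1) * a k)"
  have "(\<Sum>k<n. a k * ((w k \<omega> - s k \<omega>) / sqrt 2)) + (\<Sum>k<n. b k * ((w k \<omega> + s k \<omega>) / sqrt 2))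
      = (\<Sum>k<n. ?a k * w k \<omega>) + (\<Sum>k<n. ?b k * s k \<omega>)" for \<omega>
    unfolding sum.distrib[symmetric] by (intro sum.cong refl) (simp add: field_simps)
  moreover have "quad n P ?a + quad n P ?b = quad n P a + quad n P b"
  proof -
    have "quad n P (\<lambda>k. b k + (-1) * a k) = quad n P b + quad n P a + 2 * (\<Sum>k<n. \<Sum>l<n. b k * P k l * ((-1) * a l))"
      using quad_add[of n P b "\<lambda>k. (-1) * a k"] P_sym quad_scale[of n P "-1" a] by simp
    also have "(\<Sum>k<n. \<Sum>l<n. b k * P k l * ((-1) * a l)) = - (\<Sum>l<n. \<Sum>k<n. b k * P k l * a l)"
      by (subst sum.swap) (simp add: sum_negf)
    also have "(\<Sum>l<n. \<Sum>k<n. b k * P k l * a l) = (\<Sum>k<n. \<Sum>l<n. a k * P k l * b l)"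
      by (intro sum.cong refl) (simp add: P_sym)
    finally show ?thesis
      using quad_add[of n P a b] P_sym unfolding quad_scale by (simp add: power_divide field_simps)
  qed
  ultimately show "(CLINT \<omega>|M. iexp ((\<Sum>k<n. a k * ((w k \<omega> - s k \<omega>) / sqrt 2)) + (\<Sum>k<n. b k * ((w k \<omega> + s k \<omega>) / sqrt 2))))
        = complex_of_real (exp (- (quad n P a + quad n P b) / 2))"
    using cf[of ?a ?b] by simp
qed (use w_meas s_meas P_sym P_psd in auto)

lemma cf_w: "(CLINT \<omega>|M. iexp (\<Sum>k<n. a k * w k \<omega>)) = complex_of_real (exp (- quad n P a / 2))"
  using cf[of a "\<lambda>_. 0"] by (simp add: quad_def)

lemma cf_s: "(CLINT \<omega>|M. iexp (\<Sum>k<n. a k * s k \<omega>)) = complex_of_real (exp (- quad n P a / 2))"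
  by (rule indep_gauss.cf_w[OF swap_pair])

lemma linear_form_moments:
  shows "integrable M (\<lambda>\<omega>. (\<Sum>k<n. a k * w k \<omega>) ^ q)"
    and "(LINT \<omega>|M. (\<Sum>k<n. a k * w k \<omega>)\<^sup>2) = quad n P a"
proof -
  have c: "(CLINT \<omega>|M. iexp (t * (\<Sum>k<n. a k * w k \<omega>))) = complex_of_real (exp (- (t\<^sup>2 * quad n P a) / 2))" for t
    using cf_w[of "\<lambda>k. t * a k"] by (simp only: quad_scale sum_distrib_left mult.assoc)
  show "integrable M (\<lambda>\<omega>. (\<Sum>k<n. a k * w k \<omega>) ^ q)"
    by (rule centered_gaussian_moments(1)[OF _ P_psd[of a] c]) measurable
  show "(LINT \<omega>|M. (\<Sum>k<n. a k * w k \<omega>)\<^sup>2) = quad n P a"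
    by (rule centered_gaussian_moments(2)[OF _ P_psd[of a] c]) measurable
qed

lemma integrable_w_power: "k < n \<Longrightarrow> integrable M (\<lambda>\<omega>. w k \<omega> ^ q)"
  using linear_form_moments(1)[of "\<lambda>l. if l = k then 1 else 0" q]
  by (simp add: if_distrib[of "\<lambda>x. x * _"] cong: if_cong)

lemma integrable_ww: "k < n \<Longrightarrow> l < n \<Longrightarrow> integrable M (\<lambda>\<omega>. w k \<omega> * w l \<omega>)"
  by (intro integrable_mult_of_squares integrable_w_power) auto

lemma bilinear_moment:
  "(LINT \<omega>|M. (\<Sum>k<n. a k * w k \<omega>) * (\<Sum>k<n. b k * w k \<omega>)) = (\<Sum>k<n. \<Sum>l<n. a k * P k l * b l)"
proof -
  let ?A = "\<lambda>\<omega>. \<Sum>k<n. a k * w k \<omega>" and ?B = "\<lambda>\<omega>. \<Sum>k<n. b k * w k \<omega>"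
  have e: "?A \<omega> * ?B \<omega> = ((\<Sum>k<n. (a k + b k) * w k \<omega>)\<^sup>2 - (?A \<omega>)\<^sup>2 - (?B \<omega>)\<^sup>2) / 2" for \<omega>
    by (simp add: distrib_right sum.distrib power2_sum)
  show ?thesis
    unfolding e using linear_form_moments quad_add[of n P a b] P_sym by simp
qed

lemma cov_w: assumes "k < n" "l < n" shows "(LINT \<omega>|M. w k \<omega> * w l \<omega>) = P k l"
proof -
  have *: "(\<Sum>j<n. (if j = m then 1 else 0) * f j) = f m" if "m < n" for m and f :: "nat \<Rightarrow> real"
    using that by (simp add: if_distrib[of "\<lambda>x. x * _"] cong: if_cong)
  show ?thesis
    using bilinear_moment[of "\<lambda>j. if j = k then 1 else 0" "\<lambda>j. if j = l then 1 else 0"] assms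
    by (simp only: *) (simp add: if_distrib[of "\<lambda>x. x * _"] if_distrib[of "\<lambda>x. _ * x"] cong: if_cong)
qed

lemma indep_ws:
  "indep_var (PiM {..<n} (\<lambda>_. borel)) (\<lambda>\<omega>. \<lambda>k\<in>{..<n}. w k \<omega>) (PiM {..<n} (\<lambda>_. borel)) (\<lambda>\<omega>. \<lambda>k\<in>{..<n}. s k \<omega>)"
proof (rule indep_var_if_char_factorizes)
  fix a b
  have "(CLINT \<omega>|M. iexp (\<Sum>k<n. a k * w k \<omega>) * iexp (\<Sum>k<n. b k * s k \<omega>))
    = (CLINT \<omega>|M. iexp ((\<Sum>k<n. a k * w k \<omega>) + (\<Sum>k<n. b k * s k \<omega>)))"
    by (simp only: of_real_add distrib_left exp_add)
  also have "\<dots> = complex_of_real (exp (- quad n P a / 2) * exp (- quad n P b / 2))"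
    unfolding cf by (simp flip: exp_add add: diff_divide_distrib)
  finally show "(CLINT \<omega>|M. iexp (\<Sum>k<n. a k * w k \<omega>) * iexp (\<Sum>k<n. b k * s k \<omega>))
    = (CLINT \<omega>|M. iexp (\<Sum>k<n. a k * w k \<omega>)) * (CLINT \<omega>|M. iexp (\<Sum>k<n. b k * s k \<omega>))"
    unfolding cf_w cf_s by simp
qed auto

lemma product_expectation:
  fixes f g :: "(nat \<Rightarrow> real) \<Rightarrow> real"
  assumes f[measurable]: "f \<in> borel_measurable (PiM {..<n} (\<lambda>_. borel))"
    and g[measurable]: "g \<in> borel_measurable (PiM {..<n} (\<lambda>_. borel))"
    and "integrable M (\<lambda>\<omega>. f (\<lambda>k\<in>{..<n}. w k \<omega>))" "integrable M (\<lambda>\<omega>. g (\<lambda>k\<in>{..<n}. s k \<omega>))"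
  shows "(LINT \<omega>|M. f (\<lambda>k\<in>{..<n}. w k \<omega>) * g (\<lambda>k\<in>{..<n}. s k \<omega>))
      = (LINT \<omega>|M. f (\<lambda>k\<in>{..<n}. w k \<omega>)) * (LINT \<omega>|M. g (\<lambda>k\<in>{..<n}. s k \<omega>))"
    and "integrable M (\<lambda>\<omega>. f (\<lambda>k\<in>{..<n}. w k \<omega>) * g (\<lambda>k\<in>{..<n}. s k \<omega>))"
proof -
  have "indep_var borel (f \<circ> (\<lambda>\<omega>. \<lambda>k\<in>{..<n}. w k \<omega>)) borel (g \<circ> (\<lambda>\<omega>. \<lambda>k\<in>{..<n}. s k \<omega>))"
    by (rule indep_var_compose[OF indep_ws f g])
  then have i: "indep_var borel (\<lambda>\<omega>. f (\<lambda>k\<in>{..<n}. w k \<omega>)) borel (\<lambda>\<omega>. g (\<lambda>k\<in>{..<n}. s k \<omega>))"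
    by (simp add: comp_def)
  show "(LINT \<omega>|M. f (\<lambda>k\<in>{..<n}. w k \<omega>) * g (\<lambda>k\<in>{..<n}. s k \<omega>))
      = (LINT \<omega>|M. f (\<lambda>k\<in>{..<n}. w k \<omega>)) * (LINT \<omega>|M. g (\<lambda>k\<in>{..<n}. s k \<omega>))"
    by (rule indep_var_lebesgue_integral[OF i assms(3,4)])
  show "integrable M (\<lambda>\<omega>. f (\<lambda>k\<in>{..<n}. w k \<omega>) * g (\<lambda>k\<in>{..<n}. s k \<omega>))"
    by (rule indep_var_integrable[OF i assms(3,4)])
qed

lemma mixed_moment:
  assumes "k < n" "l < n" "m < n" "r < n"
  shows "(LINT \<omega>|M. (w k \<omega> * w m \<omega>) * (s l \<omega> * s r \<omega>)) = P k m * P l r"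
    and "integrable M (\<lambda>\<omega>. (w k \<omega> * w m \<omega>) * (s l \<omega> * s r \<omega>))"
proof -
  interpret S: indep_gauss M n P s w by (rule swap_pair)
  have [measurable]: "k \<in> {..<n}" "l \<in> {..<n}" "m \<in> {..<n}" "r \<in> {..<n}" using assms by auto
  note pe = product_expectation[of "\<lambda>x. x k * x m" "\<lambda>x. x l * x r"]
  show "(LINT \<omega>|M. (w k \<omega> * w m \<omega>) * (s l \<omega> * s r \<omega>)) = P k m * P l r"
    using pe(1) integrable_ww S.integrable_ww assms by (simp add: cov_w S.cov_w)
  show "integrable M (\<lambda>\<omega>. (w k \<omega> * w m \<omega>) * (s l \<omega> * s r \<omega>))"
    using pe(2) integrable_ww S.integrable_ww assms by simp
qed

lemma bilinear_form_second_moment: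
  shows "(LINT \<omega>|M. (\<Sum>k<n. \<Sum>l<n. A k l * w k \<omega> * s l \<omega>)\<^sup>2)
      = (\<Sum>k<n. \<Sum>l<n. \<Sum>m<n. \<Sum>r<n. A k l * A m r * P k m * P l r)"
    and "integrable M (\<lambda>\<omega>. (\<Sum>k<n. \<Sum>l<n. A k l * w k \<omega> * s l \<omega>)\<^sup>2)"
proof -
  have e: "(\<Sum>k<n. \<Sum>l<n. A k l * w k \<omega> * s l \<omega>)\<^sup>2
    = (\<Sum>k<n. \<Sum>l<n. \<Sum>m<n. \<Sum>r<n. (A k l * A m r) * ((w k \<omega> * w m \<omega>) * (s l \<omega> * s r \<omega>)))" for \<omega>
    unfolding square_sum_expand by (simp only: mult_ac)
  show "(LINT \<omega>|M. (\<Sum>k<n. \<Sum>l<n. A k l * w k \<omega> * s l \<omega>)\<^sup>2)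
      = (\<Sum>k<n. \<Sum>l<n. \<Sum>m<n. \<Sum>r<n. A k l * A m r * P k m * P l r)"
  proof -
    have i: "integrable M (\<lambda>\<omega>. (A k l * A m r) * ((w k \<omega> * w m \<omega>) * (s l \<omega> * s r \<omega>)))"
      if "k < n" "l < n" "m < n" "r < n" for k l m r
      using mixed_moment(2)[OF that] by (rule integrable_mult_right)
    have inner: "(LINT \<omega>|M. (\<Sum>m<n. \<Sum>r<n. (A k l * A m r) * ((w k \<omega> * w m \<omega>) * (s l \<omega> * s r \<omega>))))
      = (\<Sum>m<n. \<Sum>r<n. A k l * A m r * P k m * P l r)" if "k < n" "l < n" for k l
      using that by (subst integral_double_sum(1)[OF i]) (auto simp: mult.assoc mixed_moment[unfolded mult.assoc] intro!: sum.cong)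
    show ?thesis
      unfolding e by (subst integral_double_sum(1)[OF integral_double_sum(2)[OF i]]) (auto simp: inner)
  qed
  show "integrable M (\<lambda>\<omega>. (\<Sum>k<n. \<Sum>l<n. A k l * w k \<omega> * s l \<omega>)\<^sup>2)"
    unfolding e by (intro Bochner_Integration.integrable_sum integrable_mult_right mixed_moment) auto
qed

lemma quadratic_form_square_integrable:
  "integrable M (\<lambda>\<omega>. (\<Sum>k<n. \<Sum>l<n. A k l * w k \<omega> * w l \<omega>)\<^sup>2)"
proof (intro integrable_square_sum)
  fix k l assume "k \<in> {..<n}" "l \<in> {..<n}"
  then have "k < n" "l < n" by auto
  then have "integrable M (\<lambda>\<omega>. (w k \<omega>)\<^sup>2 * (w l \<omega>)\<^sup>2)"
    using integrable_w_power[of _ 4] by (intro integrable_mult_of_squares) (auto simp flip: power_mult)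
  then show "integrable M (\<lambda>\<omega>. (A k l * w k \<omega> * w l \<omega>)\<^sup>2)"
    by (simp add: power_mult_distrib mult.assoc)
qed auto

lemma quadratic_form_mean:
  shows "(LINT \<omega>|M. (\<Sum>k<n. \<Sum>l<n. A k l * w k \<omega> * w l \<omega>)) = (\<Sum>k<n. \<Sum>l<n. A k l * P k l)"
    and "integrable M (\<lambda>\<omega>. (\<Sum>k<n. \<Sum>l<n. A k l * w k \<omega> * w l \<omega>))"
  unfolding mult.assoc
  by (subst integral_double_sum) (auto simp: cov_w integrable_ww intro!: integral_double_sum(2))

lemma quadratic_form_difference:
  assumes "\<And>k l. k < n \<Longrightarrow> l < n \<Longrightarrow> A k l = A l k"
  shows "(\<Sum>k<n. \<Sum>l<n. A k l * w k \<omega> * w l \<omega>) - (\<Sum>k<n. \<Sum>l<n. A k l * s k \<omega> * s l \<omega>)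
    = 2 * (\<Sum>k<n. \<Sum>l<n. A k l * ((w k \<omega> - s k \<omega>) / sqrt 2) * ((w l \<omega> + s l \<omega>) / sqrt 2))"
proof -
  have "(\<Sum>k<n. \<Sum>l<n. A k l * s k \<omega> * w l \<omega>) = (\<Sum>l<n. \<Sum>k<n. A k l * s k \<omega> * w l \<omega>)"
    by (rule sum.swap)
  also have "\<dots> = (\<Sum>k<n. \<Sum>l<n. A k l * w k \<omega> * s l \<omega>)"
    by (intro sum.cong refl) (simp add: assms)
  finally have "(\<Sum>k<n. \<Sum>l<n. A k l * s k \<omega> * w l \<omega>) = (\<Sum>k<n. \<Sum>l<n. A k l * w k \<omega> * s l \<omega>)" .
  moreover have "2 * (\<Sum>k<n. \<Sum>l<n. A k l * ((w k \<omega> - s k \<omega>) / sqrt 2) * ((w l \<omega> + s l \<omega>) / sqrt 2))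
    = (\<Sum>k<n. \<Sum>l<n. A k l * w k \<omega> * w l \<omega> + A k l * w k \<omega> * s l \<omega> - A k l * s k \<omega> * w l \<omega> - A k l * s k \<omega> * s l \<omega>)"
    unfolding sum_distrib_left by (intro sum.cong refl) (simp add: field_simps)
  ultimately show ?thesis by (simp add: sum.distrib sum_subtractf)
qed

text \<open>
  No fourth moments have to be computed. If \<open>U\<close> and \<open>V\<close> are the centred values of the form at \<open>w\<close> and \<open>s\<close>, then
  \<open>E U\<^sup>2 \<le> E (U - V)\<^sup>2\<close> by independence, and \<open>U - V = 2 h'Ag\<close> with the rotated pair \<open>h = (w - s)/\<surd>2\<close>, \<open>g = (w + s)/\<surd>2\<close>.
\<close>

lemma quadratic_form_variance_bound:
  assumes sym: "\<And>k l. k < n \<Longrightarrow> l < n \<Longrightarrow> A k l = A l k"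
  shows "(LINT \<omega>|M. ((\<Sum>k<n. \<Sum>l<n. A k l * w k \<omega> * w l \<omega>) - (\<Sum>k<n. \<Sum>l<n. A k l * P k l))\<^sup>2)
      \<le> 4 * (\<Sum>k<n. \<Sum>l<n. \<Sum>m<n. \<Sum>r<n. A k l * A m r * P k m * P l r)"
    and "integrable M (\<lambda>\<omega>. ((\<Sum>k<n. \<Sum>l<n. A k l * w k \<omega> * w l \<omega>) - (\<Sum>k<n. \<Sum>l<n. A k l * P k l))\<^sup>2)"
proof -
  interpret S: indep_gauss M n P s w by (rule swap_pair)
  interpret R: indep_gauss M n P "\<lambda>k \<omega>. (w k \<omega> - s k \<omega>) / sqrt 2" "\<lambda>k \<omega>. (w k \<omega> + s k \<omega>) / sqrt 2"
    by (rule rotate_pair)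
  define q where "q x = (\<Sum>k<n. \<Sum>l<n. A k l * x k * x l) - (\<Sum>k<n. \<Sum>l<n. A k l * P k l)" for x :: "nat \<Rightarrow> real"
  let ?U = "\<lambda>\<omega>. (\<Sum>k<n. \<Sum>l<n. A k l * w k \<omega> * w l \<omega>) - (\<Sum>k<n. \<Sum>l<n. A k l * P k l)"
  let ?V = "\<lambda>\<omega>. (\<Sum>k<n. \<Sum>l<n. A k l * s k \<omega> * s l \<omega>) - (\<Sum>k<n. \<Sum>l<n. A k l * P k l)"
  have U: "q (\<lambda>k\<in>{..<n}. w k \<omega>) = ?U \<omega>" and V: "q (\<lambda>k\<in>{..<n}. s k \<omega>) = ?V \<omega>" for \<omega>
    by (simp_all add: q_def)
  have [measurable]: "q \<in> borel_measurable (PiM {..<n} (\<lambda>_. borel))" unfolding q_def by measurable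
  have iU: "integrable M ?U" and iV: "integrable M ?V"
    using quadratic_form_mean(2)[of A] S.quadratic_form_mean(2)[of A] by auto
  have mU: "(LINT \<omega>|M. ?U \<omega>) = 0"
    using quadratic_form_mean[of A] by (simp add: prob_space)
  have cross: "(LINT \<omega>|M. ?U \<omega> * ?V \<omega>) = 0" "integrable M (\<lambda>\<omega>. ?U \<omega> * ?V \<omega>)"
    using product_expectation[of q q] iU iV mU unfolding U V by auto
  show iU2: "integrable M (\<lambda>\<omega>. (?U \<omega>)\<^sup>2)"
    using integrable_square_add[OF _ _ quadratic_form_square_integrable[of A], of "\<lambda>_. - (\<Sum>k<n. \<Sum>l<n. A k l * P k l)"]
    by simp
  have iV2: "integrable M (\<lambda>\<omega>. (?V \<omega>)\<^sup>2)"
    using integrable_square_add[OF _ _ S.quadratic_form_square_integrable[of A], of "\<lambda>_. - (\<Sum>k<n. \<Sum>l<n. A k l * P k l)"]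
    by simp
  have "(LINT \<omega>|M. (?U \<omega>)\<^sup>2) \<le> (LINT \<omega>|M. (?U \<omega>)\<^sup>2) + (LINT \<omega>|M. (?V \<omega>)\<^sup>2)" by simp
  also have "\<dots> = (LINT \<omega>|M. (?U \<omega>)\<^sup>2 + (?V \<omega>)\<^sup>2 - 2 * (?U \<omega> * ?V \<omega>))"
    using iU2 iV2 cross by simp
  also have "\<dots> = (LINT \<omega>|M. (?U \<omega> - ?V \<omega>)\<^sup>2)"
  proof -
    have "u\<^sup>2 + v\<^sup>2 - 2 * (u * v) = (u - v)\<^sup>2" for u v :: real by (simp add: power2_diff)
    then show ?thesis by (simp only:)
  qed
  also have "\<dots> = (LINT \<omega>|M. 4 * (\<Sum>k<n. \<Sum>l<n. A k l * ((w k \<omega> - s k \<omega>) / sqrt 2) * ((w l \<omega> + s l \<omega>) / sqrt 2))\<^sup>2)"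
    using quadratic_form_difference[OF sym] by (simp add: power_mult_distrib)
  also have "\<dots> = 4 * (\<Sum>k<n. \<Sum>l<n. \<Sum>m<n. \<Sum>r<n. A k l * A m r * P k m * P l r)"
    using R.bilinear_form_second_moment[of A] by simp
  finally show "(LINT \<omega>|M. (?U \<omega>)\<^sup>2)
      \<le> 4 * (\<Sum>k<n. \<Sum>l<n. \<Sum>m<n. \<Sum>r<n. A k l * A m r * P k m * P l r)" .
qed

text \<open>
  Given \<open>w\<close>, the inner product is a linear form in \<open>s\<close>, hence normal with variance \<open>w'Pw\<close>; then integrate over
  \<open>w\<close> by Fubini's theorem.
\<close>

lemma cf_inner_product:
  "(CLINT \<omega>|M. iexp (t * (\<Sum>k<n. w k \<omega> * s k \<omega>)))
    = complex_of_real (LINT \<omega>|M. exp (- (t\<^sup>2 * quad n P (\<lambda>k. w k \<omega>)) / 2))"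
proof -
  let ?PM = "PiM {..<n} (\<lambda>_. borel :: real measure)"
  let ?W = "\<lambda>\<omega>. \<lambda>k\<in>{..<n}. w k \<omega>" and ?S = "\<lambda>\<omega>. \<lambda>k\<in>{..<n}. s k \<omega>"
  have [measurable]: "?W \<in> measurable M ?PM" "?S \<in> measurable M ?PM" by measurable
  interpret W: prob_space "distr M ?PM ?W" by (rule prob_space_distr) simp
  interpret S: prob_space "distr M ?PM ?S" by (rule prob_space_distr) simp
  interpret WS: pair_prob_space "distr M ?PM ?W" "distr M ?PM ?S" ..
  define F where "F = (\<lambda>(x, y). iexp (t * (\<Sum>k<n. (x k :: real) * y k)))"
  have [measurable]: "F \<in> borel_measurable (?PM \<Otimes>\<^sub>M ?PM)" unfolding F_def by measurable
  have prod: "distr M ?PM ?W \<Otimes>\<^sub>M distr M ?PM ?S = distr M (?PM \<Otimes>\<^sub>M ?PM) (\<lambda>x. (?W x, ?S x))"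
    using indep_ws unfolding indep_var_distribution_eq by simp
  have iF: "integrable (distr M ?PM ?W \<Otimes>\<^sub>M distr M ?PM ?S) F"
    by (rule WS.P.integrable_const_bound[where B=1]) (auto simp: F_def)
  have inner: "(CLINT y|distr M ?PM ?S. F (x, y)) = complex_of_real (exp (- (t\<^sup>2 * quad n P x) / 2))"
    if [measurable]: "x \<in> space ?PM" for x
  proof -
    have "(CLINT y|distr M ?PM ?S. F (x, y)) = (CLINT \<omega>|M. F (x, ?S \<omega>))"
      by (rule integral_distr) measurable
    also have "\<dots> = (CLINT \<omega>|M. iexp (\<Sum>k<n. (t * x k) * s k \<omega>))"
      by (simp add: F_def sum_distrib_left mult.assoc)
    also have "\<dots> = complex_of_real (exp (- (t\<^sup>2 * quad n P x) / 2))"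
      unfolding cf_s quad_scale ..
    finally show ?thesis .
  qed
  have "(CLINT \<omega>|M. iexp (t * (\<Sum>k<n. w k \<omega> * s k \<omega>))) = (CLINT \<omega>|M. F (?W \<omega>, ?S \<omega>))"
    by (simp add: F_def)
  also have "\<dots> = integral\<^sup>L (distr M (?PM \<Otimes>\<^sub>M ?PM) (\<lambda>x. (?W x, ?S x))) F"
    by (subst integral_distr) auto
  also have "\<dots> = (CLINT x|distr M ?PM ?W. CLINT y|distr M ?PM ?S. F (x, y))"
    unfolding prod[symmetric] by (rule WS.integral_fst'[OF iF, symmetric])
  also have "\<dots> = (CLINT x|distr M ?PM ?W. complex_of_real (exp (- (t\<^sup>2 * quad n P x) / 2)))"
    by (rule Bochner_Integration.integral_cong) (simp_all only: space_distr inner)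
  also have "\<dots> = (CLINT \<omega>|M. complex_of_real (exp (- (t\<^sup>2 * quad n P (?W \<omega>)) / 2)))"
    unfolding quad_def by (rule integral_distr) measurable
  also have "\<dots> = (CLINT \<omega>|M. complex_of_real (exp (- (t\<^sup>2 * quad n P (\<lambda>k. w k \<omega>)) / 2)))"
    by (simp add: quad_def)
  finally show ?thesis by (simp only: integral_complex_of_real)
qed

end

section \<open>Eigenvalue bounds for covariance matrices\<close>

text \<open>
  A nonnegative form is minimal where it vanishes, so its gradient is zero there. Quantitatively, the
  form at \<open>v + t e\<^sub>k\<close> is \<open>2 t x + t\<^sup>2 d\<close>, where \<open>x\<close> is the \<open>k\<close>-th entry of \<open>Cv\<close> and
  \<open>d\<close> the form at \<open>e\<^sub>k\<close>, and the choice \<open>t = -x/(d + 1)\<close> makes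
  it negative unless \<open>x = 0\<close>.
\<close>

lemma psd_kernel:
  assumes sym: "\<And>k l. k < n \<Longrightarrow> l < n \<Longrightarrow> C k l = C l k"
    and psd: "\<And>a. quad n C a \<ge> 0" and zero: "quad n C v = 0" and k: "k < n"
  shows "(\<Sum>l<n. C k l * v l) = 0"
proof -
  define e where "e l = (if l = k then 1 else 0 :: real)" for l :: nat
  define x where "x = (\<Sum>l<n. C k l * v l)"
  define d where "d = quad n C e"
  have d0: "d \<ge> 0" unfolding d_def by (rule psd)
  have "(\<Sum>i<n. \<Sum>l<n. e i * C i l * v l) = (\<Sum>i<n. if i = k then x else 0)"
    by (intro sum.cong refl) (auto simp: e_def x_def)
  also have "\<dots> = x" using k by simp
  finally have x: "(\<Sum>i<n. \<Sum>l<n. e i * C i l * v l) = x" .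
  have "t\<^sup>2 * d + 2 * (t * x) \<ge> 0" for t
  proof -
    have "0 \<le> quad n C (\<lambda>i. t * e i + v i)" by (rule psd)
    also have "\<dots> = t\<^sup>2 * d + 2 * (\<Sum>i<n. \<Sum>l<n. t * e i * C i l * v l)"
      using quad_add[of n C "\<lambda>i. t * e i" v, OF sym] zero by (simp add: quad_scale d_def)
    also have "(\<Sum>i<n. \<Sum>l<n. t * e i * C i l * v l) = t * x"
      unfolding x[symmetric] sum_distrib_left by (simp add: mult.assoc)
    finally show ?thesis .
  qed
  from this[of "- x / (d + 1)"] have "0 \<le> (x / (d + 1))\<^sup>2 * d - 2 * x\<^sup>2 / (d + 1)"
    by (simp add: power2_eq_square)
  also have "\<dots> = - x\<^sup>2 * (d + 2) / (d + 1)\<^sup>2"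
    using d0 by (simp add: power_divide divide_simps) (simp add: power2_eq_square algebra_simps)
  finally have "x\<^sup>2 * (d + 2) \<le> 0" using d0 by (simp add: zero_le_divide_iff divide_le_0_iff)
  then show ?thesis using d0 unfolding x_def[symmetric] by (simp add: mult_le_0_iff)
qed

text \<open>
  The form attains its maximum \<open>m\<close> over the unit sphere at some \<open>v\<close>. Then \<open>mI - P\<close> is positive semidefinite
  and vanishes at \<open>v\<close>, so \<open>v\<close> lies in its kernel, that is, \<open>v\<close> is an eigenvector. The sphere is compact as a
  subset of a product of intervals, with coordinates from \<open>n\<close> on set to \<open>0\<close>.
\<close>

lemma rayleigh_maximizer:
  assumes n: "n > 0" and sym: "\<And>k l. k < n \<Longrightarrow> l < n \<Longrightarrow> P k l = P l k"
  shows "\<exists>v m. (\<exists>k<n. v k \<noteq> 0) \<and> (\<forall>k<n. (\<Sum>l<n. P k l * v l) = m * v k) \<and>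
    (\<forall>x. quad n P x \<le> m * (\<Sum>k<n. (x k)\<^sup>2))"
proof -
  define S where "S = (PiE UNIV (\<lambda>k. if k < n then {-1..1} else {0})) \<inter> {x :: nat \<Rightarrow> real. (\<Sum>k<n. (x k)\<^sup>2) = 1}"
  have cont: "continuous_on A (\<lambda>x :: nat \<Rightarrow> real. x k)" for k A
    by (rule continuous_on_subset[OF continuous_on_product_coordinates]) simp
  have "compactin (product_topology (\<lambda>_. euclidean) UNIV) (PiE UNIV (\<lambda>k. if k < n then {-1..1} else {0 :: real}))"
    by (subst compactin_PiE) auto
  then have "compact (PiE UNIV (\<lambda>k. if k < n then {-1..1} else {0 :: real}))"
    by (simp add: euclidean_product_topology)
  moreover have "closed {x :: nat \<Rightarrow> real. (\<Sum>k<n. (x k)\<^sup>2) = 1}"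
    by (intro closed_Collect_eq continuous_intros cont)
  ultimately have "compact S" unfolding S_def by (rule compact_Int_closed)
  moreover have "(\<lambda>k. if k = 0 then 1 else 0) \<in> S"
    using n by (auto simp: S_def if_distrib[of "\<lambda>x. x\<^sup>2"] cong: if_cong)
  then have "S \<noteq> {}" by blast
  moreover have "continuous_on S (quad n P)"
    unfolding quad_def by (intro continuous_intros cont)
  ultimately obtain v where v: "v \<in> S" and max: "\<And>x. x \<in> S \<Longrightarrow> quad n P x \<le> quad n P v"
    using continuous_attains_sup[of S "quad n P"] by blast
  define m where "m = quad n P v"
  have bound: "quad n P x \<le> m * (\<Sum>k<n. (x k)\<^sup>2)" for x
  proof (cases "(\<Sum>k<n. (x k)\<^sup>2) = 0")
    case True
    then have "x k = 0" if "k < n" for k using that by (subst (asm) sum_nonneg_eq_0_iff) auto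
    then show ?thesis using True by (simp add: quad_def)
  next
    case False
    define N where "N = (\<Sum>k<n. (x k)\<^sup>2)"
    have N: "N > 0" using False sum_nonneg[of "{..<n}" "\<lambda>k. (x k)\<^sup>2"] unfolding N_def by simp
    define y where "y k = (if k < n then 1 / sqrt N * x k else 0)" for k
    have "(\<Sum>k<n. (y k)\<^sup>2) = 1"
      using N by (simp add: y_def power_mult_distrib power_divide flip: sum_divide_distrib N_def)
    moreover from this have "\<bar>y k\<bar> \<le> 1" if "k < n" for k
      using member_le_sum[of k "{..<n}" "\<lambda>k. (y k)\<^sup>2"] that by (simp add: abs_square_le_1)
    moreover have "y k = 0" if "\<not> k < n" for k using that by (simp add: y_def)
    ultimately have "y \<in> S" unfolding S_def by (auto simp: abs_le_iff minus_le_iff)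
    then have "quad n P y \<le> m" unfolding m_def by (rule max)
    moreover have "quad n P y = quad n P (\<lambda>k. 1 / sqrt N * x k)"
      by (rule quad_cong) (simp add: y_def)
    ultimately have "quad n P x / N \<le> m"
      using N unfolding quad_scale by (simp add: power_divide)
    then show ?thesis using N by (simp add: field_simps N_def)
  qed
  define C where "C k l = (if k = l then m else 0) - P k l" for k l
  have Cq: "quad n C x = m * (\<Sum>k<n. (x k)\<^sup>2) - quad n P x" for x
  proof -
    have "quad n C x = (\<Sum>k<n. \<Sum>l<n. (if k = l then m * (x k)\<^sup>2 else 0) - x k * P k l * x l)"
      unfolding quad_def C_def by (intro sum.cong refl) (auto simp: algebra_simps power2_eq_square)
    then show ?thesis by (simp add: sum_subtractf quad_def sum_distrib_left)
  qed
  have v1: "(\<Sum>k<n. (v k)\<^sup>2) = 1" using v by (simp add: S_def)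
  have "(\<Sum>l<n. P k l * v l) = m * v k" if k: "k < n" for k
  proof -
    have "(\<Sum>l<n. C k l * v l) = 0"
    proof (rule psd_kernel[OF _ _ _ k])
      show "C k l = C l k" if "k < n" "l < n" for k l using sym that by (auto simp: C_def)
      show "quad n C a \<ge> 0" for a using bound[of a] by (simp add: Cq)
      show "quad n C v = 0" by (simp add: Cq v1 m_def)
    qed
    then show ?thesis
      using k by (simp add: C_def left_diff_distrib sum_subtractf if_distrib[of "\<lambda>x. x * _"] cong: if_cong)
  qed
  moreover have "\<exists>k<n. v k \<noteq> 0"
    using v1 by (rule_tac ccontr) simp
  ultimately show ?thesis using bound by blast
qed

lemma eigenvalue_in_spectrum:
  fixes A :: "real mat"
  assumes A: "A \<in> carrier_mat n n" and v: "\<exists>k<n. v k \<noteq> 0"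
    and eig: "\<And>k. k < n \<Longrightarrow> (\<Sum>l<n. A $$ (k, l) * v l) = m * v k"
  shows "m \<in> spectrum A"
proof -
  have "eigenvector A (vec n v) m"
    unfolding eigenvector_def
  proof (intro conjI)
    show "vec n v \<noteq> 0\<^sub>v (dim_row A)"
      using v A by (metis carrier_matD(1) index_vec index_zero_vec(1))
    show "A *\<^sub>v vec n v = m \<cdot>\<^sub>v vec n v"
      using A eig by (intro eq_vecI) (auto simp: scalar_prod_def row_def lessThan_atLeast0)
  qed (use A in auto)
  then show ?thesis unfolding spectrum_def eigenvalue_def by blast
qed

lemma covariance_matrix_sym:
  "covariance_matrix d A \<Longrightarrow> k < d \<Longrightarrow> l < d \<Longrightarrow> A $$ (k, l) = A $$ (l, k)"
  unfolding covariance_matrix_def by (metis carrier_matD index_transpose_mat(1))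

lemma covariance_matrix_psd:
  assumes "covariance_matrix d A" shows "0 \<le> quad d (\<lambda>k l. A $$ (k, l)) a"
proof -
  have A: "A \<in> carrier_mat d d" using assms by (simp add: covariance_matrix_def)
  have "0 \<le> scalar_prod (vec d a) (A *\<^sub>v vec d a)"
    using assms by (simp add: covariance_matrix_def)
  also have "\<dots> = quad d (\<lambda>k l. A $$ (k, l)) a"
    using A by (simp add: quad_def scalar_prod_def row_def lessThan_atLeast0 sum_distrib_left mult.assoc)
  finally show ?thesis .
qed

lemma lambda_max_quad_bound:
  assumes A: "covariance_matrix n A" and n: "n > 0"
  shows "quad n (\<lambda>k l. A $$ (k, l)) x \<le> lambda_max A * (\<Sum>k<n. (x k)\<^sup>2)"
proof -
  have Ac: "A \<in> carrier_mat n n" using A by (simp add: covariance_matrix_def)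
  let ?P = "\<lambda>k l. A $$ (k, l)"
  have "\<exists>v m. (\<exists>k<n. v k \<noteq> 0) \<and> (\<forall>k<n. (\<Sum>l<n. ?P k l * v l) = m * v k) \<and>
    (\<forall>x. quad n ?P x \<le> m * (\<Sum>k<n. (x k)\<^sup>2))"
    by (rule rayleigh_maximizer) (use n covariance_matrix_sym[OF A] in auto)
  then obtain v m where vm: "(\<exists>k<n. v k \<noteq> 0) \<and> (\<forall>k<n. (\<Sum>l<n. ?P k l * v l) = m * v k) \<and>
    (\<forall>x. quad n ?P x \<le> m * (\<Sum>k<n. (x k)\<^sup>2))" by (elim exE)
  then have v: "\<exists>k<n. v k \<noteq> 0" "\<And>k. k < n \<Longrightarrow> (\<Sum>l<n. A $$ (k, l) * v l) = m * v k"
    and b: "quad n ?P x \<le> m * (\<Sum>k<n. (x k)\<^sup>2)" for x by simp_all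
  have "m \<in> spectrum A" by (rule eigenvalue_in_spectrum[OF Ac v])
  then have "m \<le> lambda_max A"
    unfolding lambda_max_def by (intro Max_ge card_finite_spectrum(1)[OF Ac])
  then show ?thesis
    by (intro order_trans[OF b] mult_right_mono sum_nonneg) auto
qed

text \<open>
  For a positive semidefinite matrix the bound on the quadratic form passes to the operator norm. With
  \<open>y = Ax\<close>, expand the form at \<open>c x - y\<close>.
\<close>

lemma lambda_max_operator_bound:
  assumes A: "covariance_matrix n A" and n: "n > 0" and c: "lambda_max A \<le> c"
  shows "(\<Sum>k<n. (\<Sum>l<n. A $$ (k, l) * x l)\<^sup>2) \<le> c\<^sup>2 * (\<Sum>k<n. (x k)\<^sup>2)"
proof -
  let ?P = "\<lambda>k l. A $$ (k, l)"
  let ?q = "quad n ?P"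
  define y where "y k = (\<Sum>l<n. A $$ (k, l) * x l)" for k
  define Y X where "Y = (\<Sum>k<n. (y k)\<^sup>2)" and "X = (\<Sum>k<n. (x k)\<^sup>2)"
  note sym = covariance_matrix_sym[OF A]
  have X0: "X \<ge> 0" and Y0: "Y \<ge> 0" unfolding X_def Y_def by (auto intro: sum_nonneg)
  have b: "?q z \<le> c * (\<Sum>k<n. (z k)\<^sup>2)" for z
    using lambda_max_quad_bound[OF A n, of z] mult_right_mono[OF c, of "\<Sum>k<n. (z k)\<^sup>2"]
    by (smt (verit) sum_nonneg zero_le_power2)
  have cross: "(\<Sum>k<n. \<Sum>l<n. y k * ?P k l * x l) = Y"
    unfolding Y_def by (intro sum.cong refl) (simp add: y_def power2_eq_square sum_distrib_left mult.assoc)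
  (* Positivity of the form at c x - y bounds the cross term y'Ax = |y|^2 by the two Rayleigh
     quotients; this is the Cauchy-Schwarz inequality of the form, without square roots. *)
  have "0 \<le> ?q (\<lambda>k. (-1) * y k + c * x k)" by (rule covariance_matrix_psd[OF A])
  also have "\<dots> = ?q y + c\<^sup>2 * ?q x - 2 * c * Y"
  proof -
    have "(\<Sum>k<n. \<Sum>l<n. (-1 * y k) * ?P k l * (c * x l)) = - c * Y"
      unfolding cross[symmetric] sum_distrib_left by (intro sum.cong refl) simp
    then show ?thesis
      using quad_add[of n ?P "\<lambda>k. (-1) * y k" "\<lambda>k. c * x k"] sym
        quad_scale[of n ?P "-1" y] quad_scale[of n ?P c x] by simp
  qed
  also have "\<dots> \<le> c * Y + c\<^sup>2 * (c * X) - 2 * c * Y"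
    using b[of y] b[of x] mult_left_mono[of "?q x" "c * X" "c\<^sup>2"] by (simp add: Y_def X_def)
  finally have le: "c * Y \<le> c * (c\<^sup>2 * X)" by (simp add: algebra_simps power2_eq_square)
  show ?thesis
  proof (cases "c > 0")
    case True
    then show ?thesis using le by (simp add: Y_def X_def y_def)
  next
    case False
    have "?q y = 0" "?q x = 0" 
      using b[of y] b[of x] False covariance_matrix_psd[OF A] X0 Y0 unfolding X_def Y_def
      by (smt (verit) mult_nonneg_nonneg minus_mult_minus mult_minus_left)+
    then have "Y = 0"
      unfolding Y_def y_def using psd_kernel[of n ?P x] sym covariance_matrix_psd[OF A] by simp
    then show ?thesis using X0 by (simp add: Y_def X_def y_def)
  qed
qed

text \<open>
  If the smallest eigenvalue is positive, the form is positive at every nonzero vector, since a zero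
  would be an eigenvector for \<open>0\<close>. Evaluate it at \<open>e\<^sub>i\<close> and at \<open>-a\<^sub>i\<^sub>j e\<^sub>i + a\<^sub>i\<^sub>i e\<^sub>j\<close>.
\<close>

lemma lambda_min_pos_two_by_two:
  assumes A: "covariance_matrix n A" and lm: "lambda_min A > 0"
    and ij: "i < n" "j < n" "i \<noteq> j"
  shows "0 < A $$ (i, i)" and "(A $$ (i, j))\<^sup>2 < A $$ (i, i) * A $$ (j, j)"
proof -
  have Ac: "A \<in> carrier_mat n n" using A by (simp add: covariance_matrix_def)
  let ?P = "\<lambda>k l. A $$ (k, l)"
  note sym = covariance_matrix_sym[OF A]
  have strict: "quad n ?P v > 0" if v: "\<exists>k<n. v k \<noteq> 0" for v
  proof (rule ccontr)
    assume "\<not> quad n ?P v > 0"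
    then have "quad n ?P v = 0" using covariance_matrix_psd[OF A, of v] by simp
    then have "(\<Sum>l<n. ?P k l * v l) = 0 * v k" if "k < n" for k
      using psd_kernel[of n ?P v k] sym covariance_matrix_psd[OF A] that by simp
    then have "0 \<in> spectrum A" by (rule eigenvalue_in_spectrum[OF Ac v])
    then have "lambda_min A \<le> 0"
      unfolding lambda_min_def by (intro Min_le card_finite_spectrum(1)[OF Ac])
    then show False using lm by simp
  qed
  define v where "v x y k = (if k = i then x else if k = j then y else 0 :: real)" for x y :: real and k :: nat
  have q: "quad n ?P (v x y) = x\<^sup>2 * A $$ (i, i) + 2 * x * y * A $$ (i, j) + y\<^sup>2 * A $$ (j, j)" for x y
  proof -
    have s: "(\<Sum>k<n. f k * v x y k) = f i * x + f j * y" for f :: "nat \<Rightarrow> real"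
    proof -
      have "(\<Sum>k<n. f k * v x y k) = (\<Sum>k\<in>{i, j}. f k * v x y k)"
        by (rule sum.mono_neutral_right) (use ij in \<open>auto simp: v_def\<close>)
      then show ?thesis using ij by (simp add: v_def)
    qed
    have "quad n ?P (v x y) = (\<Sum>k<n. (\<Sum>l<n. ?P k l * v x y l) * v x y k)"
      unfolding quad_def by (simp add: sum_distrib_left sum_distrib_right mult_ac)
    then show ?thesis using sym[OF ij(1,2)] unfolding s by (simp add: algebra_simps power2_eq_square)
  qed
  show ii: "0 < A $$ (i, i)"
    using strict[of "v 1 0"] ij q[of 1 0] by (auto simp: v_def)
  have "0 < quad n ?P (v (- A $$ (i, j)) (A $$ (i, i)))"
    using ij ii by (intro strict) (auto simp: v_def intro!: exI[of _ j])
  also have "\<dots> = A $$ (i, i) * (A $$ (i, i) * A $$ (j, j) - (A $$ (i, j))\<^sup>2)"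
    unfolding q by (simp add: power2_eq_square algebra_simps)
  finally show "(A $$ (i, j))\<^sup>2 < A $$ (i, i) * A $$ (j, j)" using ii by (simp add: zero_less_mult_iff)
qed

lemma frobenius_norm_eq_frob:
  "A \<in> carrier_mat n n \<Longrightarrow> frobenius_norm A = frob n (\<lambda>k l. A $$ (k, l))"
  by (simp add: frobenius_norm_def frob_def)

section \<open>The correlation coefficient in terms of centred cross sums\<close>

text \<open>
  The centred sum of cross products of two data vectors, that is, \<open>n - 1\<close> times their sample covariance.
\<close>

definition css :: "nat \<Rightarrow> (nat \<Rightarrow> real) \<Rightarrow> (nat \<Rightarrow> real) \<Rightarrow> real" where
  "css n x y = (\<Sum>k<n. (x k - (\<Sum>l<n. x l) / n) * (y k - (\<Sum>l<n. y l) / n))"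

lemma css_eq:
  assumes "n > 0"
  shows "css n x y = (\<Sum>k<n. x k * y k) - (\<Sum>k<n. x k) * (\<Sum>k<n. y k) / n"
proof -
  let ?X = "\<Sum>k<n. x k" and ?Y = "\<Sum>k<n. y k"
  have "css n x y = (\<Sum>k<n. x k * y k - x k * (?Y / n) - ?X / n * y k + ?X / n * (?Y / n))"
    unfolding css_def by (intro sum.cong refl) (simp add: algebra_simps)
  also have "\<dots> = (\<Sum>k<n. x k * y k) - ?X * (?Y / n) - ?X / n * ?Y + n * (?X / n * (?Y / n))"
    by (simp only: sum.distrib sum_subtractf sum_distrib_left[symmetric] sum_distrib_right[symmetric]) simp
  also have "\<dots> = (\<Sum>k<n. x k * y k) - ?X * ?Y / n"
    using assms by (simp add: field_simps)
  finally show ?thesis .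
qed

lemma css_cong:
  "(\<And>k. k < n \<Longrightarrow> x k = x' k) \<Longrightarrow> (\<And>k. k < n \<Longrightarrow> y k = y' k) \<Longrightarrow> css n x y = css n x' y'"
  unfolding css_def by (intro sum.cong arg_cong2[where f="(*)"] arg_cong2[where f="(-)"] arg_cong2[where f="(/)"] refl) auto

lemma css_combination: "css n (\<lambda>k. a * x k + b * y k) (\<lambda>k. a' * x k + b' * y k)
    = a * a' * css n x x + b * b' * css n y y + (a * b' + a' * b) * css n x y"
proof -
  have lin: "(\<Sum>k<n. a * x k + b * y k) / n = a * ((\<Sum>k<n. x k) / n) + b * ((\<Sum>k<n. y k) / n)" for a b
    by (simp only: sum.distrib sum_distrib_left[symmetric] add_divide_distrib times_divide_eq_right)
  have alg: "(a * u + b * v - (a * p + b * q)) * (a' * u + b' * v - (a' * p + b' * q))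
    = a * a' * ((u - p) * (u - p)) + b * b' * ((v - q) * (v - q)) + (a * b' + a' * b) * ((u - p) * (v - q))"
    for u v p q :: real by (simp add: algebra_simps)
  show ?thesis
    unfolding css_def lin sum_distrib_left sum.distrib[symmetric] alg ..
qed

lemma css_affine:
  assumes "n > 0"
  shows "css n (\<lambda>k. a + b * x k) (\<lambda>k. a' + b' * y k) = b * b' * css n x y"
proof -
  have m: "(\<Sum>l<n. a + b * x l) / n = a + b * ((\<Sum>l<n. x l) / n)" for a b and x :: "nat \<Rightarrow> real"
    using assms by (simp add: sum.distrib sum_distrib_left[symmetric] add_divide_distrib)
  show ?thesis
    unfolding css_def m sum_distrib_left by (intro sum.cong refl) (simp add: algebra_simps)
qed

text \<open>
  This is the deterministic core of the proof. Here \<open>W\<close>, \<open>S\<close>, \<open>D\<close> are the centred sums of \<open>w\<close> with \<open>w\<close>, \<open>s\<close> with \<open>s\<close>,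
  and \<open>w\<close> with \<open>s\<close>, and \<open>yy\<close>, \<open>zz\<close>, \<open>yz\<close> are those of \<open>y = \<gamma>w + \<delta>s\<close> and \<open>z = \<delta>w + \<gamma>s\<close>. If the geometric mean of
  \<open>yy\<close> and \<open>zz\<close> is replaced by the arithmetic mean, the numerator \<open>yz - \<rho> \<surd>(yy zz)\<close> becomes exactly
  \<open>(1 - \<rho>\<^sup>2) D\<close>. The gap between the means is of second order in \<open>yy - zz\<close>, whose square is
  \<open>(1 - \<rho>\<^sup>2) (W - S)\<^sup>2\<close>. So the factor \<open>1 - \<rho>\<^sup>2\<close> cancels throughout, and the error is uniform in \<open>\<rho>\<close>.
\<close>

lemma normalized_correlation_expansion:
  fixes W S D F \<rho> \<gamma> \<delta> \<eta> :: real and n :: nat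
  assumes n: "n > 0" and F: "F > 0" and \<rho>: "\<bar>\<rho>\<bar> < 1"
    and gd: "\<gamma>\<^sup>2 + \<delta>\<^sup>2 = 1" "2 * \<gamma> * \<delta> = \<rho>"
    and \<eta>: "\<eta> \<le> 1/2" and H: "\<bar>W / n - 1\<bar> + \<bar>S / n - 1\<bar> + \<bar>D / n\<bar> \<le> \<eta>"
  defines "yy \<equiv> \<gamma>\<^sup>2 * W + \<delta>\<^sup>2 * S + \<rho> * D" and "zz \<equiv> \<delta>\<^sup>2 * W + \<gamma>\<^sup>2 * S + \<rho> * D"
    and "yz \<equiv> \<rho> * (W + S) / 2 + D"
  shows "\<bar>sqrt n * (yz / sqrt (yy * zz) - \<rho>) / (sqrt (F\<^sup>2 / n) * (1 - \<rho>\<^sup>2)) - D / F\<bar>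
    \<le> 2 * \<eta> * \<bar>D / F\<bar> + (W - S)\<^sup>2 / (n * F)"
proof -
  have n': "real n > 0" using n by simp
  have \<rho>2: "1 - \<rho>\<^sup>2 > 0" using \<rho> by (simp add: abs_square_less_1)
  have g1: "\<gamma>\<^sup>2 \<le> 1" "\<delta>\<^sup>2 \<le> 1" using gd(1) by (smt (verit) zero_le_power2)+
  define a b where "a = yy / n" and "b = zz / n"
  have near: "\<bar>(p * W + q * S + \<rho> * D) / n - 1\<bar> \<le> \<eta>" if pq: "0 \<le> p" "0 \<le> q" "p + q = 1" for p q
  proof -
    have "(p * W + q * S + \<rho> * D) / n - 1 = p * (W / n - 1) + q * (S / n - 1) + \<rho> * (D / n)"
      using pq(3) by (simp add: algebra_simps add_divide_distrib)
    also have "\<bar>\<dots>\<bar> \<le> \<bar>p * (W / n - 1)\<bar> + \<bar>q * (S / n - 1)\<bar> + \<bar>\<rho> * (D / n)\<bar>"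
      by (rule order_trans[OF abs_triangle_ineq add_right_mono[OF abs_triangle_ineq]])
    also have "\<dots> = p * \<bar>W / n - 1\<bar> + q * \<bar>S / n - 1\<bar> + \<bar>\<rho>\<bar> * \<bar>D / n\<bar>"
      using pq by (simp only: abs_mult abs_of_nonneg)
    also have "\<dots> \<le> 1 * \<bar>W / n - 1\<bar> + 1 * \<bar>S / n - 1\<bar> + 1 * \<bar>D / n\<bar>"
      using pq \<rho> by (intro add_mono mult_right_mono) auto
    finally show ?thesis using H by simp
  qed
  have a: "\<bar>a - 1\<bar> \<le> \<eta>" unfolding a_def yy_def by (rule near) (use gd(1) in auto)
  have b: "\<bar>b - 1\<bar> \<le> \<eta>" unfolding b_def zz_def by (rule near) (use gd(1) in auto)
  have ab: "a \<ge> 1/2" "b \<ge> 1/2" using a b \<eta> by linarith+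
  define r where "r = sqrt (a * b)"
  have \<eta>0: "0 \<le> \<eta>" using a by linarith
  have r_lo: "1 - \<eta> \<le> r"
    unfolding r_def
  proof (rule real_le_rsqrt)
    show "(1 - \<eta>)\<^sup>2 \<le> a * b" unfolding power2_eq_square using a b \<eta> by (intro mult_mono) linarith+
  qed
  have r_hi: "r \<le> 1 + \<eta>"
    unfolding r_def
  proof (rule real_le_lsqrt)
    show "a * b \<le> (1 + \<eta>)\<^sup>2" unfolding power2_eq_square using a b \<eta> ab by (intro mult_mono) linarith+
  qed (use \<eta>0 ab in auto)
  have r: "r \<ge> 1/2" using r_lo \<eta> by linarith
  have sq: "sqrt (yy * zz) = n * r"
    using n' by (simp add: r_def a_def b_def real_sqrt_divide real_sqrt_mult)
  define e where "e = \<rho> * (n * ((a + b) / 2 - r))"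
  have yz: "yz - \<rho> * (n * r) = (1 - \<rho>\<^sup>2) * D + e"
  proof -
    have "n * (a + b) = yy + zz" using n' by (simp add: a_def b_def field_simps)
    also have "\<dots> = (\<gamma>\<^sup>2 + \<delta>\<^sup>2) * (W + S) + 2 * \<rho> * D" unfolding yy_def zz_def by (simp add: algebra_simps)
    finally have "n * (a + b) = W + S + 2 * \<rho> * D" using gd(1) by simp
    then have "e = \<rho> * ((W + S + 2 * \<rho> * D) / 2) - \<rho> * (n * r)"
      unfolding e_def by (simp add: algebra_simps)
    then show ?thesis unfolding yz_def by (simp add: field_simps power2_eq_square)
  qed
  have gap: "0 \<le> (a + b) / 2 - r" "(a + b) / 2 - r \<le> (a - b)\<^sup>2 / 2"
  proof -
    have "r = sqrt a * sqrt b" unfolding r_def by (rule real_sqrt_mult)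
    then have e1: "(a + b) / 2 - r = (sqrt a - sqrt b)\<^sup>2 / 2"
      using ab by (simp add: power2_diff)
    show "0 \<le> (a + b) / 2 - r" unfolding e1 by simp
    have "a - b = (sqrt a - sqrt b) * (sqrt a + sqrt b)"
      using ab by (simp add: algebra_simps flip: power2_eq_square)
    then have "(a - b)\<^sup>2 = (sqrt a - sqrt b)\<^sup>2 * (sqrt a + sqrt b)\<^sup>2" by (simp add: power_mult_distrib)
    moreover have "(sqrt a + sqrt b)\<^sup>2 \<ge> 1"
    proof -
      have "(sqrt a + sqrt b)\<^sup>2 = a + b + 2 * (sqrt a * sqrt b)" using ab by (simp add: power2_sum)
      moreover have "0 \<le> sqrt a * sqrt b" using ab by simp
      ultimately show ?thesis using ab by linarith
    qed
    ultimately have "(sqrt a - sqrt b)\<^sup>2 \<le> (a - b)\<^sup>2"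
      using mult_left_mono[of 1 "(sqrt a + sqrt b)\<^sup>2" "(sqrt a - sqrt b)\<^sup>2"] by simp
    then show "(a + b) / 2 - r \<le> (a - b)\<^sup>2 / 2" unfolding e1 by simp
  qed
  have absq: "(a - b)\<^sup>2 = (1 - \<rho>\<^sup>2) * (W - S)\<^sup>2 / (real n)\<^sup>2"
  proof -
    have "a - b = (\<gamma>\<^sup>2 - \<delta>\<^sup>2) * (W - S) / n"
      unfolding a_def b_def yy_def zz_def diff_divide_distrib[symmetric] by (simp add: algebra_simps)
    moreover have "(\<gamma>\<^sup>2 - \<delta>\<^sup>2)\<^sup>2 = (\<gamma>\<^sup>2 + \<delta>\<^sup>2)\<^sup>2 - (2 * \<gamma> * \<delta>)\<^sup>2"
      by (simp add: power2_eq_square algebra_simps)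
    ultimately show ?thesis using gd by (simp add: power_mult_distrib power_divide)
  qed
  have e: "\<bar>e\<bar> \<le> (1 - \<rho>\<^sup>2) * ((W - S)\<^sup>2 / (2 * n))"
  proof -
    have "\<bar>e\<bar> = \<bar>\<rho>\<bar> * (n * ((a + b) / 2 - r))" unfolding e_def abs_mult using gap(1) by simp
    also have "\<dots> \<le> 1 * (n * ((a - b)\<^sup>2 / 2))"
      using \<rho> gap by (intro mult_mono) auto
    also have "\<dots> = (1 - \<rho>\<^sup>2) * ((W - S)\<^sup>2 / (2 * n))"
      unfolding absq using n' by (simp add: field_simps power2_eq_square)
    finally show ?thesis .
  qed
  define e' where "e' = e / (1 - \<rho>\<^sup>2)"
  have e': "\<bar>e'\<bar> \<le> (W - S)\<^sup>2 / (2 * n)"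
    unfolding e'_def abs_divide using \<rho>2 e by (simp add: divide_le_eq mult.commute)
  have T: "sqrt n * (yz / sqrt (yy * zz) - \<rho>) / (sqrt (F\<^sup>2 / n) * (1 - \<rho>\<^sup>2)) = (D + e') / (F * r)"
  proof -
    have "yz / (n * r) - \<rho> = (yz - \<rho> * (n * r)) / (n * r)" using n' r by (simp add: field_simps)
    also have "\<dots> = (1 - \<rho>\<^sup>2) * (D + e') / (n * r)"
      unfolding yz e'_def using \<rho>2 by (simp add: distrib_left)
    finally have y: "yz / (n * r) - \<rho> = (1 - \<rho>\<^sup>2) * (D + e') / (n * r)" .
    have s: "sqrt (F\<^sup>2 / n) = F / sqrt n" using F by (simp add: real_sqrt_divide)
    have gen: "q * (u * X / (q * q * r)) / (F / q * u) = X / (F * r)"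
      if "q > 0" "u > 0" for q u X :: real using that r F by (simp add: field_simps)
    have "sqrt n * ((1 - \<rho>\<^sup>2) * (D + e') / (n * r)) / (F / sqrt n * (1 - \<rho>\<^sup>2)) = (D + e') / (F * r)"
      using gen[of "sqrt n" "1 - \<rho>\<^sup>2" "D + e'"] n' \<rho>2 by simp
    then show ?thesis unfolding sq y s .
  qed
  have split: "(D + e') / (F * r) - D / F = D / F * ((1 - r) / r) + e' / (F * r)"
    using F r by (simp add: field_simps)
  have i1: "\<bar>(1 - r) / r\<bar> \<le> 2 * \<eta>"
  proof -
    have "\<bar>1 - r\<bar> \<le> \<eta>" using r_lo r_hi by linarith
    also have "\<eta> \<le> 2 * \<eta> * r" using r \<eta>0 mult_left_mono[of "1/2" r "2 * \<eta>"] by simp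
    finally show ?thesis using r by (simp add: abs_divide divide_le_eq)
  qed
  have i2: "\<bar>e' / (F * r)\<bar> \<le> (W - S)\<^sup>2 / (n * F)"
  proof -
    have "\<bar>e' / (F * r)\<bar> = \<bar>e'\<bar> / (F * r)" using F r by (simp add: abs_divide abs_mult)
    also have "\<dots> \<le> ((W - S)\<^sup>2 / (2 * n)) / (F * (1/2))"
      using e' F r by (intro frac_le mult_left_mono) auto
    finally show ?thesis by (simp add: mult.commute)
  qed
  have "\<bar>(D + e') / (F * r) - D / F\<bar> \<le> \<bar>D / F\<bar> * \<bar>(1 - r) / r\<bar> + \<bar>e' / (F * r)\<bar>"
    unfolding split by (metis abs_mult abs_triangle_ineq)
  also have "\<dots> \<le> \<bar>D / F\<bar> * (2 * \<eta>) + (W - S)\<^sup>2 / (n * F)"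
    using i1 i2 by (intro add_mono mult_left_mono) auto
  finally show ?thesis unfolding T by (simp add: mult.commute)
qed

lemma iexp_diff_le: "cmod (iexp x - iexp y) \<le> \<bar>x - y\<bar>"
proof -
  have "iexp x - iexp y = iexp y * (iexp (x - y) - 1)"
    by (simp add: right_diff_distrib flip: exp_add)
  then have "cmod (iexp x - iexp y) = cmod (iexp (x - y) - 1)" by (simp add: norm_mult del: of_real_diff)
  also have "\<dots> \<le> \<bar>x - y\<bar>" using iexp_approx1[of "x - y" 0] by (simp del: of_real_diff)
  finally show ?thesis .
qed

text \<open>
  Integrate \<open>2\<bar>f\<bar> \<le> n\<^sup>-\<^sup>1\<^sup>/\<^sup>2 + n\<^sup>1\<^sup>/\<^sup>2 f\<^sup>2\<close>.
\<close>

lemma (in prob_space) abs_expectation_of_second_moment: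
  fixes f :: "'a \<Rightarrow> real" and n :: nat
  assumes [measurable]: "f \<in> borel_measurable M" and i: "integrable M (\<lambda>\<omega>. (f \<omega>)\<^sup>2)"
    and b: "(LINT \<omega>|M. (f \<omega>)\<^sup>2) \<le> C / n" and n: "n > 0"
  shows "integrable M (\<lambda>\<omega>. \<bar>f \<omega>\<bar>)" and "(LINT \<omega>|M. \<bar>f \<omega>\<bar>) \<le> (1 + C) / (2 * sqrt n)"
proof -
  have sn: "sqrt n > 0" using n by simp
  have pt: "\<bar>x\<bar> \<le> (1 / sqrt n + x\<^sup>2 * sqrt n) / 2" for x :: real
  proof -
    have "2 * (\<bar>x\<bar> * sqrt n) \<le> 1 + (\<bar>x\<bar> * sqrt n)\<^sup>2"
      using sum_squares_bound[of 1 "\<bar>x\<bar> * sqrt n"] by simp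
    then have "2 * \<bar>x\<bar> * sqrt n \<le> (1 / sqrt n + x\<^sup>2 * sqrt n) * sqrt n"
      using n sn by (simp add: distrib_right power_mult_distrib mult.assoc)
    then have "2 * \<bar>x\<bar> \<le> 1 / sqrt n + x\<^sup>2 * sqrt n" using sn by (simp only: mult_le_cancel_right_pos)
    then show ?thesis by simp
  qed
  have ib: "integrable M (\<lambda>\<omega>. (1 / sqrt n + (f \<omega>)\<^sup>2 * sqrt n) / 2)" using i by simp
  show ia: "integrable M (\<lambda>\<omega>. \<bar>f \<omega>\<bar>)"
  proof (rule Bochner_Integration.integrable_bound[OF ib])
    show "AE \<omega> in M. norm \<bar>f \<omega>\<bar> \<le> norm ((1 / sqrt n + (f \<omega>)\<^sup>2 * sqrt n) / 2)"
      using order_trans[OF pt abs_ge_self] by simp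
  qed measurable
  have "(LINT \<omega>|M. \<bar>f \<omega>\<bar>) \<le> (LINT \<omega>|M. (1 / sqrt n + (f \<omega>)\<^sup>2 * sqrt n) / 2)"
    by (rule integral_mono[OF ia ib pt])
  also have "\<dots> = (1 / sqrt n + (LINT \<omega>|M. (f \<omega>)\<^sup>2) * sqrt n) / 2"
    using i by (simp add: prob_space)
  also have "\<dots> \<le> (1 / sqrt n + C / n * sqrt n) / 2"
    using b sn by (intro divide_right_mono add_left_mono mult_right_mono) auto
  also have "\<dots> = (1 + C) / (2 * sqrt n)"
    using n by (simp add: field_simps flip: real_sqrt_mult)
  finally show "(LINT \<omega>|M. \<bar>f \<omega>\<bar>) \<le> (1 + C) / (2 * sqrt n)" .
qed

section \<open>Error bounds for the normalized correlation\<close>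

lemma square_add_le: "(a + b)\<^sup>2 \<le> 2 * a\<^sup>2 + 2 * (b :: real)\<^sup>2"
proof -
  have "0 \<le> (a - b)\<^sup>2" by simp
  then show ?thesis by (simp add: power2_sum power2_diff)
qed

text \<open>
  The covariance matrix has unit diagonal and operator norm at most \<open>c\<close>. Consequently \<open>n \<le> F\<^sup>2 \<le> c\<^sup>2 n\<close> for
  its Frobenius norm \<open>F\<close>, which is what makes the error terms below of order \<open>n\<^sup>-\<^sup>1\<^sup>/\<^sup>2\<close>.
\<close>

locale bounded_gauss = indep_gauss +
  fixes c :: real
  assumes n_pos: "n > 0" and c_pos: "c > 0"
    and diag: "\<And>k. k < n \<Longrightarrow> P k k = 1"
    and op: "\<And>x. (\<Sum>k<n. (\<Sum>l<n. P k l * x l)\<^sup>2) \<le> c\<^sup>2 * (\<Sum>k<n. (x k)\<^sup>2)"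
begin

abbreviation "F \<equiv> frob n P"

lemma F2: "F\<^sup>2 = (\<Sum>k<n. \<Sum>l<n. (P k l)\<^sup>2)"
  unfolding frob_def by (simp add: sum_nonneg)

lemma F2_lower: "real n \<le> F\<^sup>2"
proof -
  have "real n = (\<Sum>k<n. (P k k)\<^sup>2)" by (simp add: diag)
  also have "\<dots> \<le> (\<Sum>k<n. \<Sum>l<n. (P k l)\<^sup>2)"
    by (intro sum_mono member_le_sum) auto
  finally show ?thesis unfolding F2 .
qed

lemma F_pos: "F > 0"
  using F2_lower n_pos unfolding frob_def by (simp add: sum_nonneg)

lemma F_lower: "sqrt n \<le> F"
  by (rule real_le_lsqrt) (use F2_lower F_pos in auto)

lemma F2_upper: "F\<^sup>2 \<le> c\<^sup>2 * n"
proof -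
  have "F\<^sup>2 = (\<Sum>l<n. \<Sum>k<n. (P k l)\<^sup>2)" unfolding F2 by (rule sum.swap)
  also have "\<dots> \<le> (\<Sum>l<n. c\<^sup>2)"
  proof (rule sum_mono)
    fix l assume "l \<in> {..<n}"
    then show "(\<Sum>k<n. (P k l)\<^sup>2) \<le> c\<^sup>2"
      using op[of "\<lambda>j. if j = l then 1 else 0"]
      by (simp add: if_distrib[of "\<lambda>x. _ * x"] if_distrib[of "\<lambda>x. x\<^sup>2"] cong: if_cong)
  qed
  finally show ?thesis by (simp add: mult.commute)
qed

lemma F_upper: "F \<le> c * sqrt n"
  by (rule power2_le_imp_le) (use F2_upper c_pos in \<open>auto simp: power_mult_distrib\<close>)

lemma quad_ones: "\<bar>quad n P (\<lambda>_. 1)\<bar> \<le> c * n"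
proof (rule power2_le_imp_le)
  have "quad n P (\<lambda>_. 1) = (\<Sum>k<n. (\<Sum>l<n. P k l) * 1)" by (simp add: quad_def)
  also have "\<dots>\<^sup>2 \<le> (\<Sum>k<n. (\<Sum>l<n. P k l)\<^sup>2) * (\<Sum>k<n. 1\<^sup>2)"
    by (rule Cauchy_Schwarz_ineq_sum)
  also have "\<dots> \<le> (c\<^sup>2 * n) * n"
    using op[of "\<lambda>_. 1"] by (intro mult_mono) auto
  finally show "\<bar>quad n P (\<lambda>_. 1)\<bar>\<^sup>2 \<le> (c * n)\<^sup>2" by (simp add: power_mult_distrib power2_eq_square mult_ac)
qed (use c_pos in simp)

text \<open>
  The second moments in \<open>bilinear_form_second_moment\<close> are needed for three coefficient matrices, treated
  here and in the next two lemmas: the identity, the all-ones matrix, and the covariance matrix itself.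
\<close>

lemma fourfold_delta:
  "(\<Sum>k<n. \<Sum>l<n. \<Sum>m<n. \<Sum>r<n. (if k = l then 1 else 0) * (if m = r then 1 else 0) * P k m * P l r) = F\<^sup>2"
proof -
  have "(\<Sum>r<n. (if k = l then 1 else 0) * (if m = r then 1 else 0) * P k m * P l r)
    = (if k = l then P k m * P k m else 0)" if "m < n" for k l m
    using that by (cases "k = l") (simp_all add: if_distrib[of "\<lambda>x. x * _"] cong: if_cong)
  then have "(\<Sum>k<n. \<Sum>l<n. \<Sum>m<n. \<Sum>r<n. (if k = l then 1 else 0) * (if m = r then 1 else 0) * P k m * P l r)
    = (\<Sum>k<n. \<Sum>l<n. \<Sum>m<n. if k = l then P k m * P k m else 0)"
    by (intro sum.cong refl) simp
  also have "\<dots> = (\<Sum>k<n. \<Sum>m<n. \<Sum>l<n. if k = l then P k m * P k m else 0)"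
    by (rule sum.cong[OF refl], rule sum.swap)
  also have "\<dots> = (\<Sum>k<n. \<Sum>m<n. P k m * P k m)" by simp
  finally show ?thesis unfolding F2 by (simp add: power2_eq_square)
qed

lemma fourfold_ones:
  "(\<Sum>k<n. \<Sum>l<n. \<Sum>m<n. \<Sum>r<n. 1 * 1 * P k m * P l r) = (quad n P (\<lambda>_. 1))\<^sup>2"
proof -
  have "(\<Sum>k<n. \<Sum>l<n. \<Sum>m<n. \<Sum>r<n. P k m * P l r) = (\<Sum>k<n. \<Sum>m<n. \<Sum>l<n. \<Sum>r<n. P k m * P l r)"
    by (rule sum.cong[OF refl], rule sum.swap)
  also have "\<dots> = (quad n P (\<lambda>_. 1))\<^sup>2"
    unfolding square_sum_expand[symmetric] by (simp add: quad_def)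
  finally show ?thesis by simp
qed

text \<open>
  The sum is the squared Frobenius norm of \<open>P\<^sup>2\<close>, and each column of \<open>P\<^sup>2\<close> is \<open>P\<close> applied to a column of \<open>P\<close>.
\<close>

lemma fourfold_P:
  "(\<Sum>k<n. \<Sum>l<n. \<Sum>m<n. \<Sum>r<n. P k l * P m r * P k m * P l r) \<le> c\<^sup>2 * F\<^sup>2"
proof -
  have "(\<Sum>k<n. \<Sum>l<n. \<Sum>m<n. \<Sum>r<n. P k l * P m r * P k m * P l r)
    = (\<Sum>k<n. \<Sum>m<n. \<Sum>l<n. \<Sum>r<n. P k l * P m r * P k m * P l r)"
    by (rule sum.cong[OF refl], rule sum.swap)
  also have "\<dots> = (\<Sum>k<n. \<Sum>r<n. (\<Sum>l<n. P k l * P l r)\<^sup>2)"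
  proof (rule sum.cong[OF refl])
    fix k assume k: "k \<in> {..<n}"
    have "(\<Sum>m<n. \<Sum>l<n. \<Sum>r<n. P k l * P m r * P k m * P l r)
      = (\<Sum>m<n. \<Sum>r<n. \<Sum>l<n. P k l * P m r * P k m * P l r)"
      by (rule sum.cong[OF refl], rule sum.swap)
    also have "\<dots> = (\<Sum>r<n. \<Sum>m<n. \<Sum>l<n. P k l * P m r * P k m * P l r)"
      by (rule sum.swap)
    also have "\<dots> = (\<Sum>r<n. (\<Sum>m<n. P k m * P m r) * (\<Sum>l<n. P k l * P l r))"
      unfolding sum_product by (intro sum.cong refl) (simp add: mult_ac)
    finally show "(\<Sum>m<n. \<Sum>l<n. \<Sum>r<n. P k l * P m r * P k m * P l r)
      = (\<Sum>r<n. (\<Sum>l<n. P k l * P l r)\<^sup>2)" by (simp add: power2_eq_square)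
  qed
  also have "\<dots> = (\<Sum>r<n. \<Sum>k<n. (\<Sum>l<n. P k l * P l r)\<^sup>2)" by (rule sum.swap)
  also have "\<dots> \<le> (\<Sum>r<n. c\<^sup>2 * (\<Sum>l<n. (P l r)\<^sup>2))" by (intro sum_mono op)
  also have "\<dots> = c\<^sup>2 * (\<Sum>r<n. \<Sum>l<n. (P l r)\<^sup>2)" by (simp add: sum_distrib_left)
  also have "(\<Sum>r<n. \<Sum>l<n. (P l r)\<^sup>2) = F\<^sup>2" unfolding F2 by (rule sum.swap)
  finally show ?thesis .
qed

lemma swap_bounded: "bounded_gauss M n P s w c"
  by (intro bounded_gauss.intro swap_pair) (unfold_locales; use n_pos c_pos diag op in auto)

lemma rotate_bounded:
  "bounded_gauss M n P (\<lambda>k \<omega>. (w k \<omega> - s k \<omega>) / sqrt 2) (\<lambda>k \<omega>. (w k \<omega> + s k \<omega>) / sqrt 2) c"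
  by (intro bounded_gauss.intro rotate_pair) (unfold_locales; use n_pos c_pos diag op in auto)

text \<open>
  By \<open>cf_inner_product\<close> the left-hand integral is the expectation of \<open>exp(-t\<^sup>2 q/(2F\<^sup>2))\<close> with \<open>q = w'Pw\<close>. The mean
  of \<open>q\<close> is \<open>F\<^sup>2\<close>, and its standard deviation is of smaller order, at most \<open>2cF\<close>.
\<close>

lemma inner_product_clt:
  "cmod ((CLINT \<omega>|M. iexp (t * ((\<Sum>k<n. w k \<omega> * s k \<omega>) / F))) - complex_of_real (exp (- t\<^sup>2 / 2))) \<le> t\<^sup>2 / 2 * ((1 + 4 * c\<^sup>2) / (2 * sqrt n))"
proof -
  let ?q = "\<lambda>\<omega>. quad n P (\<lambda>k. w k \<omega>)"
  have [measurable]: "(\<lambda>\<omega>. ?q \<omega>) \<in> borel_measurable M" unfolding quad_def by measurable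
  define Z where "Z \<omega> = ?q \<omega> / F\<^sup>2 - 1" for \<omega>
  have [measurable]: "Z \<in> borel_measurable M" unfolding Z_def by measurable
  have q: "?q \<omega> = (\<Sum>k<n. \<Sum>l<n. P k l * w k \<omega> * w l \<omega>)" for \<omega>
    unfolding quad_def by (simp add: mult_ac)
  have m: "(\<Sum>k<n. \<Sum>l<n. P k l * P k l) = F\<^sup>2" unfolding F2 by (simp add: power2_eq_square)
  note var = quadratic_form_variance_bound[of P, OF P_sym, folded q, unfolded m]
  have Z2: "(Z \<omega>)\<^sup>2 = (?q \<omega> - F\<^sup>2)\<^sup>2 / (F\<^sup>2)\<^sup>2" for \<omega>
  proof -
    have "Z \<omega> = (?q \<omega> - F\<^sup>2) / F\<^sup>2" unfolding Z_def using F_pos by (simp add: diff_divide_distrib)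
    then show ?thesis by (simp only: power_divide)
  qed
  have iZ: "integrable M (\<lambda>\<omega>. (Z \<omega>)\<^sup>2)" unfolding Z2 using var(2) by simp
  have "(LINT \<omega>|M. (Z \<omega>)\<^sup>2) = (LINT \<omega>|M. (?q \<omega> - F\<^sup>2)\<^sup>2) / (F\<^sup>2)\<^sup>2" unfolding Z2 by simp
  also have "\<dots> \<le> (4 * (c\<^sup>2 * F\<^sup>2)) / (F\<^sup>2)\<^sup>2"
    using var(1) fourfold_P by (intro divide_right_mono) auto
  also have "\<dots> = 4 * c\<^sup>2 / F\<^sup>2" using F_pos by (simp add: power2_eq_square)
  also have "\<dots> \<le> 4 * c\<^sup>2 / n" using F2_lower n_pos F_pos by (intro divide_left_mono) auto
  finally have bZ: "(LINT \<omega>|M. (Z \<omega>)\<^sup>2) \<le> 4 * c\<^sup>2 / n" .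
  note aZ = abs_expectation_of_second_moment[OF _ iZ bZ n_pos]
  have il: "integrable M (\<lambda>\<omega>. exp (- ((t / F)\<^sup>2 * ?q \<omega>) / 2))"
    by (rule integrable_const_bound[where B=1]) (auto simp: P_psd)
  have lip: "\<bar>exp (- x) - exp (- y)\<bar> \<le> \<bar>x - y\<bar>" if "x \<ge> 0" "y \<ge> 0" for x y :: real
  proof -
    have *: "exp (- x) - exp (- y) \<le> y - x" if "0 \<le> x" "x \<le> y" for x y :: real
    proof -
      have "exp (- x) * (1 + (x - y)) \<le> exp (- x) * exp (x - y)"
        by (intro mult_left_mono exp_ge_add_one_self) auto
      also have "\<dots> = exp (- y)" by (simp flip: exp_add)
      finally have "exp (- x) - exp (- y) \<le> exp (- x) * (y - x)" by (simp add: algebra_simps)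
      also have "\<dots> \<le> 1 * (y - x)" using that by (intro mult_right_mono) auto
      finally show ?thesis by simp
    qed
    show ?thesis
      using *[of x y] *[of y x] that by (cases "x \<le> y") (auto simp: abs_if)
  qed
  have "(CLINT \<omega>|M. iexp (t * ((\<Sum>k<n. w k \<omega> * s k \<omega>) / F)))
    = complex_of_real (LINT \<omega>|M. exp (- ((t / F)\<^sup>2 * ?q \<omega>) / 2))"
    using cf_inner_product[of "t / F"] by simp
  then have "cmod ((CLINT \<omega>|M. iexp (t * ((\<Sum>k<n. w k \<omega> * s k \<omega>) / F))) - complex_of_real (exp (- t\<^sup>2 / 2)))
    = \<bar>(LINT \<omega>|M. exp (- ((t / F)\<^sup>2 * ?q \<omega>) / 2)) - exp (- t\<^sup>2 / 2)\<bar>"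
    by (simp only: norm_of_real flip: of_real_diff)
  also have "\<dots> = \<bar>LINT \<omega>|M. exp (- ((t / F)\<^sup>2 * ?q \<omega>) / 2) - exp (- t\<^sup>2 / 2)\<bar>"
    using il by (simp add: prob_space)
  also have "\<dots> \<le> (LINT \<omega>|M. \<bar>exp (- ((t / F)\<^sup>2 * ?q \<omega>) / 2) - exp (- t\<^sup>2 / 2)\<bar>)"
    by (rule integral_abs_bound)
  also have "\<dots> \<le> (LINT \<omega>|M. t\<^sup>2 / 2 * \<bar>Z \<omega>\<bar>)"
  proof (rule integral_mono)
    show "integrable M (\<lambda>\<omega>. \<bar>exp (- ((t / F)\<^sup>2 * ?q \<omega>) / 2) - exp (- t\<^sup>2 / 2)\<bar>)"
      using il by auto
    show "integrable M (\<lambda>\<omega>. t\<^sup>2 / 2 * \<bar>Z \<omega>\<bar>)" using aZ(1) by simp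
    fix \<omega>
    have "\<bar>exp (- ((t / F)\<^sup>2 * ?q \<omega> / 2)) - exp (- (t\<^sup>2 / 2))\<bar> \<le> \<bar>(t / F)\<^sup>2 * ?q \<omega> / 2 - t\<^sup>2 / 2\<bar>"
      by (rule lip) (auto simp: P_psd)
    also have "(t / F)\<^sup>2 * ?q \<omega> / 2 - t\<^sup>2 / 2 = t\<^sup>2 / 2 * Z \<omega>"
      unfolding Z_def using F_pos by (simp add: power_divide algebra_simps)
    finally show "\<bar>exp (- ((t / F)\<^sup>2 * ?q \<omega>) / 2) - exp (- t\<^sup>2 / 2)\<bar> \<le> t\<^sup>2 / 2 * \<bar>Z \<omega>\<bar>"
      by (simp add: abs_mult)
  qed
  also have "\<dots> = t\<^sup>2 / 2 * (LINT \<omega>|M. \<bar>Z \<omega>\<bar>)"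
    by (rule Bochner_Integration.integral_mult_right_zero)
  also have "\<dots> \<le> t\<^sup>2 / 2 * ((1 + 4 * c\<^sup>2) / (2 * sqrt n))"
    using aZ(2) by (intro mult_left_mono) auto
  finally show ?thesis .
qed

abbreviation "css_ws \<omega> \<equiv> css n (\<lambda>k. w k \<omega>) (\<lambda>k. s k \<omega>)"
abbreviation "css_ww \<omega> \<equiv> css n (\<lambda>k. w k \<omega>) (\<lambda>k. w k \<omega>)"
abbreviation "css_ss \<omega> \<equiv> css n (\<lambda>k. s k \<omega>) (\<lambda>k. s k \<omega>)"
abbreviation "sum_w \<omega> \<equiv> \<Sum>k<n. w k \<omega>"
abbreviation "sum_s \<omega> \<equiv> \<Sum>k<n. s k \<omega>"
abbreviation "inner_ws \<omega> \<equiv> \<Sum>k<n. w k \<omega> * s k \<omega>"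

lemma css_measurable [measurable]:
  "css_ws \<in> borel_measurable M" "css_ww \<in> borel_measurable M" "css_ss \<in> borel_measurable M"
  unfolding css_def by measurable

lemma inner_second_moment:
  "integrable M (\<lambda>\<omega>. (inner_ws \<omega>)\<^sup>2)" "(LINT \<omega>|M. (inner_ws \<omega>)\<^sup>2) = F\<^sup>2"
proof -
  have e: "inner_ws \<omega> = (\<Sum>k<n. \<Sum>l<n. (if k = l then 1 else 0) * w k \<omega> * s l \<omega>)" for \<omega>
    by (intro sum.cong refl) (simp add: mult.assoc if_distrib[of "\<lambda>x. x * _"] cong: if_cong)
  show "integrable M (\<lambda>\<omega>. (inner_ws \<omega>)\<^sup>2)" unfolding e by (rule bilinear_form_second_moment(2))
  show "(LINT \<omega>|M. (inner_ws \<omega>)\<^sup>2) = F\<^sup>2" unfolding e bilinear_form_second_moment(1) fourfold_delta ..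
qed

lemma sum_product_second_moment:
  "integrable M (\<lambda>\<omega>. (sum_w \<omega> * sum_s \<omega>)\<^sup>2)" "(LINT \<omega>|M. (sum_w \<omega> * sum_s \<omega>)\<^sup>2) \<le> c\<^sup>2 * (real n)\<^sup>2"
proof -
  have e: "sum_w \<omega> * sum_s \<omega> = (\<Sum>k<n. \<Sum>l<n. 1 * w k \<omega> * s l \<omega>)" for \<omega>
    by (simp add: sum_product)
  show "integrable M (\<lambda>\<omega>. (sum_w \<omega> * sum_s \<omega>)\<^sup>2)" unfolding e by (rule bilinear_form_second_moment(2))
  have "(LINT \<omega>|M. (sum_w \<omega> * sum_s \<omega>)\<^sup>2) = (quad n P (\<lambda>_. 1))\<^sup>2"
    unfolding e bilinear_form_second_moment(1) fourfold_ones ..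
  also have "\<dots> \<le> (c * n)\<^sup>2" using quad_ones power_mono[of "\<bar>quad n P (\<lambda>_. 1)\<bar>" "c * n" 2] by simp
  finally show "(LINT \<omega>|M. (sum_w \<omega> * sum_s \<omega>)\<^sup>2) \<le> c\<^sup>2 * (real n)\<^sup>2" by (simp add: power_mult_distrib)
qed

lemma css_ws_second_moment:
  "integrable M (\<lambda>\<omega>. (css_ws \<omega>)\<^sup>2)" "(LINT \<omega>|M. (css_ws \<omega>)\<^sup>2) \<le> 2 * F\<^sup>2 + 2 * c\<^sup>2"
proof -
  have e: "css_ws \<omega> = inner_ws \<omega> + (- (sum_w \<omega> * sum_s \<omega>) / n)" for \<omega>
    using css_eq[OF n_pos] by simp
  have i1: "integrable M (\<lambda>\<omega>. (- (sum_w \<omega> * sum_s \<omega>) / n)\<^sup>2)"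
    using sum_product_second_moment(1) by (simp add: power_divide)
  show i: "integrable M (\<lambda>\<omega>. (css_ws \<omega>)\<^sup>2)"
    unfolding e by (intro integrable_square_add inner_second_moment i1) measurable
  have "(LINT \<omega>|M. (css_ws \<omega>)\<^sup>2) \<le> (LINT \<omega>|M. 2 * (inner_ws \<omega>)\<^sup>2 + 2 * (- (sum_w \<omega> * sum_s \<omega>) / n)\<^sup>2)"
    using i inner_second_moment(1) i1 by (intro integral_mono) (auto simp only: e intro!: square_add_le)
  also have "\<dots> = 2 * F\<^sup>2 + 2 * ((LINT \<omega>|M. (sum_w \<omega> * sum_s \<omega>)\<^sup>2) / (real n)\<^sup>2)"
    using inner_second_moment i1 sum_product_second_moment(1) by (simp add: power_divide)
  also have "\<dots> \<le> 2 * F\<^sup>2 + 2 * c\<^sup>2"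
    using sum_product_second_moment(2) n_pos by (simp add: divide_le_eq)
  finally show "(LINT \<omega>|M. (css_ws \<omega>)\<^sup>2) \<le> 2 * F\<^sup>2 + 2 * c\<^sup>2" .
qed

text \<open>
  The sum of the squares of \<open>w\<close> has mean \<open>n\<close>, by the unit diagonal, and standard deviation at most \<open>2F\<close>; the
  centring removes a term with bounded mean.
\<close>

lemma css_ww_law_of_large_numbers:
  "integrable M (\<lambda>\<omega>. \<bar>css_ww \<omega> / n - 1\<bar>)"
  "(LINT \<omega>|M. \<bar>css_ww \<omega> / n - 1\<bar>) \<le> (1 + 4 * c\<^sup>2 + 2 * c) / (2 * sqrt n)"
proof -
  have nn: "real n > 0" using n_pos by simp
  define Z where "Z \<omega> = ((\<Sum>k<n. w k \<omega> * w k \<omega>) - n) / n" for \<omega>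
  have [measurable]: "Z \<in> borel_measurable M" unfolding Z_def by measurable
  have e: "(\<Sum>k<n. w k \<omega> * w k \<omega>) = (\<Sum>k<n. \<Sum>l<n. (if k = l then 1 else 0) * w k \<omega> * w l \<omega>)" for \<omega>
    by (intro sum.cong refl) (simp add: mult.assoc if_distrib[of "\<lambda>x. x * _"] cong: if_cong)
  have m: "(\<Sum>k<n. \<Sum>l<n. (if k = l then 1 else 0) * P k l) = n"
    by (simp add: if_distrib[of "\<lambda>x. x * _"] diag cong: if_cong)
  note var = quadratic_form_variance_bound[of "\<lambda>k l. if k = l then 1 else 0", unfolded m fourfold_delta, folded e]
  have Z2: "(Z \<omega>)\<^sup>2 = ((\<Sum>k<n. w k \<omega> * w k \<omega>) - n)\<^sup>2 / (real n)\<^sup>2" for \<omega>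
    unfolding Z_def by (simp add: power_divide)
  have iZ: "integrable M (\<lambda>\<omega>. (Z \<omega>)\<^sup>2)" unfolding Z2 using var(2) by simp
  have "(LINT \<omega>|M. (Z \<omega>)\<^sup>2) = (LINT \<omega>|M. ((\<Sum>k<n. w k \<omega> * w k \<omega>) - n)\<^sup>2) / (real n)\<^sup>2" unfolding Z2 by simp
  also have "\<dots> \<le> (4 * (c\<^sup>2 * n)) / (real n)\<^sup>2"
    using order_trans[OF var(1)] F2_upper by (intro divide_right_mono) auto
  also have "\<dots> = 4 * c\<^sup>2 / n" using nn by (simp add: power2_eq_square)
  finally have bZ: "(LINT \<omega>|M. (Z \<omega>)\<^sup>2) \<le> 4 * c\<^sup>2 / n" .
  note aZ = abs_expectation_of_second_moment[OF _ iZ bZ n_pos]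
  have isw: "integrable M (\<lambda>\<omega>. (sum_w \<omega>)\<^sup>2)" and es: "(LINT \<omega>|M. (sum_w \<omega>)\<^sup>2) = quad n P (\<lambda>_. 1)"
    using linear_form_moments[of "\<lambda>_. 1"] by simp_all
  have ib: "integrable M (\<lambda>\<omega>. \<bar>Z \<omega>\<bar> + (sum_w \<omega>)\<^sup>2 / (real n)\<^sup>2)" using aZ(1) isw by simp
  have le: "\<bar>css_ww \<omega> / n - 1\<bar> \<le> \<bar>Z \<omega>\<bar> + (sum_w \<omega>)\<^sup>2 / (real n)\<^sup>2" for \<omega>
  proof -
    have "css_ww \<omega> / n - 1 = Z \<omega> - (sum_w \<omega>)\<^sup>2 / (real n)\<^sup>2"
      unfolding css_eq[OF n_pos] Z_def using nn by (simp add: field_simps power2_eq_square)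
    moreover have "(sum_w \<omega>)\<^sup>2 / (real n)\<^sup>2 \<ge> 0" by simp
    ultimately show ?thesis by linarith
  qed
  show i: "integrable M (\<lambda>\<omega>. \<bar>css_ww \<omega> / n - 1\<bar>)"
  proof (rule Bochner_Integration.integrable_bound[OF ib])
    show "AE \<omega> in M. norm \<bar>css_ww \<omega> / n - 1\<bar> \<le> norm (\<bar>Z \<omega>\<bar> + (sum_w \<omega>)\<^sup>2 / (real n)\<^sup>2)"
      using order_trans[OF le abs_ge_self] by simp
  qed measurable
  have "(LINT \<omega>|M. \<bar>css_ww \<omega> / n - 1\<bar>) \<le> (LINT \<omega>|M. \<bar>Z \<omega>\<bar> + (sum_w \<omega>)\<^sup>2 / (real n)\<^sup>2)"
    by (rule integral_mono[OF i ib le])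
  also have "\<dots> = (LINT \<omega>|M. \<bar>Z \<omega>\<bar>) + quad n P (\<lambda>_. 1) / (real n)\<^sup>2"
    using aZ(1) isw es by simp
  also have "\<dots> \<le> (1 + 4 * c\<^sup>2) / (2 * sqrt n) + c / sqrt n"
  proof (rule add_mono)
    show "(LINT \<omega>|M. \<bar>Z \<omega>\<bar>) \<le> (1 + 4 * c\<^sup>2) / (2 * sqrt n)" using aZ(2) by simp
    have "quad n P (\<lambda>_. 1) / (real n)\<^sup>2 \<le> c * n / (real n)\<^sup>2"
      using quad_ones by (intro divide_right_mono) auto
    also have "\<dots> = c / n" using nn by (simp add: power2_eq_square)
    also have "\<dots> \<le> c / sqrt n"
    proof (rule divide_left_mono)
      have "1 * real n \<le> real n * real n" using n_pos by (intro mult_right_mono) auto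
      then show "sqrt n \<le> n" by (intro real_le_lsqrt) (auto simp: power2_eq_square)
    qed (use c_pos nn in auto)
    finally show "quad n P (\<lambda>_. 1) / (real n)\<^sup>2 \<le> c / sqrt n" .
  qed
  also have "\<dots> = (1 + 4 * c\<^sup>2 + 2 * c) / (2 * sqrt n)" using nn by (simp add: field_simps)
  finally show "(LINT \<omega>|M. \<bar>css_ww \<omega> / n - 1\<bar>) \<le> (1 + 4 * c\<^sup>2 + 2 * c) / (2 * sqrt n)" .
qed

lemma css_ws_negligible:
  "integrable M (\<lambda>\<omega>. \<bar>css_ws \<omega> / n\<bar>)"
  "(LINT \<omega>|M. \<bar>css_ws \<omega> / n\<bar>) \<le> (1 + 4 * c\<^sup>2) / (2 * sqrt n)"
proof -
  have n1: "real n \<ge> 1" using n_pos by simp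
  have b: "(LINT \<omega>|M. (css_ws \<omega> / n)\<^sup>2) \<le> 4 * c\<^sup>2 / n"
  proof -
    have "(LINT \<omega>|M. (css_ws \<omega> / n)\<^sup>2) = (LINT \<omega>|M. (css_ws \<omega>)\<^sup>2) / (real n)\<^sup>2"
      by (simp add: power_divide)
    also have "\<dots> \<le> (2 * (c\<^sup>2 * n) + 2 * (c\<^sup>2 * n)) / (real n)\<^sup>2"
    proof (intro divide_right_mono order_trans[OF css_ws_second_moment(2)] add_mono mult_left_mono F2_upper)
      show "c\<^sup>2 \<le> c\<^sup>2 * n" using n1 mult_left_mono[of 1 "real n" "c\<^sup>2"] by simp
    qed auto
    also have "\<dots> = 4 * c\<^sup>2 / n" using n1 by (simp add: power2_eq_square)
    finally show ?thesis .
  qed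
  have i: "integrable M (\<lambda>\<omega>. (css_ws \<omega> / n)\<^sup>2)"
    using css_ws_second_moment(1) by (simp add: power_divide)
  show "integrable M (\<lambda>\<omega>. \<bar>css_ws \<omega> / n\<bar>)"
    "(LINT \<omega>|M. \<bar>css_ws \<omega> / n\<bar>) \<le> (1 + 4 * c\<^sup>2) / (2 * sqrt n)"
    using abs_expectation_of_second_moment[OF _ i b n_pos] by simp_all
qed

lemma centring_negligible:
  "integrable M (\<lambda>\<omega>. \<bar>css_ws \<omega> / F - inner_ws \<omega> / F\<bar>)"
  "(LINT \<omega>|M. \<bar>css_ws \<omega> / F - inner_ws \<omega> / F\<bar>) \<le> (1 + c\<^sup>2) / (2 * sqrt n)"
proof -
  have nn: "real n > 0" using n_pos by simp
  let ?V = "\<lambda>\<omega>. css_ws \<omega> / F - inner_ws \<omega> / F"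
  have e: "(?V \<omega>)\<^sup>2 = (sum_w \<omega> * sum_s \<omega>)\<^sup>2 / (n * F)\<^sup>2" for \<omega>
    unfolding css_eq[OF n_pos] using F_pos by (simp add: diff_divide_distrib power_divide power_mult_distrib)
  have i: "integrable M (\<lambda>\<omega>. (?V \<omega>)\<^sup>2)" unfolding e using sum_product_second_moment(1) by simp
  have "(LINT \<omega>|M. (?V \<omega>)\<^sup>2) = (LINT \<omega>|M. (sum_w \<omega> * sum_s \<omega>)\<^sup>2) / (n * F)\<^sup>2" unfolding e by simp
  also have "\<dots> \<le> c\<^sup>2 * (real n)\<^sup>2 / (n * F)\<^sup>2"
    using sum_product_second_moment(2) by (intro divide_right_mono) auto
  also have "\<dots> = c\<^sup>2 / F\<^sup>2" using nn by (simp add: power_mult_distrib)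
  also have "\<dots> \<le> c\<^sup>2 / n" using F2_lower nn F_pos by (intro divide_left_mono) auto
  finally have b: "(LINT \<omega>|M. (?V \<omega>)\<^sup>2) \<le> c\<^sup>2 / n" .
  show "integrable M (\<lambda>\<omega>. \<bar>?V \<omega>\<bar>)" "(LINT \<omega>|M. \<bar>?V \<omega>\<bar>) \<le> (1 + c\<^sup>2) / (2 * sqrt n)"
    using abs_expectation_of_second_moment[OF _ i b n_pos] by simp_all
qed

lemma css_ws_tight:
  "integrable M (\<lambda>\<omega>. \<bar>css_ws \<omega> / F\<bar>)"
  "(LINT \<omega>|M. \<bar>css_ws \<omega> / F\<bar>) \<le> (3 + 2 * c\<^sup>2) / 2"
proof -
  have f1: "F\<^sup>2 \<ge> 1" using F2_lower n_pos by linarith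
  have i: "integrable M (\<lambda>\<omega>. (css_ws \<omega> / F)\<^sup>2)"
    using css_ws_second_moment(1) by (simp add: power_divide)
  have "(LINT \<omega>|M. (css_ws \<omega> / F)\<^sup>2) = (LINT \<omega>|M. (css_ws \<omega>)\<^sup>2) / F\<^sup>2"
    by (simp add: power_divide)
  also have "\<dots> \<le> (2 * F\<^sup>2 + 2 * (c\<^sup>2 * F\<^sup>2)) / F\<^sup>2"
  proof (intro divide_right_mono order_trans[OF css_ws_second_moment(2)] add_mono mult_left_mono)
    show "c\<^sup>2 \<le> c\<^sup>2 * F\<^sup>2" using f1 mult_left_mono[of 1 "F\<^sup>2" "c\<^sup>2"] by simp
  qed auto
  also have "\<dots> = (2 + 2 * c\<^sup>2) / (1 :: nat)" using F_pos by (simp add: field_simps)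
  finally have b: "(LINT \<omega>|M. (css_ws \<omega> / F)\<^sup>2) \<le> (2 + 2 * c\<^sup>2) / (1 :: nat)" .
  show "integrable M (\<lambda>\<omega>. \<bar>css_ws \<omega> / F\<bar>)"
    "(LINT \<omega>|M. \<bar>css_ws \<omega> / F\<bar>) \<le> (3 + 2 * c\<^sup>2) / 2"
    using abs_expectation_of_second_moment[OF _ i b] by simp_all
qed

text \<open>
  The difference of the two centred sums of squares is twice the centred cross sum of the rotated pair.
  It is therefore of order \<open>n\<^sup>1\<^sup>/\<^sup>2\<close>, smaller than either sum by that order.
\<close>

lemma variance_difference_negligible:
  "integrable M (\<lambda>\<omega>. (css_ww \<omega> - css_ss \<omega>)\<^sup>2 / (n * F))"
  "(LINT \<omega>|M. (css_ww \<omega> - css_ss \<omega>)\<^sup>2 / (n * F)) \<le> 8 * (c + c\<^sup>2) / sqrt n"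
proof -
  interpret R: bounded_gauss M n P "\<lambda>k \<omega>. (w k \<omega> - s k \<omega>) / sqrt 2" "\<lambda>k \<omega>. (w k \<omega> + s k \<omega>) / sqrt 2" c
    by (rule rotate_bounded)
  have nn: "real n \<ge> 1" using n_pos by simp
  have e: "(css_ww \<omega> - css_ss \<omega>)\<^sup>2 = 4 * (R.css_ws \<omega>)\<^sup>2" for \<omega>
  proof -
    have "R.css_ws \<omega> = css n (\<lambda>k. (1 / sqrt 2) * w k \<omega> + (- 1 / sqrt 2) * s k \<omega>) (\<lambda>k. (1 / sqrt 2) * w k \<omega> + (1 / sqrt 2) * s k \<omega>)"
      by (rule css_cong) (simp_all add: diff_divide_distrib add_divide_distrib)
    also have "\<dots> = (css_ww \<omega> - css_ss \<omega>) / 2" unfolding css_combination by simp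
    finally have "css_ww \<omega> - css_ss \<omega> = 2 * R.css_ws \<omega>" by simp
    then show ?thesis by (simp add: power_mult_distrib)
  qed
  show "integrable M (\<lambda>\<omega>. (css_ww \<omega> - css_ss \<omega>)\<^sup>2 / (n * F))"
    unfolding e using R.css_ws_second_moment(1) by simp
  have "(LINT \<omega>|M. (css_ww \<omega> - css_ss \<omega>)\<^sup>2 / (n * F)) = 4 * (LINT \<omega>|M. (R.css_ws \<omega>)\<^sup>2) / (n * F)"
    unfolding e by simp
  also have "\<dots> \<le> 4 * (2 * F\<^sup>2 + 2 * c\<^sup>2) / (n * F)"
    using R.css_ws_second_moment(2) F_pos by (intro divide_right_mono mult_left_mono) auto
  also have "\<dots> = 8 * (F / n + c\<^sup>2 / (n * F))"
    using F_pos nn by (simp add: field_simps power2_eq_square)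
  also have "\<dots> \<le> 8 * (c / sqrt n + c\<^sup>2 / sqrt n)"
  proof (intro mult_left_mono add_mono)
    have "F / n \<le> c * sqrt n / n" using F_upper nn by (intro divide_right_mono) auto
    also have "\<dots> = c / sqrt n" using nn by (simp add: field_simps)
    finally show "F / n \<le> c / sqrt n" .
    have "1 * sqrt n \<le> n * F" using nn F_lower F_pos by (intro mult_mono) auto
    then show "c\<^sup>2 / (n * F) \<le> c\<^sup>2 / sqrt n" using nn F_pos by (intro divide_left_mono) auto
  qed simp
  also have "\<dots> = 8 * (c + c\<^sup>2) / sqrt n" by (simp add: add_divide_distrib)
  finally show "(LINT \<omega>|M. (css_ww \<omega> - css_ss \<omega>)\<^sup>2 / (n * F)) \<le> 8 * (c + c\<^sup>2) / sqrt n" .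
qed

text \<open>
  A quantitative Slutsky argument on characteristic functions. Where the centred sums divided by \<open>n\<close> are within \<open>\<eta>\<close> of
  their limits, the assumed expansion compares \<open>T\<close> with the inner product of \<open>w\<close> and \<open>s\<close> divided by \<open>F\<close>.
  Elsewhere the exponentials differ by at most \<open>2\<close>, and Markov's inequality bounds the probability. Both
  cases are combined into one pointwise bound before integrating.
\<close>

lemma normalized_cf_bound:
  fixes T :: "'a \<Rightarrow> real"
  assumes [measurable]: "T \<in> borel_measurable M" and \<eta>: "0 < \<eta>"
    and T: "\<And>\<omega>. \<bar>css_ww \<omega> / n - 1\<bar> + \<bar>css_ss \<omega> / n - 1\<bar> + \<bar>css_ws \<omega> / n\<bar> \<le> \<eta> \<Longrightarrow>
      \<bar>T \<omega> - css_ws \<omega> / F\<bar> \<le> 2 * \<eta> * \<bar>css_ws \<omega> / F\<bar> + (css_ww \<omega> - css_ss \<omega>)\<^sup>2 / (n * F)"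
  shows "cmod ((CLINT \<omega>|M. iexp (t * T \<omega>)) - complex_of_real (exp (- t\<^sup>2 / 2)))
    \<le> \<bar>t\<bar> * ((1 + c\<^sup>2) / (2 * sqrt n) + 2 * \<eta> * ((3 + 2 * c\<^sup>2) / 2) + 8 * (c + c\<^sup>2) / sqrt n)
      + 2 * ((3 + 12 * c\<^sup>2 + 4 * c) / (2 * sqrt n)) / \<eta>
      + t\<^sup>2 / 2 * ((1 + 4 * c\<^sup>2) / (2 * sqrt n))"
proof -
  interpret S: bounded_gauss M n P s w c by (rule swap_bounded)
  let ?H = "\<lambda>\<omega>. \<bar>css_ww \<omega> / n - 1\<bar> + \<bar>css_ss \<omega> / n - 1\<bar> + \<bar>css_ws \<omega> / n\<bar>"
  let ?R = "\<lambda>\<omega>. (css_ww \<omega> - css_ss \<omega>)\<^sup>2 / (n * F)"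
  let ?V = "\<lambda>\<omega>. \<bar>css_ws \<omega> / F - inner_ws \<omega> / F\<bar>"
  let ?B = "\<lambda>\<omega>. \<bar>t\<bar> * (?V \<omega> + 2 * \<eta> * \<bar>css_ws \<omega> / F\<bar> + ?R \<omega>) + 2 * ?H \<omega> / \<eta>"
  have R0: "?R \<omega> \<ge> 0" for \<omega> using F_pos by simp
  have pt: "cmod (iexp (t * T \<omega>) - iexp (t * (inner_ws \<omega> / F))) \<le> ?B \<omega>" for \<omega>
  proof (cases "?H \<omega> \<le> \<eta>")
    case True
    have "cmod (iexp (t * T \<omega>) - iexp (t * (inner_ws \<omega> / F))) \<le> \<bar>t * T \<omega> - t * (inner_ws \<omega> / F)\<bar>"
      by (rule iexp_diff_le)
    also have "\<dots> = \<bar>t\<bar> * \<bar>T \<omega> - inner_ws \<omega> / F\<bar>"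
      by (simp only: right_diff_distrib[symmetric] abs_mult)
    also have "\<dots> \<le> \<bar>t\<bar> * (?V \<omega> + 2 * \<eta> * \<bar>css_ws \<omega> / F\<bar> + ?R \<omega>)"
      using T[OF True] by (intro mult_left_mono) linarith+
    also have "\<dots> \<le> ?B \<omega>" using \<eta> by simp
    finally show ?thesis .
  next
    case False
    have "cmod (iexp (t * T \<omega>) - iexp (t * (inner_ws \<omega> / F))) \<le> 1 + 1"
      using norm_triangle_ineq4[of "iexp (t * T \<omega>)" "iexp (t * (inner_ws \<omega> / F))"] by simp
    also have "\<dots> \<le> 2 * ?H \<omega> / \<eta>" using False \<eta> by (simp add: le_divide_eq)
    also have "\<dots> \<le> ?B \<omega>" using R0[of \<omega>] \<eta> by (simp add: mult_nonneg_nonneg)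
    finally show ?thesis .
  qed
  have iB: "integrable M ?B"
    by (rule Bochner_Integration.integrable_add[OF
          integrable_mult_right[OF Bochner_Integration.integrable_add[OF Bochner_Integration.integrable_add[OF
            centring_negligible(1) integrable_mult_right[OF css_ws_tight(1)]] variance_difference_negligible(1)]]
          integrable_divide[OF integrable_mult_right[OF Bochner_Integration.integrable_add[OF Bochner_Integration.integrable_add[OF
            css_ww_law_of_large_numbers(1) S.css_ww_law_of_large_numbers(1)] css_ws_negligible(1)]]]])
  have i1: "integrable M (\<lambda>\<omega>. iexp (t * T \<omega>))" "integrable M (\<lambda>\<omega>. iexp (t * (inner_ws \<omega> / F)))"
    by (rule integrable_const_bound[where B=1]; simp)+
  have "cmod ((CLINT \<omega>|M. iexp (t * T \<omega>)) - (CLINT \<omega>|M. iexp (t * (inner_ws \<omega> / F))))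
    = cmod (CLINT \<omega>|M. iexp (t * T \<omega>) - iexp (t * (inner_ws \<omega> / F)))"
    by (simp only: Bochner_Integration.integral_diff[OF i1])
  also have "\<dots> \<le> (LINT \<omega>|M. cmod (iexp (t * T \<omega>) - iexp (t * (inner_ws \<omega> / F))))"
    by (rule integral_norm_bound)
  also have "\<dots> \<le> (LINT \<omega>|M. ?B \<omega>)"
    by (rule integral_mono[OF integrable_norm[OF Bochner_Integration.integrable_diff[OF i1]] iB pt])
  also have "\<dots> = \<bar>t\<bar> * ((LINT \<omega>|M. ?V \<omega>) + 2 * \<eta> * (LINT \<omega>|M. \<bar>css_ws \<omega> / F\<bar>) + (LINT \<omega>|M. ?R \<omega>))
    + 2 * ((LINT \<omega>|M. \<bar>css_ww \<omega> / n - 1\<bar>) + (LINT \<omega>|M. \<bar>css_ss \<omega> / n - 1\<bar>) + (LINT \<omega>|M. \<bar>css_ws \<omega> / n\<bar>)) / \<eta>"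
    by (simp only: Bochner_Integration.integral_add Bochner_Integration.integral_mult_right_zero integral_divide_zero
        Bochner_Integration.integrable_add integrable_mult_right integrable_divide
        css_ww_law_of_large_numbers(1) S.css_ww_law_of_large_numbers(1) css_ws_negligible(1)
        centring_negligible(1) css_ws_tight(1) variance_difference_negligible(1))
  also have "\<dots> \<le> \<bar>t\<bar> * ((1 + c\<^sup>2) / (2 * sqrt n) + 2 * \<eta> * ((3 + 2 * c\<^sup>2) / 2) + 8 * (c + c\<^sup>2) / sqrt n)
    + 2 * ((1 + 4 * c\<^sup>2 + 2 * c) / (2 * sqrt n) + (1 + 4 * c\<^sup>2 + 2 * c) / (2 * sqrt n) + (1 + 4 * c\<^sup>2) / (2 * sqrt n)) / \<eta>"
    using css_ww_law_of_large_numbers(2) S.css_ww_law_of_large_numbers(2) css_ws_negligible(2)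
        centring_negligible(2) css_ws_tight(2) variance_difference_negligible(2) \<eta>
    by (intro add_mono mult_left_mono divide_right_mono) auto
  also have "(1 + 4 * c\<^sup>2 + 2 * c) / (2 * sqrt n) + (1 + 4 * c\<^sup>2 + 2 * c) / (2 * sqrt n) + (1 + 4 * c\<^sup>2) / (2 * sqrt n)
    = (3 + 12 * c\<^sup>2 + 4 * c) / (2 * sqrt n)" by (simp add: add_divide_distrib[symmetric])
  finally show ?thesis
    using inner_product_clt[of t]
      norm_triangle_ineq[of "(CLINT \<omega>|M. iexp (t * T \<omega>)) - (CLINT \<omega>|M. iexp (t * (inner_ws \<omega> / F)))"
        "(CLINT \<omega>|M. iexp (t * (inner_ws \<omega> / F))) - complex_of_real (exp (- t\<^sup>2 / 2))"]
    by simp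
qed

end

section \<open>From the matrix-variate normal law to the limit theorem\<close>

text \<open>
  Both disjuncts of the definition of a Gaussian variable yield the same formula for the characteristic
  function in terms of mean and variance.
\<close>

lemma (in prob_space) gaussian_rv_properties:
  assumes g: "gaussian_rv M Y"
  shows "integrable M Y" and "integrable M (\<lambda>\<omega>. (Y \<omega>)\<^sup>2)"
    and "(CLINT \<omega>|M. iexp (Y \<omega> - expectation Y)) = complex_of_real (exp (- variance Y / 2))"
proof -
  have [measurable]: "Y \<in> borel_measurable M" using g by (simp add: gaussian_rv_def)
  from g consider m s where "0 < s" "distributed M lborel Y (normal_density m s)" | m where "AE \<omega> in M. Y \<omega> = m"
    unfolding gaussian_rv_def by blast
  then have "integrable M Y \<and> integrable M (\<lambda>\<omega>. (Y \<omega>)\<^sup>2) \<and>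
    (CLINT \<omega>|M. iexp (Y \<omega> - expectation Y)) = complex_of_real (exp (- variance Y / 2))"
  proof cases
    case 1
    define Z where "Z \<omega> = (Y \<omega> - m) / s" for \<omega>
    have [measurable]: "Z \<in> borel_measurable M" unfolding Z_def by measurable
    have Y: "Y \<omega> = m + s * Z \<omega>" for \<omega> using 1(1) by (simp add: Z_def)
    have "distributed M lborel Z std_normal_density"
      using 1(2) unfolding normal_standard_normal_convert[OF 1(1)] Z_def .
    then have d: "distr M lborel Z = std_normal_distribution" by (rule distributed_distr_eq_density)
    have iZ: "integrable M (\<lambda>\<omega>. Z \<omega> ^ k)" for k
    proof -
      have "integrable (distr M lborel Z) (\<lambda>x. x ^ k)"
        unfolding d by (rule integrable_std_normal_distribution_moment)
      then show ?thesis by (subst (asm) integrable_distr_eq) auto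
    qed
    have eY: "expectation Y = m" by (rule normal_distributed_expectation[OF 1])
    have vY: "variance Y = s\<^sup>2" by (rule normal_distributed_variance[OF 1])
    have "(CLINT \<omega>|M. iexp (Y \<omega> - expectation Y)) = (CLINT \<omega>|M. iexp (s * Z \<omega>))"
      unfolding eY by (simp add: Y)
    also have "\<dots> = (CLINT x|distr M lborel Z. iexp (s * x))"
      by (rule integral_distr[symmetric]) measurable
    also have "\<dots> = complex_of_real (exp (- s\<^sup>2 / 2))"
      unfolding d using char_std_normal_distribution unfolding char_def by (rule fun_cong)
    finally have cf: "(CLINT \<omega>|M. iexp (Y \<omega> - expectation Y)) = complex_of_real (exp (- variance Y / 2))"
      unfolding vY .
    have "integrable M Y" unfolding Y[abs_def] using iZ[of 1] by simp
    moreover have "integrable M (\<lambda>\<omega>. (Y \<omega>)\<^sup>2)"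
      unfolding Y power2_sum power_mult_distrib using iZ[of 1] iZ[of 2] by (simp add: mult.assoc)
    ultimately show ?thesis using cf by blast
  next
    case 2
    have "integrable M Y \<longleftrightarrow> integrable M (\<lambda>_. m)"
      by (rule integrable_cong_AE) (use 2 in auto)
    moreover have "integrable M (\<lambda>\<omega>. (Y \<omega>)\<^sup>2) \<longleftrightarrow> integrable M (\<lambda>_. m\<^sup>2)"
      by (rule integrable_cong_AE) (use 2 in auto)
    moreover have eY: "expectation Y = m"
    proof -
      have "expectation Y = expectation (\<lambda>_. m)" by (rule integral_cong_AE) (use 2 in auto)
      then show ?thesis by (simp add: prob_space)
    qed
    moreover have "variance Y = expectation (\<lambda>_. 0)"
      unfolding eY by (rule integral_cong_AE) (use 2 in auto)
    moreover have "(CLINT \<omega>|M. iexp (Y \<omega> - expectation Y)) = (CLINT \<omega>|M. 1)"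
      unfolding eY by (rule integral_cong_AE) (use 2 in auto)
    ultimately show ?thesis by (simp add: prob_space)
  qed
  then show "integrable M Y" "integrable M (\<lambda>\<omega>. (Y \<omega>)\<^sup>2)"
    "(CLINT \<omega>|M. iexp (Y \<omega> - expectation Y)) = complex_of_real (exp (- variance Y / 2))" by blast+
qed

lemma matrix_normal_entry:
  assumes "prob_space M" and X: "matrix_normal M X \<mu> \<Sigma> \<Psi>"
    and "\<Sigma> \<in> carrier_mat p p" "\<Psi> \<in> carrier_mat n n" and "r < p" "k < n"
  shows "gaussian_rv M (\<lambda>\<omega>. X \<omega> $$ (r, k))"
    and "(LINT \<omega>|M. X \<omega> $$ (r, k)) = vec_index \<mu> r"
proof -
  have J: "jointly_gaussian M ({..<p} \<times> {..<n}) (\<lambda>t \<omega>. X \<omega> $$ t)"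
    using assms by (simp add: matrix_normal_def Let_def)
  have "gaussian_rv M (\<lambda>\<omega>. \<Sum>t\<in>{..<p} \<times> {..<n}. (if t = (r, k) then 1 else 0) * X \<omega> $$ t)"
    using J unfolding jointly_gaussian_def by (rule spec)
  then show "gaussian_rv M (\<lambda>\<omega>. X \<omega> $$ (r, k))"
    using assms by (simp add: if_distrib[of "\<lambda>x. x * _"] cong: if_cong)
  show "(LINT \<omega>|M. X \<omega> $$ (r, k)) = vec_index \<mu> r"
    using assms by (simp add: matrix_normal_def Let_def)
qed

text \<open>
  A linear combination of the entries of two rows is a linear combination of all entries, hence
  Gaussian; its variance comes from the prescribed covariances.
\<close>

lemma matrix_normal_two_rows:
  assumes pM: "prob_space M" and X: "matrix_normal M X \<mu> \<Sigma> \<Psi>"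
    and S: "\<Sigma> \<in> carrier_mat p p" and P: "\<Psi> \<in> carrier_mat n n" and ij: "i < p" "j < p" "i \<noteq> j"
    and sym: "\<Sigma> $$ (j, i) = \<Sigma> $$ (i, j)"
  shows "(CLINT \<omega>|M. iexp ((\<Sum>k<n. a k * (X \<omega> $$ (i, k) - vec_index \<mu> i)) + (\<Sum>k<n. b k * (X \<omega> $$ (j, k) - vec_index \<mu> j))))
    = complex_of_real (exp (- (\<Sum>k<n. \<Sum>l<n. \<Psi> $$ (k, l) * (a k * a l * \<Sigma> $$ (i, i)
        + (a k * b l + b k * a l) * \<Sigma> $$ (i, j) + b k * b l * \<Sigma> $$ (j, j))) / 2))"
proof -
  interpret prob_space M by fact
  note entry = matrix_normal_entry[OF pM X S P]
  define Z where "Z r k \<omega> = X \<omega> $$ (r, k) - vec_index \<mu> r" for r k \<omega>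
  have meas[measurable]: "(\<lambda>\<omega>. X \<omega> $$ (r, k)) \<in> borel_measurable M" if "r < p" "k < n" for r k
    using entry(1)[OF that] by (simp add: gaussian_rv_def)
  have int: "integrable M (\<lambda>\<omega>. X \<omega> $$ (r, k))" if "r < p" "k < n" for r k
    using gaussian_rv_properties(1)[OF entry(1)[OF that]] .
  have int2: "integrable M (\<lambda>\<omega>. (X \<omega> $$ (r, k))\<^sup>2)" if "r < p" "k < n" for r k
    using gaussian_rv_properties(2)[OF entry(1)[OF that]] .
  have Zmeas[measurable]: "Z r k \<in> borel_measurable M" if "r < p" "k < n" for r k
    unfolding Z_def using that by measurable
  have Z2: "integrable M (\<lambda>\<omega>. (Z r k \<omega>)\<^sup>2)" if "r < p" "k < n" for r k
    unfolding Z_def power2_diff using int[OF that] int2[OF that] by simp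
  have ZZ: "integrable M (\<lambda>\<omega>. Z r k \<omega> * Z q l \<omega>)" if "r < p" "k < n" "q < p" "l < n" for r k q l
    using that by (intro integrable_mult_of_squares Z2) auto
  have cov: "(LINT \<omega>|M. Z r k \<omega> * Z q l \<omega>) = \<Psi> $$ (k, l) * \<Sigma> $$ (r, q)"
    if "r < p" "k < n" "q < p" "l < n" for r k q l
  proof -
    have "covariance M (\<lambda>\<omega>. X \<omega> $$ (r, k)) (\<lambda>\<omega>. X \<omega> $$ (q, l)) = \<Psi> $$ (k, l) * \<Sigma> $$ (r, q)"
      using X S P that by (simp add: matrix_normal_def Let_def)
    then show ?thesis
      unfolding covariance_def Z_def using entry(2) that by simp
  qed
  define u where "u k \<omega> = a k * Z i k \<omega> + b k * Z j k \<omega>" for k \<omega>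
  define L where "L \<omega> = (\<Sum>k<n. a k * X \<omega> $$ (i, k)) + (\<Sum>k<n. b k * X \<omega> $$ (j, k))" for \<omega>
  have gL: "gaussian_rv M L"
  proof -
    define C where "C t = (if fst t = i then a (snd t) else if fst t = j then b (snd t) else 0)" for t :: "nat \<times> nat"
    have "(\<Sum>t\<in>{..<p} \<times> {..<n}. C t * X \<omega> $$ t) = L \<omega>" for \<omega>
    proof -
      have "(\<Sum>t\<in>{..<p} \<times> {..<n}. C t * X \<omega> $$ t) = (\<Sum>r<p. \<Sum>k<n. C (r, k) * X \<omega> $$ (r, k))"
        by (simp add: sum.cartesian_product)
      also have "\<dots> = (\<Sum>r\<in>{i, j}. \<Sum>k<n. C (r, k) * X \<omega> $$ (r, k))"
        by (rule sum.mono_neutral_right) (use ij in \<open>auto simp: C_def\<close>)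
      finally show ?thesis using ij by (simp add: C_def L_def)
    qed
    moreover have "jointly_gaussian M ({..<p} \<times> {..<n}) (\<lambda>t \<omega>. X \<omega> $$ t)"
      using X S P by (simp add: matrix_normal_def Let_def)
    then have "gaussian_rv M (\<lambda>\<omega>. \<Sum>t\<in>{..<p} \<times> {..<n}. C t * X \<omega> $$ t)"
      unfolding jointly_gaussian_def by (rule spec)
    ultimately show ?thesis by simp
  qed
  have EL: "expectation L = (\<Sum>k<n. a k * vec_index \<mu> i) + (\<Sum>k<n. b k * vec_index \<mu> j)"
  proof -
    have row: "expectation (\<lambda>\<omega>. \<Sum>k<n. e k * X \<omega> $$ (r, k)) = (\<Sum>k<n. e k * vec_index \<mu> r)"
      "integrable M (\<lambda>\<omega>. \<Sum>k<n. e k * X \<omega> $$ (r, k))" if r: "r < p" for r e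
    proof -
      have "expectation (\<lambda>\<omega>. \<Sum>k<n. e k * X \<omega> $$ (r, k)) = (\<Sum>k<n. expectation (\<lambda>\<omega>. e k * X \<omega> $$ (r, k)))"
        by (rule Bochner_Integration.integral_sum) (use int r in auto)
      then show "expectation (\<lambda>\<omega>. \<Sum>k<n. e k * X \<omega> $$ (r, k)) = (\<Sum>k<n. e k * vec_index \<mu> r)"
        using entry(2)[OF r] by simp
      show "integrable M (\<lambda>\<omega>. \<Sum>k<n. e k * X \<omega> $$ (r, k))"
        by (intro Bochner_Integration.integrable_sum integrable_mult_right int r) auto
    qed
    show ?thesis unfolding L_def using row ij by simp
  qed
  have centred: "L \<omega> - expectation L = (\<Sum>k<n. a k * Z i k \<omega>) + (\<Sum>k<n. b k * Z j k \<omega>)" for \<omega>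
    unfolding EL L_def Z_def by (simp add: right_diff_distrib sum_subtractf)
  have "variance L = (LINT \<omega>|M. (\<Sum>k<n. \<Sum>l<n. u k \<omega> * u l \<omega>))"
    unfolding centred u_def by (simp only: sum.distrib[symmetric] power2_eq_square sum_product)
  also have "\<dots> = (\<Sum>k<n. \<Sum>l<n. LINT \<omega>|M. u k \<omega> * u l \<omega>)"
  proof (rule integral_double_sum)
    fix k l assume kl: "k < n" "l < n"
    show "integrable M (\<lambda>\<omega>. u k \<omega> * u l \<omega>)"
      unfolding u_def using ij kl
      by (intro integrable_mult_of_squares integrable_square_add) (auto simp: power_mult_distrib Z2)
  qed
  also have "\<dots> = (\<Sum>k<n. \<Sum>l<n. \<Psi> $$ (k, l) * (a k * a l * \<Sigma> $$ (i, i)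
        + (a k * b l + b k * a l) * \<Sigma> $$ (i, j) + b k * b l * \<Sigma> $$ (j, j)))"
  proof (intro sum.cong refl)
    fix k l assume "k \<in> {..<n}" "l \<in> {..<n}"
    then have kl: "k < n" "l < n" by auto
    have "u k \<omega> * u l \<omega> = a k * a l * (Z i k \<omega> * Z i l \<omega>) + a k * b l * (Z i k \<omega> * Z j l \<omega>)
      + b k * a l * (Z j k \<omega> * Z i l \<omega>) + b k * b l * (Z j k \<omega> * Z j l \<omega>)" for \<omega>
      unfolding u_def by (simp add: algebra_simps)
    then have "(LINT \<omega>|M. u k \<omega> * u l \<omega>) = a k * a l * (LINT \<omega>|M. Z i k \<omega> * Z i l \<omega>)
      + a k * b l * (LINT \<omega>|M. Z i k \<omega> * Z j l \<omega>)
      + b k * a l * (LINT \<omega>|M. Z j k \<omega> * Z i l \<omega>) + b k * b l * (LINT \<omega>|M. Z j k \<omega> * Z j l \<omega>)"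
      using ZZ ij kl by simp
    also have "\<dots> = \<Psi> $$ (k, l) * (a k * a l * \<Sigma> $$ (i, i)
        + (a k * b l + b k * a l) * \<Sigma> $$ (i, j) + b k * b l * \<Sigma> $$ (j, j))"
      by (simp only: cov ij kl sym) (simp add: algebra_simps)
    finally show "(LINT \<omega>|M. u k \<omega> * u l \<omega>) = \<Psi> $$ (k, l) * (a k * a l * \<Sigma> $$ (i, i)
        + (a k * b l + b k * a l) * \<Sigma> $$ (i, j) + b k * b l * \<Sigma> $$ (j, j))" .
  qed
  finally show ?thesis
    using gaussian_rv_properties(3)[OF gL] unfolding centred Z_def by simp
qed

text \<open>
  Two standardized Gaussian vectors with covariance \<open>P\<close> and cross covariance \<open>\<rho>P\<close> are \<open>y = \<gamma>w + \<delta>s\<close> and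
  \<open>z = \<delta>w + \<gamma>s\<close> with independent \<open>w\<close> and \<open>s\<close>: the vectors in the conclusion solve these equations. The
  symmetric choice of the coefficients is what makes the expansion of the correlation coefficient exact.
\<close>

lemma (in prob_space) decorrelate:
  fixes y z :: "nat \<Rightarrow> 'a \<Rightarrow> real"
  assumes ym: "\<And>k. k < n \<Longrightarrow> y k \<in> borel_measurable M" and zm: "\<And>k. k < n \<Longrightarrow> z k \<in> borel_measurable M"
    and cf: "\<And>a b. (CLINT \<omega>|M. iexp ((\<Sum>k<n. a k * y k \<omega>) + (\<Sum>k<n. b k * z k \<omega>)))
      = complex_of_real (exp (- (\<Sum>k<n. \<Sum>l<n. P k l * (a k * a l + (a k * b l + b k * a l) * \<rho> + b k * b l)) / 2))"
    and P_sym: "\<And>k l. k < n \<Longrightarrow> l < n \<Longrightarrow> P k l = P l k" and P_psd: "\<And>a. quad n P a \<ge> 0"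
    and gd: "\<gamma>\<^sup>2 + \<delta>\<^sup>2 = 1" "2 * \<gamma> * \<delta> = \<rho>" "\<gamma>\<^sup>2 - \<delta>\<^sup>2 \<noteq> 0"
  shows "indep_gauss M n P (\<lambda>k \<omega>. (\<gamma> * y k \<omega> - \<delta> * z k \<omega>) / (\<gamma>\<^sup>2 - \<delta>\<^sup>2)) (\<lambda>k \<omega>. (\<gamma> * z k \<omega> - \<delta> * y k \<omega>) / (\<gamma>\<^sup>2 - \<delta>\<^sup>2))"
proof
  fix a b :: "nat \<Rightarrow> real"
  define \<kappa> where "\<kappa> = \<gamma>\<^sup>2 - \<delta>\<^sup>2"
  have \<kappa>: "\<kappa> \<noteq> 0" using gd(3) by (simp add: \<kappa>_def)
  let ?a = "\<lambda>k. (\<gamma> * a k - \<delta> * b k) / \<kappa>" and ?b = "\<lambda>k. (\<gamma> * b k - \<delta> * a k) / \<kappa>"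
  have lin: "(\<Sum>k<n. a k * ((\<gamma> * y k \<omega> - \<delta> * z k \<omega>) / \<kappa>)) + (\<Sum>k<n. b k * ((\<gamma> * z k \<omega> - \<delta> * y k \<omega>) / \<kappa>))
    = (\<Sum>k<n. ?a k * y k \<omega>) + (\<Sum>k<n. ?b k * z k \<omega>)" for \<omega>
    unfolding sum.distrib[symmetric] using \<kappa> by (intro sum.cong refl) (simp add: field_simps)
  have form: "?a k * ?a l + (?a k * ?b l + ?b k * ?a l) * \<rho> + ?b k * ?b l = a k * a l + b k * b l" for k l
  proof -
    have "(\<gamma> * a k - \<delta> * b k) * (\<gamma> * a l - \<delta> * b l)
      + ((\<gamma> * a k - \<delta> * b k) * (\<gamma> * b l - \<delta> * a l) + (\<gamma> * b k - \<delta> * a k) * (\<gamma> * a l - \<delta> * b l)) * (2 * \<gamma> * \<delta>)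
      + (\<gamma> * b k - \<delta> * a k) * (\<gamma> * b l - \<delta> * a l) = (a k * a l + b k * b l) * \<kappa>\<^sup>2"
      (is "?L = _")
    proof -
      have "?L = (a k * a l + b k * b l) * ((\<gamma>\<^sup>2 + \<delta>\<^sup>2) - 4 * (\<gamma>\<^sup>2 * \<delta>\<^sup>2))
        + (a k * b l + b k * a l) * (2 * \<gamma> * \<delta>) * ((\<gamma>\<^sup>2 + \<delta>\<^sup>2) - 1)"
        by (simp add: algebra_simps power2_eq_square)
      moreover have "\<kappa>\<^sup>2 = (\<gamma>\<^sup>2 + \<delta>\<^sup>2)\<^sup>2 - 4 * (\<gamma>\<^sup>2 * \<delta>\<^sup>2)"
        unfolding \<kappa>_def by (simp add: algebra_simps power2_eq_square)
      ultimately show ?thesis using gd(1) by simp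
    qed
    then have "((\<gamma> * a k - \<delta> * b k) * (\<gamma> * a l - \<delta> * b l)
      + ((\<gamma> * a k - \<delta> * b k) * (\<gamma> * b l - \<delta> * a l) + (\<gamma> * b k - \<delta> * a k) * (\<gamma> * a l - \<delta> * b l)) * \<rho>
      + (\<gamma> * b k - \<delta> * a k) * (\<gamma> * b l - \<delta> * a l)) / \<kappa>\<^sup>2 = a k * a l + b k * b l"
      unfolding gd(2) using \<kappa> by simp
    then show ?thesis by (simp add: add_divide_distrib power2_eq_square distrib_right)
  qed
  have "(\<Sum>k<n. \<Sum>l<n. P k l * (a k * a l + b k * b l)) = quad n P a + quad n P b"
    unfolding quad_def sum.distrib[symmetric] by (intro sum.cong refl) (simp add: algebra_simps)
  then show "(CLINT \<omega>|M. iexp ((\<Sum>k<n. a k * ((\<gamma> * y k \<omega> - \<delta> * z k \<omega>) / (\<gamma>\<^sup>2 - \<delta>\<^sup>2)))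
        + (\<Sum>k<n. b k * ((\<gamma> * z k \<omega> - \<delta> * y k \<omega>) / (\<gamma>\<^sup>2 - \<delta>\<^sup>2)))))
      = complex_of_real (exp (- (quad n P a + quad n P b) / 2))"
    unfolding \<kappa>_def[symmetric] lin using cf[of ?a ?b] unfolding form by simp
qed (use ym zm P_sym P_psd in auto)

lemma sample_corr_eq_css:
  assumes x: "x \<in> carrier_mat p n" and n: "n \<ge> 2"
  shows "sample_corr x i j = css n (\<lambda>k. x $$ (i, k)) (\<lambda>k. x $$ (j, k)) /
    sqrt (css n (\<lambda>k. x $$ (i, k)) (\<lambda>k. x $$ (i, k)) * css n (\<lambda>k. x $$ (j, k)) (\<lambda>k. x $$ (j, k)))"
proof -
  have cov: "sample_cov x r q = css n (\<lambda>k. x $$ (r, k)) (\<lambda>k. x $$ (q, k)) / (real n - 1)" for r q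
    using x by (simp add: sample_cov_def sample_mean_def css_def)
  have sq: "sqrt (B / m * (C / m)) = sqrt (B * C) / m" if "m > 0" for B C m :: real
    using that by (simp add: real_sqrt_divide)
  have m: "real n - 1 > 0" using n by simp
  show ?thesis unfolding sample_corr_def cov sq[OF m] using m by simp
qed

lemma sample_corr_standardized:
  assumes n: "n > 0" and s: "s > 0" "t > 0"
  shows "css n (\<lambda>k. m + s * y k) (\<lambda>k. m' + t * z k) /
    sqrt (css n (\<lambda>k. m + s * y k) (\<lambda>k. m + s * y k) * css n (\<lambda>k. m' + t * z k) (\<lambda>k. m' + t * z k))
    = css n y z / sqrt (css n y y * css n z z)"
proof -
  have "sqrt (s * s * Y * (t * t * Z)) = s * t * sqrt (Y * Z)" for Y Z :: real
  proof -
    have "s * s * Y * (t * t * Z) = (s * t)\<^sup>2 * (Y * Z)" by (simp add: power2_eq_square mult_ac)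
    then show ?thesis using s by (simp add: real_sqrt_mult)
  qed
  then show ?thesis unfolding css_affine[OF n] using s by simp
qed

text \<open>
  The bound for a single sample size. The right-hand side depends on the law only through \<open>c\<close>, so it
  is uniform in the dimension, the mean, the covariance matrices and the chosen pair of variables.
\<close>

lemma normalized_sample_corr_cf:
  fixes c \<eta> :: real and \<Sigma> \<Psi> :: "real mat"
  assumes pM: "prob_space M" and n: "n \<ge> 2"
    and S: "covariance_matrix p \<Sigma>" and P: "covariance_matrix n \<Psi>"
    and diag: "\<And>k. k < n \<Longrightarrow> \<Psi> $$ (k, k) = 1"
    and X: "matrix_normal M X \<mu> \<Sigma> \<Psi>" and c: "c > 0"
    and lS: "lambda_min \<Sigma> > 0" and lP: "lambda_max \<Psi> \<le> c"
    and ij: "i < j" "j < p" and \<eta>: "0 < \<eta>" "\<eta> \<le> 1/2"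
  defines "T \<equiv> (\<lambda>\<omega>. let \<rho> = pearson_corr \<Sigma> i j; \<rho>hat = sample_corr (X \<omega>) i j;
      B = (frobenius_norm \<Psi>)\<^sup>2 / real n
    in sqrt (real n) * (\<rho>hat - \<rho>) / (sqrt B * (1 - \<rho>\<^sup>2)))"
  shows "T \<in> borel_measurable M"
    and "cmod ((CLINT \<omega>|M. iexp (t * T \<omega>)) - complex_of_real (exp (- t\<^sup>2 / 2)))
    \<le> \<bar>t\<bar> * ((1 + c\<^sup>2) / (2 * sqrt n) + 2 * \<eta> * ((3 + 2 * c\<^sup>2) / 2) + 8 * (c + c\<^sup>2) / sqrt n)
      + 2 * ((3 + 12 * c\<^sup>2 + 4 * c) / (2 * sqrt n)) / \<eta>
      + t\<^sup>2 / 2 * ((1 + 4 * c\<^sup>2) / (2 * sqrt n))"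
proof -
  interpret prob_space M by fact
  have i: "i < p" "j < p" "i \<noteq> j" "j \<noteq> i" and n0: "n > 0" using ij n by auto
  have Sc: "\<Sigma> \<in> carrier_mat p p" and Pc: "\<Psi> \<in> carrier_mat n n"
    using S P by (simp_all add: covariance_matrix_def)
  define si sj \<rho> where "si = sqrt (\<Sigma> $$ (i, i))" and "sj = sqrt (\<Sigma> $$ (j, j))" and "\<rho> = pearson_corr \<Sigma> i j"
  note two_i = lambda_min_pos_two_by_two[OF S lS i(1,2,3)]
  note two_j = lambda_min_pos_two_by_two[OF S lS i(2,1,4)]
  have si: "si > 0" "si * si = \<Sigma> $$ (i, i)" and sj: "sj > 0" "sj * sj = \<Sigma> $$ (j, j)"
    using two_i(1) two_j(1) by (simp_all add: si_def sj_def)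
  have \<rho>_eq: "\<Sigma> $$ (i, j) = \<rho> * (si * sj)"
    using si sj by (simp add: \<rho>_def pearson_corr_def si_def sj_def real_sqrt_mult)
  have \<rho>2: "\<rho>\<^sup>2 < 1"
  proof -
    have "\<rho>\<^sup>2 * (si * sj)\<^sup>2 < 1 * (si * sj)\<^sup>2"
      using two_i(2) unfolding \<rho>_eq si(2)[symmetric] sj(2)[symmetric]
      by (simp add: power_mult_distrib power2_eq_square mult_ac)
    then show ?thesis using si sj by (simp only: mult_less_cancel_right_pos zero_less_power mult_pos_pos)
  qed
  then have \<rho>1: "\<bar>\<rho>\<bar> < 1" by (simp add: abs_square_less_1)
  (* The solution of gamma^2 + delta^2 = 1 and 2 gamma delta = rho:
     gamma + delta and gamma - delta are the square roots of 1 + rho and 1 - rho. *)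
  define \<gamma> \<delta> where "\<gamma> = (sqrt (1 + \<rho>) + sqrt (1 - \<rho>)) / 2" and "\<delta> = (sqrt (1 + \<rho>) - sqrt (1 - \<rho>)) / 2"
  have gd: "\<gamma>\<^sup>2 + \<delta>\<^sup>2 = 1" "2 * \<gamma> * \<delta> = \<rho>" and k0: "\<gamma>\<^sup>2 - \<delta>\<^sup>2 \<noteq> 0"
  proof -
    have q: "(sqrt (1 + \<rho>))\<^sup>2 = 1 + \<rho>" "(sqrt (1 - \<rho>))\<^sup>2 = 1 - \<rho>" using \<rho>1 by auto
    have "\<gamma>\<^sup>2 + \<delta>\<^sup>2 = ((sqrt (1 + \<rho>))\<^sup>2 + (sqrt (1 - \<rho>))\<^sup>2) / 2"
      unfolding \<gamma>_def \<delta>_def by (simp add: power2_eq_square field_simps)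
    then show "\<gamma>\<^sup>2 + \<delta>\<^sup>2 = 1" unfolding q by simp
    have "2 * \<gamma> * \<delta> = ((sqrt (1 + \<rho>))\<^sup>2 - (sqrt (1 - \<rho>))\<^sup>2) / 2"
      unfolding \<gamma>_def \<delta>_def by (simp add: power2_eq_square field_simps)
    then show "2 * \<gamma> * \<delta> = \<rho>" unfolding q by simp
    have "\<gamma>\<^sup>2 - \<delta>\<^sup>2 = sqrt (1 + \<rho>) * sqrt (1 - \<rho>)"
      unfolding \<gamma>_def \<delta>_def by (simp add: power2_eq_square field_simps)
    then show "\<gamma>\<^sup>2 - \<delta>\<^sup>2 \<noteq> 0" using \<rho>1 by auto
  qed
  let ?P = "\<lambda>k l. \<Psi> $$ (k, l)"
  define y where "y k \<omega> = (X \<omega> $$ (i, k) - vec_index \<mu> i) / si" for k \<omega>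
  define z where "z k \<omega> = (X \<omega> $$ (j, k) - vec_index \<mu> j) / sj" for k \<omega>
  define w where "w k \<omega> = (\<gamma> * y k \<omega> - \<delta> * z k \<omega>) / (\<gamma>\<^sup>2 - \<delta>\<^sup>2)" for k \<omega>
  define s where "s k \<omega> = (\<gamma> * z k \<omega> - \<delta> * y k \<omega>) / (\<gamma>\<^sup>2 - \<delta>\<^sup>2)" for k \<omega>
  have meas[measurable]: "(\<lambda>\<omega>. X \<omega> $$ (r, k)) \<in> borel_measurable M" if "r < p" "k < n" for r k
    using matrix_normal_entry(1)[OF pM X Sc Pc that] by (simp add: gaussian_rv_def)
  have ym[measurable]: "y k \<in> borel_measurable M" and zm[measurable]: "z k \<in> borel_measurable M" if "k < n" for k
    unfolding y_def z_def using meas[OF i(1) that] meas[OF i(2) that] by measurable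
  have "indep_gauss M n ?P w s"
    unfolding w_def s_def
  proof (rule decorrelate[OF ym zm _ _ _ gd k0])
    fix a b
    have "(\<Sum>k<n. a k * y k \<omega>) + (\<Sum>k<n. b k * z k \<omega>)
      = (\<Sum>k<n. a k / si * (X \<omega> $$ (i, k) - vec_index \<mu> i)) + (\<Sum>k<n. b k / sj * (X \<omega> $$ (j, k) - vec_index \<mu> j))" for \<omega>
      unfolding y_def z_def by simp
    moreover have "a k / si * (a l / si) * \<Sigma> $$ (i, i) + (a k / si * (b l / sj) + b k / sj * (a l / si)) * \<Sigma> $$ (i, j)
      + b k / sj * (b l / sj) * \<Sigma> $$ (j, j) = a k * a l + (a k * b l + b k * a l) * \<rho> + b k * b l" for k l
      unfolding \<rho>_eq si(2)[symmetric] sj(2)[symmetric] using si(1) sj(1) by (simp add: field_simps)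
    ultimately show "(CLINT \<omega>|M. iexp ((\<Sum>k<n. a k * y k \<omega>) + (\<Sum>k<n. b k * z k \<omega>)))
      = complex_of_real (exp (- (\<Sum>k<n. \<Sum>l<n. ?P k l * (a k * a l + (a k * b l + b k * a l) * \<rho> + b k * b l)) / 2))"
      using matrix_normal_two_rows[OF pM X Sc Pc i(1,2,3) covariance_matrix_sym[OF S i(2,1)], of "\<lambda>k. a k / si" "\<lambda>k. b k / sj"]
      by (simp only:)
  qed (use covariance_matrix_sym[OF P] covariance_matrix_psd[OF P] in auto)
  then interpret bounded_gauss M n ?P w s c
    by (intro bounded_gauss.intro bounded_gauss_axioms.intro)
      (use n0 c diag lambda_max_operator_bound[OF P n0 lP] in auto)
  have yz: "y k \<omega> = \<gamma> * w k \<omega> + \<delta> * s k \<omega>" "z k \<omega> = \<delta> * w k \<omega> + \<gamma> * s k \<omega>" for k \<omega>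
  proof -
    have "\<gamma> * w k \<omega> + \<delta> * s k \<omega> = (\<gamma>\<^sup>2 - \<delta>\<^sup>2) * y k \<omega> / (\<gamma>\<^sup>2 - \<delta>\<^sup>2)"
      unfolding w_def s_def times_divide_eq_right add_divide_distrib[symmetric]
      by (rule arg_cong[where f="\<lambda>x. x / _"]) (simp add: power2_eq_square algebra_simps)
    then show "y k \<omega> = \<gamma> * w k \<omega> + \<delta> * s k \<omega>" using k0 by simp
    have "\<delta> * w k \<omega> + \<gamma> * s k \<omega> = (\<gamma>\<^sup>2 - \<delta>\<^sup>2) * z k \<omega> / (\<gamma>\<^sup>2 - \<delta>\<^sup>2)"
      unfolding w_def s_def times_divide_eq_right add_divide_distrib[symmetric]
      by (rule arg_cong[where f="\<lambda>x. x / _"]) (simp add: power2_eq_square algebra_simps)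
    then show "z k \<omega> = \<delta> * w k \<omega> + \<gamma> * s k \<omega>" using k0 by simp
  qed
  have gd': "\<gamma> * \<delta> + \<gamma> * \<delta> = \<rho>" "\<delta> * \<gamma> + \<delta> * \<gamma> = \<rho>" "\<gamma> * \<gamma> + \<delta> * \<delta> = 1" "\<gamma> * \<delta> = \<rho> / 2" "\<delta> * \<gamma> = \<rho> / 2"
    using gd by (simp_all add: power2_eq_square mult_ac)
  define T' where "T' \<omega> = sqrt n * ((\<rho> * (css_ww \<omega> + css_ss \<omega>) / 2 + css_ws \<omega>) /
      sqrt ((\<gamma>\<^sup>2 * css_ww \<omega> + \<delta>\<^sup>2 * css_ss \<omega> + \<rho> * css_ws \<omega>) * (\<delta>\<^sup>2 * css_ww \<omega> + \<gamma>\<^sup>2 * css_ss \<omega> + \<rho> * css_ws \<omega>)) - \<rho>)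
    / (sqrt (F\<^sup>2 / n) * (1 - \<rho>\<^sup>2))" for \<omega>
  have T_eq: "T \<omega> = T' \<omega>" if \<omega>: "\<omega> \<in> space M" for \<omega>
  proof -
    have Xc: "X \<omega> \<in> carrier_mat p n"
      using X Sc Pc \<omega> by (simp add: matrix_normal_def Let_def)
    have rows: "X \<omega> $$ (i, k) = vec_index \<mu> i + si * y k \<omega>" "X \<omega> $$ (j, k) = vec_index \<mu> j + sj * z k \<omega>" for k
      using si sj by (simp_all add: y_def z_def)
    have "sample_corr (X \<omega>) i j = css n (\<lambda>k. y k \<omega>) (\<lambda>k. z k \<omega>) / sqrt (css n (\<lambda>k. y k \<omega>) (\<lambda>k. y k \<omega>) * css n (\<lambda>k. z k \<omega>) (\<lambda>k. z k \<omega>))"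
      unfolding sample_corr_eq_css[OF Xc n] rows by (rule sample_corr_standardized[OF n0 si(1) sj(1)])
    moreover have "css n (\<lambda>k. y k \<omega>) (\<lambda>k. z k \<omega>) = \<rho> * (css_ww \<omega> + css_ss \<omega>) / 2 + css_ws \<omega>"
      unfolding yz css_combination gd' by (simp add: algebra_simps add_divide_distrib)
    moreover have "css n (\<lambda>k. y k \<omega>) (\<lambda>k. y k \<omega>) = \<gamma>\<^sup>2 * css_ww \<omega> + \<delta>\<^sup>2 * css_ss \<omega> + \<rho> * css_ws \<omega>"
      unfolding yz css_combination gd' power2_eq_square by simp
    moreover have "css n (\<lambda>k. z k \<omega>) (\<lambda>k. z k \<omega>) = \<delta>\<^sup>2 * css_ww \<omega> + \<gamma>\<^sup>2 * css_ss \<omega> + \<rho> * css_ws \<omega>"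
      unfolding yz css_combination gd' power2_eq_square by simp
    ultimately show ?thesis
      unfolding T_def T'_def Let_def \<rho>_def[symmetric] frobenius_norm_eq_frob[OF Pc] by (simp only:)
  qed
  have T'm: "T' \<in> borel_measurable M" unfolding T'_def by measurable
  then show "T \<in> borel_measurable M"
    using measurable_cong[of M T T' borel] T_eq by blast
  have "(CLINT \<omega>|M. iexp (t * T \<omega>)) = (CLINT \<omega>|M. iexp (t * T' \<omega>))"
    by (rule Bochner_Integration.integral_cong) (simp_all add: T_eq)
  then show "cmod ((CLINT \<omega>|M. iexp (t * T \<omega>)) - complex_of_real (exp (- t\<^sup>2 / 2)))
    \<le> \<bar>t\<bar> * ((1 + c\<^sup>2) / (2 * sqrt n) + 2 * \<eta> * ((3 + 2 * c\<^sup>2) / 2) + 8 * (c + c\<^sup>2) / sqrt n)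
      + 2 * ((3 + 12 * c\<^sup>2 + 4 * c) / (2 * sqrt n)) / \<eta>
      + t\<^sup>2 / 2 * ((1 + 4 * c\<^sup>2) / (2 * sqrt n))"
  proof (simp only:, intro normalized_cf_bound[OF T'm \<eta>(1)])
    fix \<omega>
    assume "\<bar>css_ww \<omega> / n - 1\<bar> + \<bar>css_ss \<omega> / n - 1\<bar> + \<bar>css_ws \<omega> / n\<bar> \<le> \<eta>"
    then show "\<bar>T' \<omega> - css_ws \<omega> / F\<bar> \<le> 2 * \<eta> * \<bar>css_ws \<omega> / F\<bar> + (css_ww \<omega> - css_ss \<omega>)\<^sup>2 / (n * F)"
      unfolding T'_def by (rule normalized_correlation_expansion[OF n0 F_pos \<rho>1 gd \<eta>(2)])
  qed
qed

lemma weak_conv_m_offset: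
  assumes "weak_conv_m (\<lambda>n. \<nu> (n + N)) \<nu>'" shows "weak_conv_m \<nu> \<nu>'"
  using assms unfolding weak_conv_m_def weak_conv_def by (blast intro: LIMSEQ_offset)

theorem proposition3p1:
  fixes M :: "nat \<Rightarrow> 'a measure"
    and p :: "nat \<Rightarrow> nat"
    and X :: "nat \<Rightarrow> 'a \<Rightarrow> real mat"
    and \<mu> :: "nat \<Rightarrow> real vec"
    and \<Sigma> \<Psi> :: "nat \<Rightarrow> real mat"
    and i j :: "nat \<Rightarrow> nat"
    and c :: real
  assumes "\<And>n. n \<ge> 1 \<Longrightarrow> prob_space (M n)"
    and "\<And>n. n \<ge> 1 \<Longrightarrow> p n \<ge> 1"
    and "\<And>n. n \<ge> 1 \<Longrightarrow> \<mu> n \<in> carrier_vec (p n)"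
    and "\<And>n. n \<ge> 1 \<Longrightarrow> covariance_matrix (p n) (\<Sigma> n)"
    and "\<And>n. n \<ge> 1 \<Longrightarrow> covariance_matrix n (\<Psi> n)"
    and "\<And>n k. n \<ge> 1 \<Longrightarrow> k < n \<Longrightarrow> \<Psi> n $$ (k, k) = 1"
    and "\<And>n. n \<ge> 1 \<Longrightarrow> matrix_normal (M n) (X n) (\<mu> n) (\<Sigma> n) (\<Psi> n)"
    and "c > 0"
    and "\<And>n. n \<ge> 1 \<Longrightarrow>
           inverse c \<le> lambda_min (\<Sigma> n) \<and>
           lambda_min (\<Sigma> n) \<le> lambda_max (\<Sigma> n) \<and> lambda_max (\<Sigma> n) \<le> c"
    and "\<And>n. n \<ge> 1 \<Longrightarrow>
           inverse c \<le> lambda_min (\<Psi> n) \<and>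
           lambda_min (\<Psi> n) \<le> lambda_max (\<Psi> n) \<and> lambda_max (\<Psi> n) \<le> c"
    and "\<forall>\<^sub>F n in sequentially. i n < j n \<and> j n < p n"
  shows "weak_conv_m
           (\<lambda>n. distr (M n) borel
              (\<lambda>\<omega>. let \<rho> = pearson_corr (\<Sigma> n) (i n) (j n);
                        \<rho>hat = sample_corr (X n \<omega>) (i n) (j n);
                        B = (frobenius_norm (\<Psi> n))\<^sup>2 / real n
                    in sqrt (real n) * (\<rho>hat - \<rho>) / (sqrt B * (1 - \<rho>\<^sup>2))))
           std_normal_distribution"
proof -
  define T where "T n = (\<lambda>\<omega>. let \<rho> = pearson_corr (\<Sigma> n) (i n) (j n);
                        \<rho>hat = sample_corr (X n \<omega>) (i n) (j n);
                        B = (frobenius_norm (\<Psi> n))\<^sup>2 / real n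
                    in sqrt (real n) * (\<rho>hat - \<rho>) / (sqrt B * (1 - \<rho>\<^sup>2)))" for n
  obtain N0 where N0: "\<And>n. n \<ge> N0 \<Longrightarrow> i n < j n \<and> j n < p n"
    using assms(11) unfolding eventually_sequentially by blast
  (* A sample covariance needs at least two observations. *)
  define N where "N = max N0 2"
  (* The error terms are of order eta and n^(-1/2) / eta; this choice balances them. *)
  define \<eta> where "\<eta> n = 1 / (2 * sqrt (sqrt (real n)))" for n
  define bound where "bound t n = \<bar>t\<bar> * ((1 + c\<^sup>2) / (2 * sqrt n) + 2 * \<eta> n * ((3 + 2 * c\<^sup>2) / 2) + 8 * (c + c\<^sup>2) / sqrt n)
      + 2 * ((3 + 12 * c\<^sup>2 + 4 * c) / (2 * sqrt n)) / \<eta> n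
      + t\<^sup>2 / 2 * ((1 + 4 * c\<^sup>2) / (2 * sqrt n))" for t and n :: nat
  have main: "T n \<in> borel_measurable (M n)"
    "cmod ((CLINT \<omega>|M n. iexp (t * T n \<omega>)) - complex_of_real (exp (- t\<^sup>2 / 2))) \<le> bound t n"
    if "n \<ge> N" for n t
  proof -
    have n: "n \<ge> 2" "n \<ge> 1" and ij: "i n < j n" "j n < p n" using that N0[of n] by (auto simp: N_def)
    have ic: "0 < lambda_min (\<Sigma> n)"
      using assms(9)[OF n(2)] assms(8) by (meson inverse_positive_iff_positive less_le_trans)
    have lP: "lambda_max (\<Psi> n) \<le> c" using assms(10)[OF n(2)] by blast
    have "1 \<le> sqrt (sqrt (real n))" using n by simp
    then have \<eta>: "0 < \<eta> n" "\<eta> n \<le> 1/2" unfolding \<eta>_def by (simp_all add: divide_le_eq)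
    note res = normalized_sample_corr_cf[OF assms(1)[OF n(2)] n(1) assms(4)[OF n(2)] assms(5)[OF n(2)]
      assms(6)[OF n(2)] assms(7)[OF n(2)] assms(8) ic lP ij \<eta>]
    show "T n \<in> borel_measurable (M n)" unfolding T_def by (rule res(1))
    show "cmod ((CLINT \<omega>|M n. iexp (t * T n \<omega>)) - complex_of_real (exp (- t\<^sup>2 / 2))) \<le> bound t n"
      unfolding T_def bound_def by (rule res(2))
  qed
  have bound0: "bound t \<longlonglongrightarrow> 0" for t
  proof -
    define \<alpha> where "\<alpha> = \<bar>t\<bar> * ((1 + c\<^sup>2) / 2 + 8 * (c + c\<^sup>2)) + t\<^sup>2 / 2 * ((1 + 4 * c\<^sup>2) / 2)"
    define \<beta> where "\<beta> = \<bar>t\<bar> * ((3 + 2 * c\<^sup>2) / 2) + 2 * (3 + 12 * c\<^sup>2 + 4 * c)"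
    have "(\<lambda>n. 1 / sqrt (real n)) \<longlonglongrightarrow> 0" "(\<lambda>n. 1 / sqrt (sqrt (real n))) \<longlonglongrightarrow> 0"
      by real_asymp+
    then have "(\<lambda>n. \<alpha> * (1 / sqrt (real n)) + \<beta> * (1 / sqrt (sqrt (real n)))) \<longlonglongrightarrow> \<alpha> * 0 + \<beta> * 0"
      by (intro tendsto_intros)
    moreover have "\<forall>\<^sub>F n in sequentially. \<alpha> * (1 / sqrt (real n)) + \<beta> * (1 / sqrt (sqrt (real n))) = bound t n"
      using eventually_gt_at_top[of 0]
    proof eventually_elim
      case (elim n)
      define q where "q = sqrt (sqrt (real n))"
      have q: "q > 0" "sqrt (real n) = q * q" using elim by (simp_all add: q_def)
      show ?case
        unfolding \<alpha>_def \<beta>_def bound_def \<eta>_def q_def[symmetric] q(2) using q(1) by (simp add: field_simps)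
    qed
    ultimately show ?thesis by (simp add: tendsto_cong)
  qed
  have "weak_conv_m (\<lambda>n. distr (M (n + N)) borel (T (n + N))) std_normal_distribution"
  proof (rule levy_continuity)
    show "real_distribution (distr (M (n + N)) borel (T (n + N)))" for n
    proof -
      interpret prob_space "M (n + N)" by (rule assms(1)) (simp add: N_def)
      show ?thesis by (intro real_distribution_distr main(1)) simp
    qed
    show "real_distribution std_normal_distribution" by (rule real_dist_normal_dist)
    fix t
    have "(\<lambda>n. char (distr (M (n + N)) borel (T (n + N))) t - char std_normal_distribution t) \<longlonglongrightarrow> 0"
    proof (rule Lim_null_comparison)
      show "(\<lambda>n. bound t (n + N)) \<longlonglongrightarrow> 0" by (rule LIMSEQ_ignore_initial_segment[OF bound0])
      have "char (distr (M (n + N)) borel (T (n + N))) t = (CLINT \<omega>|M (n + N). iexp (t * T (n + N) \<omega>))" for n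
        unfolding char_def by (rule integral_distr) (use main(1)[of "n + N"] in auto)
      then show "\<forall>\<^sub>F n in sequentially. norm (char (distr (M (n + N)) borel (T (n + N))) t - char std_normal_distribution t) \<le> bound t (n + N)"
        using main(2) by (simp add: char_std_normal_distribution)
    qed
    then show "(\<lambda>n. char (distr (M (n + N)) borel (T (n + N))) t) \<longlonglongrightarrow> char std_normal_distribution t"
      by (rule LIM_zero_cancel)
  qed
  then show ?thesis unfolding T_def by (rule weak_conv_m_offset)
qed

end
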